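(* Let $m$ be a nonnegative integer and let $$f=\sum_{\lambda\in\Lambda}\sum_{\|j\|\le m}p_{\lambda,j}D^j\delta_\lambda,\qquad g=\sum_{\gamma\in\Gamma}\sum_{\|j\|\le m}q_{\gamma,j}D^j\delta_\gamma$$ ($p_{\lambda,j},q_{\gamma,j}\in\mathbb{C}$) be temperate distributions on $\mathbb{R}^d$ with discrete supports $\Lambda=\operatorname{supp}f$, $\Gamma=\operatorname{supp}g$, such that $\hat f,\hat g$ are atomic measures and $|\hat f|,|\hat g|\in S^*(\mathbb{R}^d)$. Suppose that there are a set $E\subset\mathbb{R}^d$, a sequence of pairwise disjoint sets $\Lambda_n$ and a sequence of pairwise disjoint sets $\Gamma_n$, $n=1,2,\dots$ (some of the $\Lambda_n$ or $\Gamma_n$ may be empty), such that: (i) there exist balls $B(x_k,r_k)$, $k=1,2,\dots$, with $r_k\to\infty$, $r_k/|x_k|\to0$ and $\bigcup_{k=1}^\infty B(x_k,r_k)\subset E$; (ii) $\Lambda\cap E=\bigcup_n\Lambda_n$ and $\Gamma\cap E=\bigcup_n\Gamma_n$; (iii) for some $N<\infty$, $\ \#\{n:(\Lambda_n\cup\Gamma_n)\cap B(x,1)\ne\emptyset\}\le N$ for all $x\in E$; (iv) $\operatorname{diam}(\Lambda_n\cup\Gamma_n)\to0$ as $n\to\infty$, and for every $j$ with $\|j\|\le m$ $$\sum_{\lambda\in\Lambda_n}p_{\lambda,j}-\sum_{\gamma\in\Gamma_n}q_{\gamma,j}\to0\quad\text{as } n\to\infty;$$ (v) $\displaystyle\max_j\sup_n\sum_{\lambda\in\Lambda_n}|p_{\lambda,j}|<\infty$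 and $\displaystyle\max_j\sup_n\sum_{\gamma\in\Gamma_n}|q_{\gamma,j}|<\infty$. Then the distributions $f$ and $g$ coincide.
   Context: Here $B(x,r)=\{y\in\mathbb{R}^d:|y-x|<r\}$, $\delta_\lambda$ is the unit mass at $\lambda\in\mathbb{R}^d$, and for a multi-index $j=(j_1,\dots,j_d)\in(\mathbb{N}\cup\{0\})^d$, $\|j\|=\max\{j_1,\dots,j_d\}$ and $D^j=\partial_{x_1}^{j_1}\cdots\partial_{x_d}^{j_d}$. $S(\mathbb{R}^d)$ is the Schwartz space and $S^*(\mathbb{R}^d)$ its dual, the space of temperate (tempered) distributions. The Fourier transform is $\hat f(\varphi)=f(\hat\varphi)$ for $\varphi\in S(\mathbb{R}^d)$, where $\hat\varphi(y)=\int_{\mathbb{R}^d}\varphi(x)e^{-2\pi i\langle x,y\rangle}dx$. The support of a distribution is discrete if each of its points $\lambda$ has a ball $B(\lambda,\varepsilon)$, $\varepsilon=\varepsilon(\lambda)>0$, containing no other point of the support. Measures are complex Radon (locally finite, not necessarily finite) measures on $\mathbb{R}^d$; a measure is atomic if it has the form $\sum_{s\in A}a_s\delta_s$ with $a_s\in\mathbb{C}$ and $A$ countable; $|\cdot|$ of a measure is its total variation measure; a measure is said to belong to $S^*(\mathbb{R}^d)$ if the distribution it defines is (extends to) a temperate distribution. The diameter of the empty set and the sum over the empty set are $0$. *)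

theory Defs
  imports "HOL-Analysis.Analysis"
begin

definition mnorm :: "nat ^ 'd::finite \<Rightarrow> nat" where
  "mnorm j = Max (range (($) j))"

definition partial_deriv :: "'d::finite \<Rightarrow> (real ^ 'd \<Rightarrow> complex) \<Rightarrow> real ^ 'd \<Rightarrow> complex" where
  "partial_deriv i \<phi> x = vector_derivative (\<lambda>t. \<phi> (x + t *\<^sub>R axis i 1)) (at 0)"

definition smooth :: "(real ^ 'd::finite \<Rightarrow> complex) \<Rightarrow> bool" where
  "smooth \<phi> \<longleftrightarrow> (\<forall>is x. foldr partial_deriv is \<phi> differentiable (at x))"

text \<open>The index type carries no order, so an enumeration of the coordinates is chosen once and
  for all; on smooth functions \<open>mderiv\<close> does not depend on it.\<close>

definition coords :: "'d::finite list" where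
  "coords = (SOME is. distinct is \<and> set is = UNIV)"

definition mderiv :: "nat ^ 'd::finite \<Rightarrow> (real ^ 'd \<Rightarrow> complex) \<Rightarrow> real ^ 'd \<Rightarrow> complex" where
  "mderiv j = foldr (\<lambda>i. partial_deriv i ^^ (j $ i)) coords"

text \<open>Distributions are represented by functionals on all complex-valued functions; only their
  values on test functions (respectively Schwartz functions) are meaningful.\<close>

definition test_functions :: "(real ^ 'd::finite \<Rightarrow> complex) set" where
  "test_functions = {\<phi>. smooth \<phi> \<and> (\<exists>K. compact K \<and> (\<forall>x. x \<notin> K \<longrightarrow> \<phi> x = 0))}"

definition schwartz_seminorm ::
    "nat ^ 'd::finite \<Rightarrow> nat ^ 'd \<Rightarrow> (real ^ 'd \<Rightarrow> complex) \<Rightarrow> real" where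
  "schwartz_seminorm a b \<phi> = (SUP x. \<bar>\<Prod>i\<in>UNIV. x $ i ^ (a $ i)\<bar> * cmod (mderiv b \<phi> x))"

definition schwartz_space :: "(real ^ 'd::finite \<Rightarrow> complex) set" where
  "schwartz_space = {\<phi>. smooth \<phi> \<and>
     (\<forall>a b. bdd_above (range (\<lambda>x. \<bar>\<Prod>i\<in>UNIV. x $ i ^ (a $ i)\<bar> * cmod (mderiv b \<phi> x))))}"

definition schwartz_topology :: "(real ^ 'd::finite \<Rightarrow> complex) topology" where
  "schwartz_topology = topology_generated_by
     {{\<psi> \<in> schwartz_space. schwartz_seminorm a b (\<lambda>x. \<psi> x - \<phi> x) < e} | \<phi> a b e.
        \<phi> \<in> schwartz_space \<and> 0 < e}"

definition tempered_distribution :: "((real ^ 'd::finite \<Rightarrow> complex) \<Rightarrow> complex) \<Rightarrow> bool" where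
  "tempered_distribution f \<longleftrightarrow>
     (\<forall>\<phi>\<in>schwartz_space. \<forall>\<psi>\<in>schwartz_space. \<forall>a b.
        f (\<lambda>x. a * \<phi> x + b * \<psi> x) = a * f \<phi> + b * f \<psi>) \<and>
     continuous_map schwartz_topology euclidean f"

definition distr_support :: "((real ^ 'd::finite \<Rightarrow> complex) \<Rightarrow> complex) \<Rightarrow> (real ^ 'd) set" where
  "distr_support f = {x. \<forall>U. open U \<and> x \<in> U \<longrightarrow>
     (\<exists>\<phi>\<in>test_functions. (\<exists>K. compact K \<and> K \<subseteq> U \<and> (\<forall>y. y \<notin> K \<longrightarrow> \<phi> y = 0)) \<and> f \<phi> \<noteq> 0)}"

definition delta :: "real ^ 'd::finite \<Rightarrow> (real ^ 'd \<Rightarrow> complex) \<Rightarrow> complex" where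
  "delta s \<phi> = \<phi> s"

definition distr_deriv :: "nat ^ 'd::finite \<Rightarrow> ((real ^ 'd \<Rightarrow> complex) \<Rightarrow> complex)
    \<Rightarrow> (real ^ 'd \<Rightarrow> complex) \<Rightarrow> complex" where
  "distr_deriv j f \<phi> = (- 1) ^ (\<Sum>i\<in>UNIV. j $ i) * f (mderiv j \<phi>)"

text \<open>\<open>f\<close> is the sum over \<open>S\<close> of \<open>p s j\<close> times the \<open>j\<close>-th derivative of the unit mass at \<open>s\<close>,
  in the sense of distributions. The series need not converge on every Schwartz function; if \<open>S\<close>
  is closed and discrete, only finitely many terms are nonzero on a given test function.\<close>

definition is_delta_series :: "nat \<Rightarrow> (real ^ 'd::finite) set \<Rightarrow> (real ^ 'd \<Rightarrow> nat ^ 'd \<Rightarrow> complex)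
    \<Rightarrow> ((real ^ 'd \<Rightarrow> complex) \<Rightarrow> complex) \<Rightarrow> bool" where
  "is_delta_series m S p f \<longleftrightarrow> (\<forall>\<phi>\<in>test_functions.
     ((\<lambda>s. \<Sum>j\<in>{j. mnorm j \<le> m}. p s j * distr_deriv j (delta s) \<phi>) has_sum f \<phi>) S)"

definition fourier :: "(real ^ 'd::finite \<Rightarrow> complex) \<Rightarrow> real ^ 'd \<Rightarrow> complex" where
  "fourier \<phi> y = (LINT x|lborel. \<phi> x * exp (- 2 * complex_of_real pi * \<i> * complex_of_real (x \<bullet> y)))"

definition fourier_distr :: "((real ^ 'd::finite \<Rightarrow> complex) \<Rightarrow> complex)
    \<Rightarrow> (real ^ 'd \<Rightarrow> complex) \<Rightarrow> complex" where
  "fourier_distr f \<phi> = f (fourier \<phi>)"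

text \<open>A complex Radon measure need not be finite, so it is a set function on the bounded Borel
  sets only; countable additivity there already makes its variation locally finite.\<close>

definition bounded_borel :: "(real ^ 'd::finite) set set" where
  "bounded_borel = {B \<in> sets borel. bounded B}"

definition complex_radon_measure :: "((real ^ 'd::finite) set \<Rightarrow> complex) \<Rightarrow> bool" where
  "complex_radon_measure \<mu> \<longleftrightarrow> (\<forall>A :: nat \<Rightarrow> (real ^ 'd) set.
     range A \<subseteq> bounded_borel \<and> disjoint_family A \<and> bounded (\<Union>n. A n) \<longrightarrow>
     (\<lambda>n. \<mu> (A n)) sums \<mu> (\<Union>n. A n))"

definition atomic_measure :: "((real ^ 'd::finite) set \<Rightarrow> complex) \<Rightarrow> bool" where
  "atomic_measure \<mu> \<longleftrightarrow> complex_radon_measure \<mu> \<and>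
     (\<exists>A a. countable A \<and> (\<forall>B\<in>bounded_borel. (a has_sum \<mu> B) (A \<inter> B)))"

definition total_variation :: "((real ^ 'd::finite) set \<Rightarrow> complex) \<Rightarrow> (real ^ 'd) measure" where
  "total_variation \<mu> = measure_of UNIV (sets borel)
     (\<lambda>B. SUP P\<in>{P. finite P \<and> disjoint P \<and> P \<subseteq> bounded_borel \<and> \<Union>P \<subseteq> B}.
        \<Sum>C\<in>P. ennreal (cmod (\<mu> C)))"

text \<open>The positive part of a real set function in its Jordan decomposition; the negative part
  is the positive part of its negation.\<close>

definition positive_variation :: "((real ^ 'd::finite) set \<Rightarrow> real) \<Rightarrow> (real ^ 'd) measure" where
  "positive_variation \<rho> = measure_of UNIV (sets borel)
     (\<lambda>B. SUP C\<in>{C \<in> bounded_borel. C \<subseteq> B}. ennreal (\<rho> C))"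

definition complex_measure_integral ::
    "((real ^ 'd::finite) set \<Rightarrow> complex) \<Rightarrow> (real ^ 'd \<Rightarrow> complex) \<Rightarrow> complex" where
  "complex_measure_integral \<mu> \<phi> =
     (LINT x|positive_variation (\<lambda>B. Re (\<mu> B)). \<phi> x)
   - (LINT x|positive_variation (\<lambda>B. - Re (\<mu> B)). \<phi> x)
   + \<i> * ((LINT x|positive_variation (\<lambda>B. Im (\<mu> B)). \<phi> x)
        - (LINT x|positive_variation (\<lambda>B. - Im (\<mu> B)). \<phi> x))"

definition distr_is_measure :: "((real ^ 'd::finite \<Rightarrow> complex) \<Rightarrow> complex)
    \<Rightarrow> ((real ^ 'd) set \<Rightarrow> complex) \<Rightarrow> bool" where
  "distr_is_measure F \<mu> \<longleftrightarrow> complex_radon_measure \<mu> \<and>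
     (\<forall>\<phi>\<in>test_functions. F \<phi> = complex_measure_integral \<mu> \<phi>)"

definition tempered_measure :: "(real ^ 'd::finite) measure \<Rightarrow> bool" where
  "tempered_measure M \<longleftrightarrow> (\<exists>T. tempered_distribution T \<and>
     (\<forall>\<phi>\<in>test_functions. T \<phi> = (LINT x|M. \<phi> x)))"

end

(* A Schwartz function is a limit of test functions, and on test functions f and g are determined by
   their coefficients, which are read off from the values on translates of tensor products u of
   functions of one variable with prescribed jets at 0. Write u as the Fourier transform of v. Then
   f of the t-translate of u is the absolutely convergent exponential sum over the atoms s of the
   transform of f, with coefficients mass(s) v(s), because the temperate total variation has
   polynomial growth; the same holds for g. By (ii)-(v) the difference F of the two tends to 0 along
   t + x k for every t. Some subsequence of the translates of F by x k is uniformly Cauchy, which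
   forces F = 0.

   Only tensor products are Fourier transformed, so the Fourier analysis is one-dimensional. *)

theory Submission
  imports Defs "HOL-Library.Sublist" "HOL-Probability.Characteristic_Functions"
    "HOL-Probability.Sinc_Integral" "HOL-Real_Asymp.Real_Asymp"
begin

section \<open>Smooth functions of one real variable\<close>

text \<open>The hypotheses compare f and g only inside balls that run off to infinity, and nothing
  decays in the space variable. What carries the comparison back to an arbitrary point is that, by
  absolute convergence, finitely many frequencies describe F up to an error uniform over the whole
  space; finitely many bounded phases have a common convergent subsequence along x k, and a single
  late index then serves as a return shift. Absolute convergence has to be earned: the masses of the
  transform may have infinite total, and only their growth rate, weighed against the decay of v,
  makes the coefficients summable. Two demands on u pull against each other. It must have compact
  support, so that its translate near x k sees only points of E once r k is large. Its inverse
  transform v is then in general not compactly supported, although the measure represents the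
  transform on test functions only; this is why cutoffs at a scale R with errors of order 1/R recur
  at every level. The jets at 0 are prescribed because several derivatives of a point mass may sit
  at one point: shrinking the support of u isolates the point, and the jet selects the
  multi-index.\<close>

definition vderiv :: "(real \<Rightarrow> complex) \<Rightarrow> real \<Rightarrow> complex" where
  "vderiv u x = vector_derivative u (at x)"

definition smooth1 :: "(real \<Rightarrow> complex) \<Rightarrow> bool" where
  "smooth1 u \<longleftrightarrow> (\<forall>n x. (vderiv ^^ n) u differentiable (at x))"

text \<open>Iterated derivatives never leave a class closed under \<open>vderiv\<close>. Smoothness
  proofs thus reduce to choosing a class that is stable under one differentiation.\<close>

lemma smooth1_coinduct:
  assumes "u \<in> X" "\<And>v x. v \<in> X \<Longrightarrow> v differentiable (at x)" "\<And>v. v \<in> X \<Longrightarrow> vderiv v \<in> X"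
  shows "smooth1 u"
proof -
  have "(vderiv ^^ n) u \<in> X" for n
    by (induction n) (auto simp: assms)
  then show ?thesis using assms(2) by (auto simp: smooth1_def)
qed

lemma vderivI: "(\<And>x. (u has_vector_derivative u' x) (at x)) \<Longrightarrow> vderiv u = u'"
  by (auto simp: vderiv_def vector_derivative_at)

lemma smooth1_differentiable: "smooth1 u \<Longrightarrow> u differentiable (at x)"
  unfolding smooth1_def by (metis funpow_0)

lemma smooth1_has_vector_derivative: "smooth1 u \<Longrightarrow> (u has_vector_derivative vderiv u x) (at x)"
  unfolding vderiv_def using smooth1_differentiable vector_derivative_works by blast

lemma smooth1_vderiv: "smooth1 u \<Longrightarrow> smooth1 (vderiv u)"
  unfolding smooth1_def by (metis funpow_swap1 funpow_simps_right(2) comp_apply)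

lemma smooth1_vderiv_pow: "smooth1 u \<Longrightarrow> smooth1 ((vderiv ^^ n) u)"
  by (induction n) (auto simp: smooth1_vderiv)

lemma smooth1_continuous_on: "smooth1 u \<Longrightarrow> continuous_on S u"
  by (meson continuous_at_imp_continuous_on differentiable_imp_continuous_within smooth1_differentiable)

lemma smooth1_isCont: "smooth1 u \<Longrightarrow> isCont u x"
  using differentiable_imp_continuous_within smooth1_differentiable by blast

lemma smooth1_measurable [measurable]: "smooth1 u \<Longrightarrow> u \<in> borel_measurable borel"
  by (simp add: borel_measurable_continuous_onI smooth1_continuous_on)

lemma vderiv_add:
  assumes "smooth1 u" "smooth1 v"
  shows "vderiv (\<lambda>x. u x + v x) = (\<lambda>x. vderiv u x + vderiv v x)"
  by (rule vderivI) (intro has_vector_derivative_add smooth1_has_vector_derivative assms)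

lemma vderiv_mult:
  assumes "smooth1 u" "smooth1 v"
  shows "vderiv (\<lambda>x. u x * v x) = (\<lambda>x. u x * vderiv v x + vderiv u x * v x)"
  by (rule vderivI) (intro has_vector_derivative_mult smooth1_has_vector_derivative assms)

lemma vderiv_const: "vderiv (\<lambda>x. c) = (\<lambda>x. 0)"
  by (rule vderivI) simp

lemma smooth1_const [simp]: "smooth1 (\<lambda>x. c)"
  by (rule smooth1_coinduct[of _ "range (\<lambda>c x. c)"]) (auto simp: vderiv_const)

lemma smooth1_add:
  assumes "smooth1 u" "smooth1 v" shows "smooth1 (\<lambda>x. u x + v x)"
proof (rule smooth1_coinduct[of _ "{\<lambda>x. u x + v x |u v. smooth1 u \<and> smooth1 v}"])
  fix w assume "w \<in> {\<lambda>x. u x + v x |u v. smooth1 u \<and> smooth1 v}"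
  then obtain u v where w: "w = (\<lambda>x. u x + v x)" "smooth1 u" "smooth1 v" by blast
  show "w differentiable (at x)" for x
    unfolding w by (intro differentiable_add smooth1_differentiable w)
  show "vderiv w \<in> {\<lambda>x. u x + v x |u v. smooth1 u \<and> smooth1 v}"
    unfolding w(1) vderiv_add[OF w(2,3)] using w(2,3) smooth1_vderiv by blast
qed (use assms in blast)

text \<open>The invariant for \<open>smooth1_mult\<close>: one differentiation turns a product into
  a sum of two products, so sums have to be included for the class to be closed under
  \<open>vderiv\<close>.\<close>

inductive_set product_sums1 :: "(real \<Rightarrow> complex) set" where
  prod: "smooth1 u \<Longrightarrow> smooth1 v \<Longrightarrow> (\<lambda>x. u x * v x) \<in> product_sums1"
| sum: "u \<in> product_sums1 \<Longrightarrow> v \<in> product_sums1 \<Longrightarrow> (\<lambda>x. u x + v x) \<in> product_sums1"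

lemma smooth1_mult:
  assumes "smooth1 u" "smooth1 v" shows "smooth1 (\<lambda>x. u x * v x)"
proof (rule smooth1_coinduct[of _ product_sums1])
  show diff: "w differentiable (at x)" if "w \<in> product_sums1" for w x
    using that
    by (induction rule: product_sums1.induct)
       (simp_all add: differentiable_mult differentiable_add smooth1_differentiable)
  show "vderiv w \<in> product_sums1" if "w \<in> product_sums1" for w
    using that
  proof (induction rule: product_sums1.induct)
    case (prod u v)
    then show ?case
      by (subst vderiv_mult) (auto intro!: product_sums1.intros simp: smooth1_vderiv)
  next
    case (sum u v)
    have "vderiv (\<lambda>x. u x + v x) = (\<lambda>x. vderiv u x + vderiv v x)"
      using sum diff by (auto simp: fun_eq_iff vderiv_def vector_derivative_add_at)
    then show ?case using sum by (auto intro!: product_sums1.intros)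
  qed
qed (use assms product_sums1.prod in auto)

lemma smooth1_cmult: "smooth1 u \<Longrightarrow> smooth1 (\<lambda>x. c * u x)"
  by (simp add: smooth1_mult)

lemma smooth1_of_real: "smooth1 of_real"
proof (rule smooth1_coinduct[of _ "insert of_real (range (\<lambda>c x. c))"])
  have "vderiv of_real = (\<lambda>x. 1)"
    by (rule vderivI) (simp add: has_vector_derivative_of_real[of "\<lambda>x. x" 1, simplified])
  then show "vderiv v \<in> insert of_real (range (\<lambda>c x. c))"
    if "v \<in> insert complex_of_real (range (\<lambda>c x. c))" for v
    using that by (auto simp: vderiv_const)
  show "v differentiable (at x)" if "v \<in> insert complex_of_real (range (\<lambda>c x. c))" for v x
    using that 
    by (auto intro!: differentiableI_vector[OF has_vector_derivative_of_real[of "\<lambda>x. x" 1, simplified]])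
qed simp

lemma smooth1_power: "smooth1 u \<Longrightarrow> smooth1 (\<lambda>x. u x ^ n)"
  by (induction n) (simp_all add: smooth1_mult)

lemma smooth1_affine:
  assumes "smooth1 u" shows "smooth1 (\<lambda>x. u (a * x + b))"
    and vderiv_affine: "vderiv (\<lambda>x. u (a * x + b)) = (\<lambda>x. of_real a * vderiv u (a * x + b))"
proof -
  have d: "((\<lambda>x. c * u (a * x + b)) has_vector_derivative c * of_real a * vderiv u (a * x + b)) (at x)"
    if "smooth1 u" for u c x
  proof -
    have "(u \<circ> (\<lambda>x. a * x + b) has_vector_derivative a *\<^sub>R vderiv u (a * x + b)) (at x)"
      by (rule vector_diff_chain_at)
         (auto intro!: smooth1_has_vector_derivative that derivative_eq_intros
           simp flip: has_real_derivative_iff_has_vector_derivative)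
    from has_vector_derivative_mult_right[OF this, of c] show ?thesis
      by (simp add: o_def scaleR_conv_of_real mult.assoc)
  qed
  show "vderiv (\<lambda>x. u (a * x + b)) = (\<lambda>x. of_real a * vderiv u (a * x + b))"
    using d[OF assms, of 1] by (intro vderivI) simp
  show "smooth1 (\<lambda>x. u (a * x + b))"
  \<comment> \<open>Each differentiation releases a factor \<open>a\<close>, so the invariant class
    carries a constant \<open>c\<close> and an arbitrary smooth \<open>u\<close>.\<close>
  proof (rule smooth1_coinduct[of _ "{\<lambda>x. c * u (a * x + b) | c u. smooth1 u}"])
    show "(\<lambda>x. u (a * x + b)) \<in> {\<lambda>x. c * u (a * x + b) | c u. smooth1 u}"
      using assms by (force intro!: exI[of _ 1])
    show "v differentiable (at x)" if "v \<in> {\<lambda>x. c * u (a * x + b) | c u. smooth1 u}" for v x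
      using that d differentiableI_vector by blast
    show "vderiv v \<in> {\<lambda>x. c * u (a * x + b) | c u. smooth1 u}"
      if v: "v \<in> {\<lambda>x. c * u (a * x + b) | c u. smooth1 u}" for v
    proof -
      obtain c u where "v = (\<lambda>x. c * u (a * x + b))" "smooth1 u" using v by blast
      then have "vderiv v = (\<lambda>x. c * of_real a * vderiv u (a * x + b))" "smooth1 (vderiv u)"
        using d by (auto intro!: vderivI smooth1_vderiv)
      then show ?thesis by blast
    qed
  qed
qed

lemma has_vector_derivative_exp_mult:
  "((\<lambda>x. c * exp (k * complex_of_real x)) has_vector_derivative c * k * exp (k * of_real x)) (at x)"
proof -
  have "((\<lambda>z. c * exp (k * z)) has_field_derivative c * k * exp (k * of_real x)) (at (of_real x))"
    by (auto intro!: derivative_eq_intros)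
  from has_vector_derivative_real_field[OF this] show ?thesis by simp
qed

lemma vderiv_exp: "vderiv (\<lambda>x. exp (k * of_real x)) = (\<lambda>x. k * exp (k * of_real x))"
  by (rule vderivI) (use has_vector_derivative_exp_mult[of 1 k] in simp)

lemma smooth1_exp: "smooth1 (\<lambda>x. exp (k * of_real x))"
proof (rule smooth1_coinduct[of _ "range (\<lambda>c x. c * exp (k * of_real x))"])
  show "(\<lambda>x. exp (k * of_real x)) \<in> range (\<lambda>c x. c * exp (k * of_real x))"
    by (rule image_eqI[of _ _ 1]) auto
  show "v differentiable (at x)" if "v \<in> range (\<lambda>c x. c * exp (k * of_real x))" for v x
    using that has_vector_derivative_exp_mult differentiableI_vector by blast
  show "vderiv v \<in> range (\<lambda>c x. c * exp (k * of_real x))"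
    if "v \<in> range (\<lambda>c x. c * exp (k * of_real x))" for v
    using that vderivI[OF has_vector_derivative_exp_mult] by auto
qed

section \<open>Higher derivatives of sums, multiples and affine substitutions\<close>

lemma vderiv_pow_add:
  assumes "smooth1 u" "smooth1 v"
  shows "(vderiv ^^ n) (\<lambda>x. u x + v x) = (\<lambda>x. (vderiv ^^ n) u x + (vderiv ^^ n) v x)"
  by (induction n) (simp_all add: vderiv_add smooth1_vderiv_pow assms)

lemma vderiv_pow_cmult:
  assumes "smooth1 u"
  shows "(vderiv ^^ n) (\<lambda>x. c * u x) = (\<lambda>x. c * (vderiv ^^ n) u x)"
  by (induction n) (simp_all add: vderiv_mult vderiv_const smooth1_vderiv_pow assms)

lemma vderiv_pow_affine:
  assumes "smooth1 u"
  shows "(vderiv ^^ n) (\<lambda>x. u (a * x + b)) = (\<lambda>x. of_real a ^ n * (vderiv ^^ n) u (a * x + b))"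
proof (induction n)
  case (Suc n)
  have "vderiv (\<lambda>x. of_real a ^ n * (vderiv ^^ n) u (a * x + b))
      = (\<lambda>x. of_real a ^ n * vderiv (\<lambda>x. (vderiv ^^ n) u (a * x + b)) x)"
    by (simp add: vderiv_mult vderiv_const smooth1_affine smooth1_vderiv_pow assms)
  also have "\<dots> = (\<lambda>x. of_real a ^ Suc n * (vderiv ^^ Suc n) u (a * x + b))"
    by (simp add: vderiv_affine smooth1_vderiv_pow assms mult.assoc mult.left_commute)
  finally show ?case using Suc by simp
qed simp

lemma vderiv_cong_open:
  assumes "open S" "x \<in> S" "\<And>y. y \<in> S \<Longrightarrow> u y = v y"
  shows "vderiv u x = vderiv v x"
  unfolding vderiv_def
  by (rule vector_derivative_cong_eq) (use assms in \<open>auto simp: eventually_nhds\<close>)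

lemma vderiv_pow_cong_open:
  assumes "open S" "\<And>y. y \<in> S \<Longrightarrow> u y = v y" "x \<in> S"
  shows "(vderiv ^^ n) u x = (vderiv ^^ n) v x"
  using assms(3)
  by (induction n arbitrary: x) (auto intro!: vderiv_cong_open[OF assms(1)] simp: assms(2))

subsection \<open>A smooth cutoff function\<close>

text \<open>For k = 0 this is the classical function that vanishes to infinite order at 0; larger k
  give the terms that arise on differentiating it, so that the whole family spans a class closed
  under differentiation.\<close>

definition flat :: "nat \<Rightarrow> real \<Rightarrow> real" where
  "flat k x = (if x > 0 then (1 / x) ^ k * exp (- (1 / x)) else 0)"

lemma flat_deriv: "(flat k has_real_derivative flat (k + 2) x - k * flat (k + 1) x) (at x)"
proof -
  consider "x > 0" | "x < 0" | "x = 0" by linarith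
  then show ?thesis
  proof cases
    case 1
    have "((\<lambda>x. (1 / x) ^ k * exp (- (1 / x))) has_real_derivative flat (k + 2) x - k * flat (k + 1) x) (at x)"
    proof (rule DERIV_cong)
      show "((\<lambda>x. (1 / x) ^ k * exp (- (1 / x))) has_real_derivative
          k * (1 / x) ^ (k - 1) * (- (1 / x\<^sup>2)) * exp (- (1 / x)) + (1 / x) ^ k * (exp (- (1 / x)) * (1 / x\<^sup>2))) (at x)"
        using 1 by (auto intro!: derivative_eq_intros simp: power2_eq_square)
      show "k * (1 / x) ^ (k - 1) * (- (1 / x\<^sup>2)) * exp (- (1 / x)) + (1 / x) ^ k * (exp (- (1 / x)) * (1 / x\<^sup>2))
          = flat (k + 2) x - k * flat (k + 1) x"
        using 1 by (cases k) (auto simp: flat_def power2_eq_square algebra_simps add_divide_distrib)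
    qed
    then show ?thesis
      by (rule has_field_derivative_transform_within_open[where S = "{0<..}"]) (use 1 in \<open>auto simp: flat_def\<close>)
  next
    case 2
    have "((\<lambda>x. 0) has_real_derivative flat (k + 2) x - k * flat (k + 1) x) (at x)"
      using 2 by (auto simp: flat_def)
    then show ?thesis
      by (rule has_field_derivative_transform_within_open[where S = "{..<0}"]) (use 2 in \<open>auto simp: flat_def\<close>)
  next
    case 3
    \<comment> \<open>With s = 1/h the right difference quotient at 0 is s^(k + 1) / exp s, which
      tends to 0; the left one is identically 0.\<close>
    have "((\<lambda>h. inverse h ^ (k + 1) / exp (inverse h)) \<longlongrightarrow> (0::real)) (at_right 0)"
      by (rule filterlim_compose[OF tendsto_power_div_exp_0 filterlim_inverse_at_top_right])
    then have r: "((\<lambda>h. flat k h / h) \<longlongrightarrow> 0) (at_right 0)"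
      by (rule Lim_transform_eventually)
         (auto simp: flat_def eventually_at_filter exp_minus field_simps)
    have l: "((\<lambda>h. flat k h / h) \<longlongrightarrow> 0) (at_left 0)"
      by (rule Lim_transform_eventually[OF tendsto_const])
         (auto simp: flat_def eventually_at_filter)
    from l r show ?thesis
      using 3 by (simp add: has_field_derivative_iff filterlim_at_split flat_def)
  qed
qed

inductive_set flat_span :: "(real \<Rightarrow> complex) set" where
  base: "(\<lambda>x. of_real (flat k x)) \<in> flat_span"
| add: "u \<in> flat_span \<Longrightarrow> v \<in> flat_span \<Longrightarrow> (\<lambda>x. u x + v x) \<in> flat_span"
| cmult: "u \<in> flat_span \<Longrightarrow> (\<lambda>x. c * u x) \<in> flat_span"

lemma smooth1_flat: "smooth1 (\<lambda>x. of_real (flat k x))"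
proof (rule smooth1_coinduct[of _ flat_span])
  have d: "((\<lambda>x. of_real (flat k x)) has_vector_derivative
      complex_of_real (flat (k + 2) x) + (- of_nat k) * of_real (flat (k + 1) x)) (at x)" for k x
  proof -
    have "((\<lambda>x. of_real (flat k x)) has_vector_derivative
        complex_of_real (flat (k + 2) x - k * flat (k + 1) x)) (at x)"
      by (rule has_vector_derivative_of_real[OF flat_deriv])
    then show ?thesis by simp
  qed
  show diff: "w differentiable (at x)" if "w \<in> flat_span" for w x
    using that
    by (induction rule: flat_span.induct)
       (auto intro!: differentiable_mult differentiable_add d[THEN differentiableI_vector])
  show "vderiv w \<in> flat_span" if "w \<in> flat_span" for w
    using that
  proof (induction rule: flat_span.induct)
    case (base k)
    show ?case unfolding vderivI[OF d] by (intro flat_span.intros)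
  next
    case (add u v)
    have "vderiv (\<lambda>x. u x + v x) = (\<lambda>x. vderiv u x + vderiv v x)"
      using add diff by (auto simp: fun_eq_iff vderiv_def vector_derivative_add_at)
    then show ?case using add by (auto intro!: flat_span.intros)
  next
    case (cmult u c)
    have "vderiv (\<lambda>x. c * u x) = (\<lambda>x. c * vderiv u x)"
      using cmult diff by (auto simp: fun_eq_iff vderiv_def vector_derivative_mult_at)
    then show ?case using cmult by (auto intro!: flat_span.intros)
  qed
qed (rule flat_span.base)

text \<open>The bump \<open>b\<close> lives on (0, 1), and its antiderivative \<open>B\<close> rises
  there from 0 to the constant \<open>c\<close>. In the product of \<open>B (x + 2)\<close> and
  \<open>B (2 - x)\<close> both factors have reached \<open>c\<close> when |x| <= 1, and one of them
  is still 0 when |x| >= 2.\<close>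

lemma smooth_cutoff_exists:
  obtains \<kappa> :: "real \<Rightarrow> real"
  where "smooth1 (\<lambda>x. of_real (\<kappa> x))" "\<And>x. 0 \<le> \<kappa> x" "\<And>x. \<kappa> x \<le> 1"
    "\<And>x. \<bar>x\<bar> \<le> 1 \<Longrightarrow> \<kappa> x = 1" "\<And>x. \<bar>x\<bar> \<ge> 2 \<Longrightarrow> \<kappa> x = 0"
proof -
  define b :: "real \<Rightarrow> real" where "b x = flat 0 x * flat 0 (1 - x)" for x
  have b_nonneg: "b x \<ge> 0" for x by (auto simp: b_def flat_def)
  have b0: "b x = 0" if "x \<le> 0 \<or> x \<ge> 1" for x using that by (auto simp: b_def flat_def)
  have b_pos: "b (1/2) > 0" by (auto simp: b_def flat_def)
  have smb: "smooth1 (\<lambda>x. of_real (b x))"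
    using smooth1_mult[OF smooth1_flat smooth1_affine(1)[OF smooth1_flat, of 0 "-1" 1], of 0]
    by (simp add: b_def add.commute)
  have contb: "continuous_on S b" for S
    using continuous_on_Re[OF smooth1_continuous_on[OF smb, of S]] by simp
  \<comment> \<open>Since \<open>b\<close> vanishes on x <= 0, any starting point there gives the
    same function; a point strictly below 0 puts every x >= 0, including 0 itself, in the interior
    of the interval on which the integral is differentiated.\<close>
  define B where "B x = integral {-1..x} b" for x
  have B_neg: "B x = 0" if "x \<le> 0" for x
    unfolding B_def by (rule integral_unique, rule has_integral_is_0) (use b0 that in auto)
  have dB: "(B has_real_derivative b x) (at x)" for x
  proof (cases "x < 0")
    case True
    have "((\<lambda>x. 0) has_real_derivative b x) (at x)" using True b0 by auto
    then show ?thesis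
      by (rule has_field_derivative_transform_within_open[where S = "{..<0}"]) (use True B_neg in auto)
  next
    case False
    have "(B has_vector_derivative b x) (at x within {-1..x+1})"
      unfolding B_def by (rule integral_has_vector_derivative) (use False contb in auto)
    then have "(B has_vector_derivative b x) (at x)"
      using False by (subst (asm) at_within_interior) auto
    then show ?thesis by (simp add: has_real_derivative_iff_has_vector_derivative)
  qed
  have mono: "B x \<le> B y" if "x \<le> y" for x y
    by (rule deriv_nonneg_imp_mono[OF dB b_nonneg that])
  have const: "B x = B 1" if "x \<ge> 1" for x
  proof -
    have "B x \<le> B 1"
    proof (rule DERIV_nonpos_imp_nonincreasing[OF that])
      show "\<exists>y. (B has_real_derivative y) (at z) \<and> y \<le> 0" if "1 \<le> z" "z \<le> x" for z
        using dB[of z] b0[of z] that by auto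
    qed
    with mono[OF that] show ?thesis by simp
  qed
  define c where "c = B 1"
  \<comment> \<open>Otherwise monotonicity would force \<open>B\<close> to vanish on (0, 1), against
    its derivative \<open>b\<close> being positive at 1/2.\<close>
  have "c > 0"
  proof (rule ccontr)
    assume "\<not> c > 0"
    have "B x = 0" if "x \<in> {0<..<1}" for x
      using mono[of 0 x] mono[of x 1] B_neg[of 0] \<open>\<not> c > 0\<close> that by (auto simp: c_def)
    moreover have "((\<lambda>x. 0) has_real_derivative 0) (at (1/2))" by auto
    ultimately have "(B has_real_derivative 0) (at (1/2))"
      by (auto intro: has_field_derivative_transform_within_open[where S = "{0<..<1}" and f = "\<lambda>_. 0"])
    with dB[of "1/2"] have "b (1/2) = 0" by (rule DERIV_unique)
    with b_pos show False by simp
  qed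
  have B_range: "0 \<le> B x" "B x \<le> c" for x
    using mono[of 0 x] B_neg[of x] B_neg[of 0] const[of x] mono[of x 1]
    by (cases "x \<le> 0"; cases "x \<ge> 1"; auto simp: c_def)+
  have smB: "smooth1 (\<lambda>x. of_real (B x))"
  proof (rule smooth1_coinduct[of _ "insert (\<lambda>x. of_real (B x)) (Collect smooth1)"])
    have "vderiv (\<lambda>x. of_real (B x)) = (\<lambda>x. of_real (b x))"
      by (intro vderivI has_vector_derivative_of_real dB)
    then show "vderiv v \<in> insert (\<lambda>x. of_real (B x)) (Collect smooth1)"
      if "v \<in> insert (\<lambda>x. of_real (B x)) (Collect smooth1)" for v
      using that smb smooth1_vderiv by auto
    show "v differentiable (at x)" if "v \<in> insert (\<lambda>x. of_real (B x)) (Collect smooth1)" for v x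
      using that smooth1_differentiable differentiableI_vector[OF has_vector_derivative_of_real[OF dB]] by auto
  qed simp
  have "smooth1 (\<lambda>x. (1 / of_real (c\<^sup>2)) * (of_real (B (1 * x + 2)) * of_real (B ((-1) * x + 2))))"
    by (intro smooth1_cmult smooth1_mult smooth1_affine(1)[OF smB])
  then have sm: "smooth1 (\<lambda>x. of_real (B (x + 2) * B (2 - x) / c\<^sup>2))"
    by (simp add: field_simps)
  show ?thesis
  proof (rule that[OF sm])
    fix x :: real
    show "0 \<le> B (x + 2) * B (2 - x) / c\<^sup>2" using B_range by simp
    have "B (x + 2) * B (2 - x) \<le> c * c" by (intro mult_mono B_range) (use \<open>c > 0\<close> in auto)
    then show "B (x + 2) * B (2 - x) / c\<^sup>2 \<le> 1"
      using \<open>c > 0\<close> by (simp add: power2_eq_square)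
    show "B (x + 2) * B (2 - x) / c\<^sup>2 = 1" if "\<bar>x\<bar> \<le> 1"
      using that const[of "x + 2"] const[of "2 - x"] \<open>c > 0\<close> by (simp add: c_def power2_eq_square)
    show "B (x + 2) * B (2 - x) / c\<^sup>2 = 0" if "\<bar>x\<bar> \<ge> 2"
      using that B_neg[of "x + 2"] B_neg[of "2 - x"] by (cases "x \<ge> 0") auto
  qed
qed

section \<open>The Fourier transform on the Schwartz space of the line\<close>

definition schwartz1 :: "(real \<Rightarrow> complex) \<Rightarrow> bool" where
  "schwartz1 v \<longleftrightarrow> smooth1 v \<and> (\<forall>a b. \<exists>C. \<forall>x. \<bar>x\<bar> ^ a * cmod ((vderiv ^^ b) v x) \<le> C)"

definition bounded_derivs1 :: "(real \<Rightarrow> complex) \<Rightarrow> bool" where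
  "bounded_derivs1 \<eta> \<longleftrightarrow> smooth1 \<eta> \<and> (\<forall>b. \<exists>C. \<forall>x. cmod ((vderiv ^^ b) \<eta> x) \<le> C)"

definition test1 :: "(real \<Rightarrow> complex) \<Rightarrow> bool" where
  "test1 u \<longleftrightarrow> smooth1 u \<and> (\<exists>\<rho>. \<forall>x. \<rho> < \<bar>x\<bar> \<longrightarrow> u x = 0)"

lemma schwartz1_smooth1: "schwartz1 v \<Longrightarrow> smooth1 v"
  by (simp add: schwartz1_def)

lemma schwartz1_bound:
  assumes "schwartz1 v" shows "\<exists>C. \<forall>x. \<bar>x\<bar> ^ a * cmod ((vderiv ^^ b) v x) \<le> C"
  using assms unfolding schwartz1_def by blast

lemma schwartz1_vderiv: "schwartz1 v \<Longrightarrow> schwartz1 (vderiv v)"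
  unfolding schwartz1_def by (metis smooth1_vderiv funpow_swap1 funpow_simps_right(2) comp_apply)

lemma schwartz1_vderiv_pow: "schwartz1 v \<Longrightarrow> schwartz1 ((vderiv ^^ n) v)"
  by (induction n) (auto simp: schwartz1_vderiv)

section \<open>Multipliers of the one-dimensional Schwartz space\<close>

lemma schwartz1_cmult:
  assumes "schwartz1 v" shows "schwartz1 (\<lambda>x. c * v x)"
  unfolding schwartz1_def
proof (intro conjI allI)
  show "smooth1 (\<lambda>x. c * v x)" using assms by (simp add: schwartz1_smooth1 smooth1_cmult)
  fix a b
  obtain C where C: "\<And>x. \<bar>x\<bar> ^ a * cmod ((vderiv ^^ b) v x) \<le> C"
    using schwartz1_bound[OF assms] by blast
  have "\<bar>x\<bar> ^ a * cmod ((vderiv ^^ b) (\<lambda>x. c * v x) x) \<le> cmod c * C" for x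
    using mult_left_mono[OF C[of x], of "cmod c"] assms
    by (simp add: vderiv_pow_cmult schwartz1_smooth1 norm_mult mult_ac)
  then show "\<exists>C. \<forall>x. \<bar>x\<bar> ^ a * cmod ((vderiv ^^ b) (\<lambda>x. c * v x) x) \<le> C" by blast
qed

text \<open>The second derivative of the linear factor is 0, so only two Leibniz terms survive. At n
  = 0 the truncated index n - 1 is harmless because its coefficient is 0.\<close>

lemma vderiv_pow_mult_of_real:
  assumes "smooth1 v"
  shows "(vderiv ^^ n) (\<lambda>x. of_real x * v x)
    = (\<lambda>x. of_real x * (vderiv ^^ n) v x + of_nat n * (vderiv ^^ (n - 1)) v x)"
proof (induction n)
  case (Suc n)
  have x: "vderiv complex_of_real = (\<lambda>x. 1)"
    by (rule vderivI) (simp add: has_vector_derivative_of_real[of "\<lambda>x. x" 1, simplified])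
  have d: "vderiv (\<lambda>x. of_real x * (vderiv ^^ n) v x + of_nat n * (vderiv ^^ (n - 1)) v x)
      = (\<lambda>x. of_real x * vderiv ((vderiv ^^ n) v) x + (vderiv ^^ n) v x
            + of_nat n * vderiv ((vderiv ^^ (n - 1)) v) x)"
    using assms by (simp add: vderiv_add vderiv_mult vderiv_const smooth1_mult smooth1_of_real
        smooth1_vderiv_pow x)
  have "(vderiv ^^ Suc n) (\<lambda>x. of_real x * v x) = (\<lambda>x. of_real x * vderiv ((vderiv ^^ n) v) x
      + (vderiv ^^ n) v x + of_nat n * vderiv ((vderiv ^^ (n - 1)) v) x)"
    by (simp only: funpow.simps comp_apply Suc d)
  also have "\<dots> = (\<lambda>x. of_real x * (vderiv ^^ Suc n) v x + of_nat (Suc n) * (vderiv ^^ (Suc n - 1)) v x)"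
    by (cases n) (simp_all add: fun_eq_iff algebra_simps)
  finally show ?case .
qed simp

lemma schwartz1_mult_of_real:
  assumes "schwartz1 v" shows "schwartz1 (\<lambda>x. of_real x * v x)"
  unfolding schwartz1_def
proof (intro conjI allI)
  show "smooth1 (\<lambda>x. of_real x * v x)"
    using assms by (simp add: schwartz1_smooth1 smooth1_mult smooth1_of_real)
  fix a b
  obtain C where C: "\<And>x. \<bar>x\<bar> ^ Suc a * cmod ((vderiv ^^ b) v x) \<le> C"
    using schwartz1_bound[OF assms] by blast
  obtain D where D: "\<And>x. \<bar>x\<bar> ^ a * cmod ((vderiv ^^ (b - 1)) v x) \<le> D"
    using schwartz1_bound[OF assms] by blast
  have "\<bar>x\<bar> ^ a * cmod ((vderiv ^^ b) (\<lambda>x. of_real x * v x) x) \<le> C + b * D" for x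
  proof -
    have "\<bar>x\<bar> ^ a * cmod ((vderiv ^^ b) (\<lambda>x. of_real x * v x) x)
        \<le> \<bar>x\<bar> ^ a * (\<bar>x\<bar> * cmod ((vderiv ^^ b) v x) + b * cmod ((vderiv ^^ (b - 1)) v x))"
      using assms by (intro mult_left_mono)
        (auto simp: vderiv_pow_mult_of_real schwartz1_smooth1 norm_mult intro!: norm_triangle_le)
    also have "\<dots> \<le> C + b * D"
      using C[of x] mult_left_mono[OF D[of x], of "real b"] by (simp add: distrib_left mult_ac)
    finally show ?thesis .
  qed
  then show "\<exists>C. \<forall>x. \<bar>x\<bar> ^ a * cmod ((vderiv ^^ b) (\<lambda>x. of_real x * v x) x) \<le> C" by blast
qed

lemma bounded_derivs1_vderiv: "bounded_derivs1 v \<Longrightarrow> bounded_derivs1 (vderiv v)"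
  unfolding bounded_derivs1_def by (metis smooth1_vderiv funpow_swap1 funpow_simps_right(2) comp_apply)

lemma bounded_derivs1_affine:
  assumes "bounded_derivs1 \<eta>" shows "bounded_derivs1 (\<lambda>x. \<eta> (a * x + b))"
  unfolding bounded_derivs1_def
proof (intro conjI allI)
  show "smooth1 (\<lambda>x. \<eta> (a * x + b))" using assms by (simp add: bounded_derivs1_def smooth1_affine)
  fix n
  obtain C where C: "\<And>x. cmod ((vderiv ^^ n) \<eta> x) \<le> C"
    using assms by (auto simp: bounded_derivs1_def)
  have "cmod ((vderiv ^^ n) (\<lambda>x. \<eta> (a * x + b)) x) \<le> \<bar>a\<bar> ^ n * C" for x
    using assms C by (auto simp: bounded_derivs1_def vderiv_pow_affine norm_mult norm_power
        intro!: mult_left_mono)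
  then show "\<exists>C. \<forall>x. cmod ((vderiv ^^ n) (\<lambda>x. \<eta> (a * x + b)) x) \<le> C" by blast
qed

lemma vderiv_pow_Suc_mult:
  assumes "smooth1 u" "smooth1 v"
  shows "(vderiv ^^ Suc n) (\<lambda>x. u x * v x)
    = (\<lambda>x. (vderiv ^^ n) (\<lambda>x. u x * vderiv v x) x + (vderiv ^^ n) (\<lambda>x. vderiv u x * v x) x)"
  by (simp only: funpow_Suc_right comp_apply vderiv_mult[OF assms])
     (intro vderiv_pow_add smooth1_mult smooth1_vderiv assms)

text \<open>One derivative splits the product into two products of the same kind, so the induction
  on \<open>b\<close> closes once both factors are kept arbitrary.\<close>

lemma schwartz1_bounded_mult:
  assumes "bounded_derivs1 \<eta>" "schwartz1 v" shows "schwartz1 (\<lambda>x. \<eta> x * v x)"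
  unfolding schwartz1_def
proof (intro conjI allI)
  show "smooth1 (\<lambda>x. \<eta> x * v x)"
    using assms by (simp add: schwartz1_smooth1 smooth1_mult bounded_derivs1_def)
  fix a b show "\<exists>C. \<forall>x. \<bar>x\<bar> ^ a * cmod ((vderiv ^^ b) (\<lambda>x. \<eta> x * v x) x) \<le> C"
    using assms
  proof (induction b arbitrary: \<eta> v)
    case 0
    obtain C where C: "\<And>x. cmod ((vderiv ^^ 0) \<eta> x) \<le> C"
      using 0(1) unfolding bounded_derivs1_def by blast
    obtain D where D: "\<And>x. \<bar>x\<bar> ^ a * cmod ((vderiv ^^ 0) v x) \<le> D"
      using schwartz1_bound[OF 0(2)] by blast
    have "\<bar>x\<bar> ^ a * cmod (\<eta> x * v x) \<le> C * D" for x
      using mult_mono[OF C[of x] D[of x]] order.trans[OF norm_ge_zero C[of x]]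
      by (simp add: norm_mult mult_ac)
    then show ?case by auto
  next
    case (Suc b)
    obtain C where C: "\<And>x. \<bar>x\<bar> ^ a * cmod ((vderiv ^^ b) (\<lambda>x. \<eta> x * vderiv v x) x) \<le> C"
      using Suc.IH[OF Suc.prems(1) schwartz1_vderiv[OF Suc.prems(2)]] by blast
    obtain D where D: "\<And>x. \<bar>x\<bar> ^ a * cmod ((vderiv ^^ b) (\<lambda>x. vderiv \<eta> x * v x) x) \<le> D"
      using Suc.IH[OF bounded_derivs1_vderiv[OF Suc.prems(1)] Suc.prems(2)] by blast
    have "\<bar>x\<bar> ^ a * cmod ((vderiv ^^ Suc b) (\<lambda>x. \<eta> x * v x) x) \<le> C + D" for x
    proof -
      have "\<bar>x\<bar> ^ a * cmod ((vderiv ^^ Suc b) (\<lambda>x. \<eta> x * v x) x)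
          \<le> \<bar>x\<bar> ^ a * (cmod ((vderiv ^^ b) (\<lambda>x. \<eta> x * vderiv v x) x)
              + cmod ((vderiv ^^ b) (\<lambda>x. vderiv \<eta> x * v x) x))"
        using Suc.prems by (subst vderiv_pow_Suc_mult)
          (auto simp: bounded_derivs1_def schwartz1_smooth1 norm_triangle_ineq intro!: mult_left_mono)
      also have "\<dots> \<le> C + D" using C[of x] D[of x] by (simp add: distrib_left)
      finally show ?thesis .
    qed
    then show ?case by blast
  qed
qed

text \<open>The class of admissible \<open>\<eta>\<close> is closed under differentiation, so that no Leibniz formula
  is needed.\<close>

lemma schwartz1_dilated_mult_bound:
  assumes "bounded_derivs1 \<eta>" "\<And>x. \<bar>x\<bar> < 1 \<Longrightarrow> \<eta> x = 0" "schwartz1 v"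
  shows "\<exists>C. \<forall>R\<ge>1. \<forall>x. \<bar>x\<bar> ^ a * cmod ((vderiv ^^ b) (\<lambda>x. \<eta> (x / R) * v x) x) \<le> C / R"
  using assms
proof (induction b arbitrary: \<eta> v)
  case 0
  obtain C where C: "\<And>x. cmod ((vderiv ^^ 0) \<eta> x) \<le> C"
    using 0(1) unfolding bounded_derivs1_def by blast
  obtain D where D: "\<And>x. \<bar>x\<bar> ^ Suc a * cmod ((vderiv ^^ 0) v x) \<le> D"
    using schwartz1_bound[OF 0(3)] by blast
  have C0: "C \<ge> 0" using order.trans[OF norm_ge_zero C[of 0]] .
  have D0: "D \<ge> 0" using order.trans[OF _ D[of 0]] by simp
  have "\<bar>x\<bar> ^ a * cmod (\<eta> (x / R) * v x) \<le> C * D / R" if R: "R \<ge> 1" for x R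
  proof (cases "\<bar>x\<bar> < R")
    case True
    then have "\<eta> (x / R) = 0" using R by (intro 0) (simp add: abs_divide)
    then show ?thesis using R C0 D0 by simp
  next
    case False
    \<comment> \<open>Here |x| >= R, so one extra power of |x|, which the decay of \<open>v\<close>
      absorbs, buys the factor 1/R.\<close>
    have "\<bar>x\<bar> ^ a * cmod (\<eta> (x / R) * v x) = cmod (\<eta> (x / R)) * (\<bar>x\<bar> ^ a * cmod (v x))"
      by (simp add: norm_mult)
    also have "\<dots> \<le> C * ((\<bar>x\<bar> ^ Suc a * cmod (v x)) / R)"
    proof (rule mult_mono)
      have "R * (\<bar>x\<bar> ^ a * cmod (v x)) \<le> \<bar>x\<bar> * (\<bar>x\<bar> ^ a * cmod (v x))"
        using False by (intro mult_right_mono) auto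
      then show "\<bar>x\<bar> ^ a * cmod (v x) \<le> (\<bar>x\<bar> ^ Suc a * cmod (v x)) / R"
        using R by (simp add: field_simps)
    qed (use C C0 in auto)
    also have "\<dots> \<le> C * (D / R)"
      using D[of x] R C0 by (intro mult_left_mono divide_right_mono) auto
    finally show ?thesis by simp
  qed
  then show ?case by auto
next
  case (Suc b)
  have dz: "vderiv \<eta> x = 0" if "\<bar>x\<bar> < 1" for x
  proof -
    have "vderiv \<eta> x = vderiv (\<lambda>_. 0) x"
      by (rule vderiv_cong_open[of "ball 0 1"]) (use that Suc.prems(2) in auto)
    then show ?thesis by (simp add: vderiv_const)
  qed
  obtain C where C: "\<And>R x. R \<ge> 1 \<Longrightarrow> \<bar>x\<bar> ^ a * cmod ((vderiv ^^ b) (\<lambda>x. \<eta> (x / R) * vderiv v x) x) \<le> C / R"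
    using Suc.IH[OF Suc.prems(1,2) schwartz1_vderiv[OF Suc.prems(3)]] by blast
  obtain D where D: "\<And>R x. R \<ge> 1 \<Longrightarrow> \<bar>x\<bar> ^ a * cmod ((vderiv ^^ b) (\<lambda>x. vderiv \<eta> (x / R) * v x) x) \<le> D / R"
    using Suc.IH[OF bounded_derivs1_vderiv[OF Suc.prems(1)] dz Suc.prems(3)] by blast
  have D0: "D \<ge> 0" using order.trans[OF _ D[of 1 0]] by simp
  have "\<bar>x\<bar> ^ a * cmod ((vderiv ^^ Suc b) (\<lambda>x. \<eta> (x / R) * v x) x) \<le> (C + D) / R" if R: "R \<ge> 1" for x R
  proof -
    have sm: "smooth1 \<eta>" "smooth1 v" using Suc.prems by (auto simp: bounded_derivs1_def schwartz1_smooth1)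
    have sm': "smooth1 (\<lambda>x. \<eta> (x / R))" "vderiv (\<lambda>x. \<eta> (x / R)) = (\<lambda>x. of_real (1 / R) * vderiv \<eta> (x / R))"
      using smooth1_affine[OF sm(1), of "1 / R" 0] vderiv_affine[OF sm(1), of "1 / R" 0] by simp_all
    have sm'': "smooth1 (\<lambda>x. vderiv \<eta> (x / R))"
      using smooth1_affine(1)[OF smooth1_vderiv[OF sm(1)], of "1 / R" 0] by simp
    have "(vderiv ^^ Suc b) (\<lambda>x. \<eta> (x / R) * v x) x = (vderiv ^^ b) (\<lambda>x. \<eta> (x / R) * vderiv v x) x
        + of_real (1 / R) * (vderiv ^^ b) (\<lambda>x. vderiv \<eta> (x / R) * v x) x"
      using sm sm' sm'' unfolding vderiv_pow_Suc_mult[OF sm'(1) sm(2)]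
      using vderiv_pow_cmult[of "\<lambda>x. vderiv \<eta> (x / R) * v x" b "of_real (1 / R)"]
      by (simp add: smooth1_mult mult.assoc)
    then have "cmod ((vderiv ^^ Suc b) (\<lambda>x. \<eta> (x / R) * v x) x) \<le> cmod ((vderiv ^^ b) (\<lambda>x. \<eta> (x / R) * vderiv v x) x)
        + 1 / R * cmod ((vderiv ^^ b) (\<lambda>x. vderiv \<eta> (x / R) * v x) x)"
      using R norm_triangle_ineq[of "(vderiv ^^ b) (\<lambda>x. \<eta> (x / R) * vderiv v x) x"
          "of_real (1 / R) * (vderiv ^^ b) (\<lambda>x. vderiv \<eta> (x / R) * v x) x"]
      by (simp add: norm_mult norm_divide)
    then have "\<bar>x\<bar> ^ a * cmod ((vderiv ^^ Suc b) (\<lambda>x. \<eta> (x / R) * v x) x)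
        \<le> \<bar>x\<bar> ^ a * (cmod ((vderiv ^^ b) (\<lambda>x. \<eta> (x / R) * vderiv v x) x)
        + 1 / R * cmod ((vderiv ^^ b) (\<lambda>x. vderiv \<eta> (x / R) * v x) x))"
      by (intro mult_left_mono) auto
    also have "\<dots> \<le> C / R + 1 / R * (D / R)"
      using C[OF R, of x] mult_left_mono[OF D[OF R, of x], of "1 / R"] R
      by (simp add: distrib_left mult_ac)
    \<comment> \<open>The chain rule supplies a second factor 1/R; it is bounded by 1, since the
      induction carries only one.\<close>
    also have "1 / R * (D / R) \<le> 1 * (D / R)"
      using R D0 by (intro mult_right_mono) auto
    finally show ?thesis by (simp add: add_divide_distrib)
  qed
  then show ?case by blast
qed

section \<open>Compactly supported smooth functions of one variable\<close>

lemma test1_vderiv: 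
  assumes "test1 u" shows "test1 (vderiv u)"
proof -
  obtain \<rho> where \<rho>: "\<And>x. \<rho> < \<bar>x\<bar> \<Longrightarrow> u x = 0" using assms by (auto simp: test1_def)
  have "vderiv u x = 0" if "\<rho> < \<bar>x\<bar>" for x
  proof -
    have "vderiv u x = vderiv (\<lambda>_. 0) x"
      by (rule vderiv_cong_open[of "{x. \<rho> < \<bar>x\<bar>}"])
         (use \<rho> that in \<open>auto intro!: open_Collect_less continuous_intros\<close>)
    then show ?thesis by (simp add: vderiv_const)
  qed
  then show ?thesis using assms smooth1_vderiv by (auto simp: test1_def)
qed

lemma test1_vderiv_pow: "test1 u \<Longrightarrow> test1 ((vderiv ^^ n) u)"
  by (induction n) (auto simp: test1_vderiv)

lemma test1_bounded:
  assumes "test1 u" obtains C where "\<And>x. \<bar>x\<bar> ^ a * cmod (u x) \<le> C"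
proof -
  obtain \<rho> where \<rho>: "\<And>x. \<rho> < \<bar>x\<bar> \<Longrightarrow> u x = 0" using assms by (auto simp: test1_def)
  have "continuous_on UNIV u" using assms by (simp add: test1_def smooth1_continuous_on)
  then have "continuous_on {-\<rho>..\<rho>} (\<lambda>x. of_real (\<bar>x\<bar> ^ a) * u x)"
    by (intro continuous_intros) (auto intro: continuous_on_subset)
  then have "compact ((\<lambda>x. of_real (\<bar>x\<bar> ^ a) * u x) ` {-\<rho>..\<rho>})"
    by (rule compact_continuous_image) simp
  from compact_imp_bounded[OF this] obtain C where
    C: "C > 0" "\<And>x. x \<in> {-\<rho>..\<rho>} \<Longrightarrow> cmod (of_real (\<bar>x\<bar> ^ a) * u x) \<le> C"
    by (auto simp: bounded_pos)
  have "\<bar>x\<bar> ^ a * cmod (u x) \<le> C" for x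
  proof (cases "\<rho> < \<bar>x\<bar>")
    case False
    then have "x \<in> {-\<rho>..\<rho>}" by auto
    from C(2)[OF this] show ?thesis by (simp add: norm_mult norm_power)
  qed (use C(1) \<rho>[of x] in simp)
  then show ?thesis by (rule that)
qed

lemma test1_schwartz1:
  assumes "test1 u" shows "schwartz1 u"
proof -
  have "\<exists>C. \<forall>x. \<bar>x\<bar> ^ a * cmod ((vderiv ^^ b) u x) \<le> C" for a b
    using test1_bounded[OF test1_vderiv_pow[OF assms, of b], of a] by blast
  then show ?thesis using assms by (auto simp: schwartz1_def test1_def)
qed

lemma schwartz1_bounded_derivs1: "schwartz1 v \<Longrightarrow> bounded_derivs1 v"
  unfolding schwartz1_def bounded_derivs1_def
  by (metis mult_1 power_0)

subsection \<open>Fourier transform\<close>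

definition fourier1 :: "(real \<Rightarrow> complex) \<Rightarrow> real \<Rightarrow> complex" where
  "fourier1 v y = (LINT x|lborel. v x * exp (- 2 * complex_of_real pi * \<i> * complex_of_real (x * y)))"

lemma norm_exp_imaginary: "cmod (exp (- 2 * complex_of_real pi * \<i> * complex_of_real t)) = 1"
  by (simp add: norm_exp_eq_Re)

lemma integrable_inverse_1_plus_square_UNIV: "integrable lborel (\<lambda>x::real. inverse (1 + x\<^sup>2))"
  and integral_inverse_1_plus_square_UNIV: "(LINT x|lborel. inverse (1 + x\<^sup>2)) = pi"
  using integrable_inverse_1_plus_square LBINT_inverse_1_plus_square
  by (simp_all add: set_integrable_def interval_lebesgue_integral_def set_lebesgue_integral_def einterval_def)

text \<open>Comparison with 1/(1 + x^2), whose integral over the line is the constant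
  \<open>pi\<close> in the bound.\<close>

lemma decay_integrable:
  fixes v :: "real \<Rightarrow> complex"
  assumes [measurable]: "v \<in> borel_measurable borel" and "\<And>x. (1 + x\<^sup>2) * cmod (v x) \<le> C"
  shows "integrable lborel v" and "(LINT x|lborel. cmod (v x)) \<le> C * pi"
proof -
  have b: "cmod (v x) \<le> C * inverse (1 + x\<^sup>2)" for x
    using assms(2)[of x] by (simp add: field_simps add_pos_nonneg)
  have i: "integrable lborel (\<lambda>x::real. C * inverse (1 + x\<^sup>2))"
    using integrable_inverse_1_plus_square_UNIV by simp
  show *: "integrable lborel v"
    by (rule Bochner_Integration.integrable_bound[OF i]) (use b in \<open>auto intro!: AE_I2 order.trans[OF _ abs_ge_self]\<close>)
  have "(LINT x|lborel. cmod (v x)) \<le> (LINT x|lborel. C * inverse (1 + x\<^sup>2))"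
    by (rule integral_mono[OF integrable_norm[OF *] i b])
  then show "(LINT x|lborel. cmod (v x)) \<le> C * pi"
    by (simp add: integral_inverse_1_plus_square_UNIV)
qed

lemma schwartz1_decay:
  assumes "schwartz1 v" obtains C where "\<And>x. (1 + x\<^sup>2) * cmod (v x) \<le> C"
proof -
  obtain C where C: "\<And>x. \<bar>x\<bar> ^ 0 * cmod ((vderiv ^^ 0) v x) \<le> C"
    using schwartz1_bound[OF assms] by blast
  obtain D where D: "\<And>x. \<bar>x\<bar> ^ 2 * cmod ((vderiv ^^ 0) v x) \<le> D"
    using schwartz1_bound[OF assms] by blast
  have "(1 + x\<^sup>2) * cmod (v x) \<le> C + D" for x
    using C[of x] D[of x] by (simp add: distrib_right)
  then show ?thesis by (rule that)
qed

lemma schwartz1_integrable: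
  assumes "schwartz1 v" shows "integrable lborel v"
proof -
  obtain C where "\<And>x. (1 + x\<^sup>2) * cmod (v x) \<le> C" using schwartz1_decay[OF assms] by blast
  then show ?thesis using decay_integrable smooth1_measurable schwartz1_smooth1 assms by blast
qed

lemma integrable_mult_exp:
  assumes "integrable lborel v"
  shows "integrable lborel (\<lambda>x. v x * exp (- 2 * complex_of_real pi * \<i> * complex_of_real (x * y)))"
  by (rule Bochner_Integration.integrable_bound[OF assms])
     (use assms in \<open>auto simp: norm_mult norm_exp_imaginary simp del: of_real_mult\<close>)

lemma fourier1_norm_le: "cmod (fourier1 v y) \<le> (LINT x|lborel. cmod (v x))"
  unfolding fourier1_def
  by (rule order.trans[OF integral_norm_bound])
     (simp add: norm_mult norm_exp_imaginary del: of_real_mult)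

lemma norm_iexp_linear_le: "cmod (exp (\<i> * complex_of_real t) - 1 - \<i> * t) \<le> t\<^sup>2 / 2"
  using iexp_approx1[of t 1] by (simp add: numeral_2_eq_2 diff_diff_eq)

text \<open>The factor is the one that the kernel exp(-2 pi i x y) releases when it is
  differentiated in y; this is the operator that \<open>fourier1\<close> turns into
  differentiation.\<close>

definition mult_id :: "(real \<Rightarrow> complex) \<Rightarrow> real \<Rightarrow> complex" where
  "mult_id v x = - 2 * complex_of_real pi * \<i> * (of_real x * v x)"

lemma schwartz1_mult_id: "schwartz1 v \<Longrightarrow> schwartz1 (mult_id v)"
  unfolding mult_id_def[abs_def] by (rule schwartz1_cmult[OF schwartz1_mult_of_real])

lemma schwartz1_mult_id_pow: "schwartz1 v \<Longrightarrow> schwartz1 ((mult_id ^^ n) v)"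
  by (induction n) (simp_all add: schwartz1_mult_id)

text \<open>The linear Taylor remainder of exp(i t) is at most t^2/2. Integrated against
  \<open>v\<close>, it shows that the increment of the transform differs from its linear part by at
  most \<open>K\<close> times (z - y)^2, and \<open>K\<close> is finite because x^2 v is
  integrable.\<close>

lemma fourier1_has_vector_derivative:
  assumes v: "schwartz1 v"
  shows "(fourier1 v has_vector_derivative fourier1 (mult_id v) y) (at y)"
proof -
  let ?e = "\<lambda>x y. exp (- 2 * complex_of_real pi * \<i> * complex_of_real (x * y))"
  define K where "K = (LINT x|lborel. cmod (v x) * (2 * pi\<^sup>2 * x\<^sup>2))"
  have i1: "integrable lborel (\<lambda>x. v x * ?e x y)" for y
    by (rule integrable_mult_exp[OF schwartz1_integrable[OF v]])
  have i2: "integrable lborel (\<lambda>x. mult_id v x * ?e x y)"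
    by (rule integrable_mult_exp[OF schwartz1_integrable[OF schwartz1_mult_id[OF v]]])
  \<comment> \<open>Applying \<open>mult_id\<close> twice multiplies |v| by 4 pi^2 x^2; half of this
    is the majorant that t^2/2 yields for t = -2 pi x (z - y), up to the factor (z - y)^2.\<close>
  have "integrable lborel (\<lambda>x. cmod (mult_id (mult_id v) x))"
    by (rule integrable_norm[OF schwartz1_integrable[OF schwartz1_mult_id[OF schwartz1_mult_id[OF v]]]])
  then have "integrable lborel (\<lambda>x. (1/2) * cmod (mult_id (mult_id v) x))"
    by (rule integrable_mult_right)
  also have "(\<lambda>x. (1/2) * cmod (mult_id (mult_id v) x)) = (\<lambda>x. cmod (v x) * (2 * pi\<^sup>2 * x\<^sup>2))"
    by (auto simp: mult_id_def norm_mult fun_eq_iff power2_eq_square)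
  finally have i3: "integrable lborel (\<lambda>x. cmod (v x) * (2 * pi\<^sup>2 * x\<^sup>2))" .
  have est: "cmod (fourier1 v z - fourier1 v y - of_real (z - y) * fourier1 (mult_id v) y) \<le> K * (z - y)\<^sup>2" for z
  proof -
    have eq: "fourier1 v z - fourier1 v y - of_real (z - y) * fourier1 (mult_id v) y
        = (LINT x|lborel. v x * ?e x z - v x * ?e x y - of_real (z - y) * (mult_id v x * ?e x y))"
      unfolding fourier1_def using i1 i2 by (simp del: of_real_mult)
    have "cmod (fourier1 v z - fourier1 v y - of_real (z - y) * fourier1 (mult_id v) y)
        \<le> (LINT x|lborel. cmod (v x) * (2 * pi\<^sup>2 * x\<^sup>2) * (z - y)\<^sup>2)"
      unfolding eq
    proof (rule Bochner_Integration.integral_norm_bound_integral)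
      show "integrable lborel (\<lambda>x. v x * ?e x z - v x * ?e x y - of_real (z - y) * (mult_id v x * ?e x y))"
        using i1 i2 by (intro Bochner_Integration.integrable_diff integrable_mult_right)
      show "integrable lborel (\<lambda>x. cmod (v x) * (2 * pi\<^sup>2 * x\<^sup>2) * (z - y)\<^sup>2)"
        using i3 by (rule integrable_mult_left)
      fix x
      define t where "t = - (2 * pi * (x * (z - y)))"
      have "?e x z = ?e x y * exp (\<i> * complex_of_real t)"
        by (simp add: t_def exp_add[symmetric] algebra_simps)
      then have "v x * ?e x z - v x * ?e x y - of_real (z - y) * (mult_id v x * ?e x y)
          = v x * ?e x y * (exp (\<i> * complex_of_real t) - 1 - \<i> * t)"
        by (simp add: t_def mult_id_def algebra_simps)
      then have "cmod (v x * ?e x z - v x * ?e x y - of_real (z - y) * (mult_id v x * ?e x y))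
          \<le> cmod (v x) * (t\<^sup>2 / 2)"
        using mult_left_mono[OF norm_iexp_linear_le[of t], of "cmod (v x)"] norm_exp_imaginary[of "x * y"]
        by (simp add: norm_mult del: of_real_mult)
      also have "\<dots> = cmod (v x) * (2 * pi\<^sup>2 * x\<^sup>2) * (z - y)\<^sup>2"
        by (simp add: t_def power2_eq_square)
      finally show "cmod (v x * ?e x z - v x * ?e x y - of_real (z - y) * (mult_id v x * ?e x y))
          \<le> cmod (v x) * (2 * pi\<^sup>2 * x\<^sup>2) * (z - y)\<^sup>2" .
    qed
    also have "\<dots> = K * (z - y)\<^sup>2" using i3 by (simp add: K_def)
    finally show ?thesis .
  qed
  show ?thesis unfolding has_vector_derivative_def
  proof (rule has_derivativeI_sandwich[where e = 1 and H = "\<lambda>z. K * \<bar>z - y\<bar>"])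
    show "norm (fourier1 v z - fourier1 v y - (z - y) *\<^sub>R fourier1 (mult_id v) y) / norm (z - y) \<le> K * \<bar>z - y\<bar>"
      if "z \<noteq> y" for z
    proof -
      have "norm (fourier1 v z - fourier1 v y - (z - y) *\<^sub>R fourier1 (mult_id v) y) \<le> K * \<bar>z - y\<bar> * \<bar>z - y\<bar>"
        using est[of z] by (simp add: scaleR_conv_of_real power2_eq_square)
      then show ?thesis using that by (simp add: field_simps)
    qed
    show "((\<lambda>z. K * \<bar>z - y\<bar>) \<longlongrightarrow> 0) (at y)"
      by (auto intro!: tendsto_eq_intros)
  qed (auto intro: bounded_linear_scaleR_left)
qed

lemma vderiv_fourier1: "schwartz1 v \<Longrightarrow> vderiv (fourier1 v) = fourier1 (mult_id v)"
  by (intro vderivI fourier1_has_vector_derivative)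

lemma vderiv_pow_fourier1:
  "schwartz1 v \<Longrightarrow> (vderiv ^^ b) (fourier1 v) = fourier1 ((mult_id ^^ b) v)"
  by (induction b) (simp_all add: vderiv_fourier1 schwartz1_mult_id_pow)

lemma smooth1_fourier1:
  assumes "schwartz1 v" shows "smooth1 (fourier1 v)"
  by (rule smooth1_coinduct[of _ "fourier1 ` Collect schwartz1"])
     (use assms in \<open>auto simp: vderiv_fourier1 schwartz1_mult_id
        intro: differentiableI_vector[OF fourier1_has_vector_derivative]\<close>)

lemma schwartz1_tendsto_0:
  assumes "schwartz1 v" shows "(v \<longlongrightarrow> 0) at_top" "(v \<longlongrightarrow> 0) at_bot"
proof -
  obtain C where C: "\<And>x. \<bar>x\<bar> ^ 1 * cmod ((vderiv ^^ 0) v x) \<le> C"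
    using schwartz1_bound[OF assms] by blast
  have "cmod (v x) \<le> C / \<bar>x\<bar>" if "x \<noteq> 0" for x
    using C[of x] that by (simp add: field_simps)
  then have ev: "\<forall>\<^sub>F x in F. cmod (v x) \<le> C / \<bar>x\<bar>" if "\<forall>\<^sub>F x in F. x \<noteq> 0" for F
    using that by (auto elim: eventually_mono)
  have "((\<lambda>x::real. C / \<bar>x\<bar>) \<longlongrightarrow> 0) at_top" "((\<lambda>x::real. C / \<bar>x\<bar>) \<longlongrightarrow> 0) at_bot"
    by real_asymp+
  then show "(v \<longlongrightarrow> 0) at_top" "(v \<longlongrightarrow> 0) at_bot"
    by (auto intro!: Lim_null_comparison[OF ev] simp: eventually_at_top_not_equal eventually_at_bot_not_equal)
qed

lemma integral_vderiv_schwartz1: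
  assumes "schwartz1 v" shows "(LINT x|lborel. vderiv v x) = 0"
proof -
  have "(LBINT x=-\<infinity>..\<infinity>. vderiv v x) = 0 - 0"
  proof (rule interval_integral_FTC_integrable)
    show "(v has_vector_derivative vderiv v x) (at x)" for x
      using assms by (simp add: schwartz1_smooth1 smooth1_has_vector_derivative)
    show "isCont (vderiv v) x" for x
      using assms by (simp add: schwartz1_smooth1 smooth1_vderiv smooth1_isCont)
    show "set_integrable lborel (einterval (- \<infinity>) \<infinity>) (vderiv v)"
      using schwartz1_integrable[OF schwartz1_vderiv[OF assms]]
      by (simp add: set_integrable_def einterval_def)
    show "((v \<circ> real_of_ereal) \<longlongrightarrow> 0) (at_right (- \<infinity>))" "((v \<circ> real_of_ereal) \<longlongrightarrow> 0) (at_left \<infinity>)"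
      using schwartz1_tendsto_0[OF assms] by (simp_all add: ereal_tendsto_simps)
  qed simp
  then show ?thesis
    by (simp add: interval_lebesgue_integral_def set_lebesgue_integral_def einterval_def)
qed

lemma bounded_derivs1_exp:
  assumes "Re k = 0" shows "bounded_derivs1 (\<lambda>x. exp (k * of_real x))"
  unfolding bounded_derivs1_def
proof (intro conjI allI)
  fix n
  have "(vderiv ^^ n) (\<lambda>x. exp (k * of_real x)) = (\<lambda>x. k ^ n * exp (k * of_real x))"
  proof (induction n)
    case (Suc n)
    then show ?case by (simp add: vderiv_exp vderiv_mult vderiv_const smooth1_exp mult_ac)
  qed simp
  then show "\<exists>C. \<forall>x. cmod ((vderiv ^^ n) (\<lambda>x. exp (k * of_real x)) x) \<le> C"
    using assms by (intro exI[of _ "cmod k ^ n"]) (simp add: norm_mult norm_power norm_exp_eq_Re)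
qed (rule smooth1_exp)

text \<open>Integration by parts: the product of \<open>v\<close> with the character is again a
  Schwartz function, so its derivative integrates to 0.\<close>

lemma fourier1_vderiv:
  assumes v: "schwartz1 v" shows "fourier1 (vderiv v) y = 2 * pi * \<i> * y * fourier1 v y"
proof -
  define k where "k = - 2 * complex_of_real pi * \<i> * complex_of_real y"
  have e: "exp (- 2 * complex_of_real pi * \<i> * complex_of_real (x * y)) = exp (k * of_real x)" for x
    by (simp add: k_def mult_ac)
  have i: "integrable lborel (\<lambda>x. v x * exp (k * of_real x))" "integrable lborel (\<lambda>x. vderiv v x * exp (k * of_real x))"
    using integrable_mult_exp[OF schwartz1_integrable[OF v], of y]
      integrable_mult_exp[OF schwartz1_integrable[OF schwartz1_vderiv[OF v]], of y] unfolding e .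
  have "schwartz1 (\<lambda>x. exp (k * of_real x) * v x)"
    by (rule schwartz1_bounded_mult[OF bounded_derivs1_exp v]) (simp add: k_def)
  from integral_vderiv_schwartz1[OF this]
  have "0 = (LINT x|lborel. vderiv v x * exp (k * of_real x) + k * (v x * exp (k * of_real x)))"
    using v by (simp add: vderiv_mult smooth1_exp schwartz1_smooth1 vderiv_exp mult_ac add.commute)
  also have "\<dots> = fourier1 (vderiv v) y + k * fourier1 v y"
    unfolding fourier1_def e using i by simp
  finally show ?thesis by (simp add: k_def)
qed

lemma fourier1_vderiv_pow:
  "schwartz1 v \<Longrightarrow> fourier1 ((vderiv ^^ a) v) y = (2 * pi * \<i> * y) ^ a * fourier1 v y"
  by (induction a) (simp_all add: fourier1_vderiv schwartz1_vderiv_pow)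

text \<open>Up to the factor (2 pi)^a >= 1, the left side is the modulus of the transform of the
  a-th derivative of \<open>(mult_id ^^ b) v\<close>, and a transform is bounded by the L1 norm of
  its argument.\<close>

lemma fourier1_seminorm_le:
  assumes v: "schwartz1 v" and C: "\<And>x. (1 + x\<^sup>2) * cmod ((vderiv ^^ a) ((mult_id ^^ b) v) x) \<le> C"
  shows "\<bar>y\<bar> ^ a * cmod ((vderiv ^^ b) (fourier1 v) y) \<le> C * pi"
proof -
  let ?w = "(mult_id ^^ b) v"
  have w: "schwartz1 ?w" by (rule schwartz1_mult_id_pow[OF v])
  have "\<bar>y\<bar> ^ a * cmod ((vderiv ^^ b) (fourier1 v) y) \<le> (2 * pi * \<bar>y\<bar>) ^ a * cmod (fourier1 ?w y)"
    using pi_ge_two unfolding vderiv_pow_fourier1[OF v]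
    by (intro mult_right_mono power_mono) (auto simp: mult_le_cancel_right1)
  also have "\<dots> = cmod (fourier1 ((vderiv ^^ a) ?w) y)"
    unfolding fourier1_vderiv_pow[OF w] by (simp add: norm_mult norm_power)
  also have "\<dots> \<le> (LINT x|lborel. cmod ((vderiv ^^ a) ?w x))" by (rule fourier1_norm_le)
  also have "\<dots> \<le> C * pi"
    using smooth1_measurable[OF schwartz1_smooth1[OF schwartz1_vderiv_pow[OF w]]] C
    by (rule decay_integrable(2))
  finally show ?thesis .
qed

lemma schwartz1_fourier1:
  assumes v: "schwartz1 v" shows "schwartz1 (fourier1 v)"
  unfolding schwartz1_def
proof (intro conjI allI)
  fix a b
  obtain C where "\<And>x. (1 + x\<^sup>2) * cmod ((vderiv ^^ a) ((mult_id ^^ b) v) x) \<le> C"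
    using schwartz1_decay[OF schwartz1_vderiv_pow[OF schwartz1_mult_id_pow[OF v]]] by blast
  from fourier1_seminorm_le[OF v this]
  show "\<exists>C. \<forall>x. \<bar>x\<bar> ^ a * cmod ((vderiv ^^ b) (fourier1 v) x) \<le> C" by blast
qed (rule smooth1_fourier1[OF v])

text \<open>Multiplication by the dilated \<open>\<eta>\<close> commutes with
  \<open>mult_id\<close>, so the 1/R estimates with weights of degree 0 and 2 pass through the
  Fourier transform. With \<open>\<eta>\<close> a cutoff minus 1 this measures the effect of
  truncating \<open>v\<close> at scale R.\<close>

lemma fourier1_dilated_mult_bound:
  assumes \<eta>: "bounded_derivs1 \<eta>" "\<And>x. \<bar>x\<bar> < 1 \<Longrightarrow> \<eta> x = 0" and v: "schwartz1 v"
  shows "\<exists>C. \<forall>R\<ge>1. \<forall>y. \<bar>y\<bar> ^ a * cmod ((vderiv ^^ b) (fourier1 (\<lambda>x. \<eta> (x / R) * v x)) y) \<le> C / R"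
proof -
  let ?w = "(mult_id ^^ b) v"
  have w: "schwartz1 ?w" by (rule schwartz1_mult_id_pow[OF v])
  have mi: "(mult_id ^^ b) (\<lambda>x. \<eta> (x / R) * v x) = (\<lambda>x. \<eta> (x / R) * ?w x)" for R
    by (induction b) (simp_all add: mult_id_def fun_eq_iff mult_ac)
  obtain C where C: "\<And>R x. R \<ge> 1 \<Longrightarrow> \<bar>x\<bar> ^ 0 * cmod ((vderiv ^^ a) (\<lambda>x. \<eta> (x / R) * ?w x) x) \<le> C / R"
    using schwartz1_dilated_mult_bound[OF \<eta> w] by blast
  obtain D where D: "\<And>R x. R \<ge> 1 \<Longrightarrow> \<bar>x\<bar> ^ 2 * cmod ((vderiv ^^ a) (\<lambda>x. \<eta> (x / R) * ?w x) x) \<le> D / R"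
    using schwartz1_dilated_mult_bound[OF \<eta> w] by blast
  have "\<bar>y\<bar> ^ a * cmod ((vderiv ^^ b) (fourier1 (\<lambda>x. \<eta> (x / R) * v x)) y) \<le> (C + D) / R * pi"
    if R: "R \<ge> 1" for R y
  proof (rule fourier1_seminorm_le)
    show "schwartz1 (\<lambda>x. \<eta> (x / R) * v x)"
      using schwartz1_bounded_mult[OF bounded_derivs1_affine[OF \<eta>(1), of "1 / R" 0] v] by simp
    show "(1 + x\<^sup>2) * cmod ((vderiv ^^ a) ((mult_id ^^ b) (\<lambda>x. \<eta> (x / R) * v x)) x) \<le> (C + D) / R" for x
      using C[OF R, of x] D[OF R, of x] unfolding mi by (simp add: distrib_right add_divide_distrib)
  qed
  then have "\<forall>R\<ge>1. \<forall>y. \<bar>y\<bar> ^ a * cmod ((vderiv ^^ b) (fourier1 (\<lambda>x. \<eta> (x / R) * v x)) y) \<le> ((C + D) * pi) / R"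
    by simp
  then show ?thesis by blast
qed

subsection \<open>Fourier inversion\<close>

lemma schwartz1_reflect:
  assumes "schwartz1 v" shows "schwartz1 (\<lambda>x. v (- x))"
  unfolding schwartz1_def
proof (intro conjI allI)
  have s: "smooth1 v" using assms by (rule schwartz1_smooth1)
  show "smooth1 (\<lambda>x. v (- x))" using smooth1_affine(1)[OF s, of "-1" 0] by simp
  fix a b
  obtain C where C: "\<And>x. \<bar>x\<bar> ^ a * cmod ((vderiv ^^ b) v x) \<le> C"
    using schwartz1_bound[OF assms] by blast
  have "\<bar>x\<bar> ^ a * cmod ((vderiv ^^ b) (\<lambda>x. v (- x)) x) \<le> C" for x
    using vderiv_pow_affine[OF s, of b "-1" 0] C[of "-x"] by (simp add: norm_mult norm_power)
  then show "\<exists>C. \<forall>x. \<bar>x\<bar> ^ a * cmod ((vderiv ^^ b) (\<lambda>x. v (- x)) x) \<le> C" by blast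
qed

lemma integrable_gaussian: "integrable lborel (\<lambda>s::real. exp (- s\<^sup>2 / 2))"
  and integral_std_normal: "(LINT s|lborel. std_normal_density s) = 1"
proof -
  have "integrable lborel (\<lambda>s. sqrt (2 * pi) * std_normal_density s)"
    using integrable_std_normal_moment[of 0] by simp
  then show "integrable lborel (\<lambda>s::real. exp (- s\<^sup>2 / 2))"
    by (simp add: std_normal_density_def)
  show "(LINT s|lborel. std_normal_density s) = 1"
    using integral_std_normal_moment_even[of 0] by simp
qed

text \<open>This is the characteristic function of the standard normal distribution after the
  substitution s = c y.\<close>

lemma integral_exp_gaussian:
  fixes t c :: real
  assumes c: "c > 0"
  shows "(LINT y|lborel. exp (\<i> * complex_of_real (t * y)) * complex_of_real (exp (- (c * y)\<^sup>2 / 2)))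
    = of_real (sqrt (2 * pi) / c * exp (- (t / c)\<^sup>2 / 2))"
proof -
  have "(LINT s|lborel. std_normal_density s *\<^sub>R iexp (t / c * s)) = of_real (exp (- (t / c)\<^sup>2 / 2))"
    using fun_cong[OF char_std_normal_distribution, of "t / c"] unfolding char_def
    by (subst (asm) integral_density) auto
  also have "(LINT s|lborel. std_normal_density s *\<^sub>R iexp (t / c * s))
      = c *\<^sub>R (LINT y|lborel. std_normal_density (c * y) *\<^sub>R iexp (t / c * (c * y)))"
    using c lborel_integral_real_affine[of c "\<lambda>s. std_normal_density s *\<^sub>R iexp (t / c * s)" 0] by simp
  also have "(\<lambda>y. std_normal_density (c * y) *\<^sub>R iexp (t / c * (c * y)))
      = (\<lambda>y. of_real (1 / sqrt (2 * pi)) * (iexp (t * y) * complex_of_real (exp (- (c * y)\<^sup>2 / 2))))"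
    using c by (simp add: std_normal_density_def scaleR_conv_of_real mult_ac fun_eq_iff)
  finally have "of_real (c / sqrt (2 * pi)) * (LINT y|lborel. iexp (t * y) * complex_of_real (exp (- (c * y)\<^sup>2 / 2)))
      = of_real (exp (- (t / c)\<^sup>2 / 2))"
    by (simp add: scaleR_conv_of_real)
  then have "of_real (sqrt (2 * pi) / c) * (of_real (c / sqrt (2 * pi)) * (LINT y|lborel. iexp (t * y) * complex_of_real (exp (- (c * y)\<^sup>2 / 2))))
      = of_real (sqrt (2 * pi) / c * exp (- (t / c)\<^sup>2 / 2))"
    by simp
  then show ?thesis using c by simp
qed

text \<open>Gaussian regularisation: inserting the factor \<open>exp (- (c y)\<^sup>2 / 2)\<close> turns the inversion
  integral into a Gaussian average of \<open>u\<close> around \<open>x0\<close>, by Fubini.\<close>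

lemma fourier1_inversion_regularised:
  assumes u: "schwartz1 u" and c: "c > 0"
  shows "(LINT y|lborel. fourier1 u (- y) * exp (- 2 * complex_of_real pi * \<i> * complex_of_real (y * x0))
        * complex_of_real (exp (- (c * y)\<^sup>2 / 2)))
    = (LINT s|lborel. u (x0 + c / (2 * pi) * s) * of_real (std_normal_density s))"
proof -
  let ?g = "\<lambda>y. complex_of_real (exp (- (c * y)\<^sup>2 / 2))"
  define F where "F x y = u x * (iexp (2 * pi * (x - x0) * y) * ?g y)" for x y
  have [measurable]: "u \<in> borel_measurable borel"
    using u by (simp add: schwartz1_smooth1 smooth1_measurable)
  have g: "integrable lborel (\<lambda>y. exp (- (c * y)\<^sup>2 / 2))"
    using lborel_integrable_real_affine[OF integrable_gaussian, of c 0] c by simp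
  have nF: "cmod (F x y) = cmod (u x) * exp (- (c * y)\<^sup>2 / 2)" for x y
    by (simp add: F_def norm_mult del: of_real_mult)
  have mF [measurable]: "case_prod F \<in> borel_measurable (lborel \<Otimes>\<^sub>M lborel)"
    unfolding F_def by measurable
  have iF: "integrable (lborel \<Otimes>\<^sub>M lborel) (case_prod F)"
  proof (rule lborel_pair.Fubini_integrable[OF mF])
    show "integrable lborel (\<lambda>x. LINT y|lborel. norm (case (x, y) of (x, y) \<Rightarrow> F x y))"
      using integrable_norm[OF schwartz1_integrable[OF u]] by (simp add: nF)
    show "AE x in lborel. integrable lborel (\<lambda>y. case (x, y) of (x, y) \<Rightarrow> F x y)"
    proof (rule AE_I2)
      fix x
      have "integrable lborel (\<lambda>y. cmod (u x) * exp (- (c * y)\<^sup>2 / 2))" using g by simp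
      then show "integrable lborel (\<lambda>y. case (x, y) of (x, y) \<Rightarrow> F x y)"
      proof (rule Bochner_Integration.integrable_bound)
        show "(\<lambda>y. case (x, y) of (x, y) \<Rightarrow> F x y) \<in> borel_measurable lborel"
          unfolding F_def by simp
      qed (simp add: nF)
    qed
  qed
  have "(LINT y|lborel. fourier1 u (- y) * exp (- 2 * complex_of_real pi * \<i> * complex_of_real (y * x0)) * ?g y)
      = (LINT y|lborel. (LINT x|lborel. F x y))"
  proof (rule Bochner_Integration.integral_cong[OF refl])
    fix y
    have "fourier1 u (- y) * exp (- 2 * complex_of_real pi * \<i> * complex_of_real (y * x0)) * ?g y
        = (LINT x|lborel. u x * exp (- 2 * complex_of_real pi * \<i> * complex_of_real (x * - y))
          * (exp (- 2 * complex_of_real pi * \<i> * complex_of_real (y * x0)) * ?g y))"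
      unfolding fourier1_def mult.assoc[of "LINT x|lborel. _ x"]
      by (rule integral_mult_left_zero[symmetric])
    also have "\<dots> = (LINT x|lborel. F x y)"
    proof (rule Bochner_Integration.integral_cong[OF refl])
      fix x
      have "iexp (2 * pi * (x - x0) * y) = exp (- 2 * complex_of_real pi * \<i> * complex_of_real (x * - y))
          * exp (- 2 * complex_of_real pi * \<i> * complex_of_real (y * x0))"
        by (simp add: exp_add[symmetric] algebra_simps)
      then show "u x * exp (- 2 * complex_of_real pi * \<i> * complex_of_real (x * - y))
          * (exp (- 2 * complex_of_real pi * \<i> * complex_of_real (y * x0)) * ?g y) = F x y"
        by (simp add: F_def mult.assoc del: of_real_mult)
    qed
    finally show "fourier1 u (- y) * exp (- 2 * complex_of_real pi * \<i> * complex_of_real (y * x0)) * ?g y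
        = (LINT x|lborel. F x y)" .
  qed
  also have "\<dots> = (LINT x|lborel. (LINT y|lborel. F x y))"
    by (rule lborel_pair.Fubini_integral[OF iF])
  also have "\<dots> = (LINT x|lborel. u x * of_real (sqrt (2 * pi) / c * exp (- (2 * pi * (x - x0) / c)\<^sup>2 / 2)))"
    unfolding F_def using integral_exp_gaussian[OF c] by (simp del: of_real_mult)
  \<comment> \<open>The substitution x = x0 + c s / (2 pi) turns the exponent into -s^2/2; the
    Jacobian and sqrt(2 pi) / c combine to 1 / sqrt(2 pi), the normalisation of the normal
    density.\<close>
  also have "\<dots> = (c / (2 * pi)) *\<^sub>R (LINT s|lborel. u (x0 + c / (2 * pi) * s)
      * of_real (sqrt (2 * pi) / c * exp (- (2 * pi * (x0 + c / (2 * pi) * s - x0) / c)\<^sup>2 / 2)))"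
    using c by (subst lborel_integral_real_affine[of "c / (2 * pi)" _ x0]) auto
  also have "\<dots> = (LINT s|lborel. of_real (c / (2 * pi)) * (u (x0 + c / (2 * pi) * s)
      * of_real (sqrt (2 * pi) / c * exp (- (2 * pi * (x0 + c / (2 * pi) * s - x0) / c)\<^sup>2 / 2))))"
    by (simp add: scaleR_conv_of_real)
  also have "\<dots> = (LINT s|lborel. u (x0 + c / (2 * pi) * s) * of_real (std_normal_density s))"
  proof (rule Bochner_Integration.integral_cong[OF refl])
    fix s
    have "c / (2 * pi) * (sqrt (2 * pi) / c * exp (- (2 * pi * (x0 + c / (2 * pi) * s - x0) / c)\<^sup>2 / 2))
        = std_normal_density s"
      using c real_sqrt_mult_self[of "2 * pi"]
      by (simp add: std_normal_density_def field_simps del: real_sqrt_mult_self)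
    then show "of_real (c / (2 * pi)) * (u (x0 + c / (2 * pi) * s)
        * of_real (sqrt (2 * pi) / c * exp (- (2 * pi * (x0 + c / (2 * pi) * s - x0) / c)\<^sup>2 / 2)))
        = u (x0 + c / (2 * pi) * s) * of_real (std_normal_density s)"
      by (subst mult.left_commute, subst of_real_mult[symmetric], simp only:)
  qed
  finally show ?thesis .
qed

text \<open>Let c tend to 0 in the regularised identity, by dominated convergence on both sides: on
  the left the Gaussian factor tends to 1, on the right the average concentrates at
  \<open>x0\<close>.\<close>

theorem fourier1_inversion:
  assumes u: "schwartz1 u"
  shows "fourier1 (\<lambda>y. fourier1 u (- y)) x0 = u x0"
proof -
  let ?e = "\<lambda>y. exp (- 2 * complex_of_real pi * \<i> * complex_of_real (y * x0))"
  have v: "schwartz1 (\<lambda>y. fourier1 u (- y))" by (rule schwartz1_reflect[OF schwartz1_fourier1[OF u]])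
  have [measurable]: "u \<in> borel_measurable borel" "(\<lambda>y. fourier1 u (- y)) \<in> borel_measurable borel"
    using u v by (auto intro: smooth1_measurable schwartz1_smooth1)
  define c where "c n = 1 / real (Suc n)" for n
  have c: "c n > 0" "c \<longlonglongrightarrow> 0" for n
    using LIMSEQ_inverse_real_of_nat by (auto simp: c_def[abs_def] inverse_eq_divide)
  have "(\<lambda>n. LINT y|lborel. fourier1 u (- y) * ?e y * complex_of_real (exp (- (c n * y)\<^sup>2 / 2)))
      \<longlonglongrightarrow> (LINT y|lborel. fourier1 u (- y) * ?e y)"
  proof (rule integral_dominated_convergence)
    show "integrable lborel (\<lambda>y. cmod (fourier1 u (- y)))"
      by (rule integrable_norm[OF schwartz1_integrable[OF v]])
    show "AE y in lborel. (\<lambda>n. fourier1 u (- y) * ?e y * complex_of_real (exp (- (c n * y)\<^sup>2 / 2)))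
        \<longlonglongrightarrow> fourier1 u (- y) * ?e y"
    proof (rule AE_I2)
      fix y
      have "(\<lambda>n. fourier1 u (- y) * ?e y * complex_of_real (exp (- (c n * y)\<^sup>2 / 2)))
          \<longlonglongrightarrow> fourier1 u (- y) * ?e y * complex_of_real (exp (- (0 * y)\<^sup>2 / 2))"
        by (intro tendsto_intros c) auto
      then show "(\<lambda>n. fourier1 u (- y) * ?e y * complex_of_real (exp (- (c n * y)\<^sup>2 / 2)))
        \<longlonglongrightarrow> fourier1 u (- y) * ?e y" by simp
    qed
    show "AE y in lborel. cmod (fourier1 u (- y) * ?e y * complex_of_real (exp (- (c n * y)\<^sup>2 / 2)))
        \<le> cmod (fourier1 u (- y))" for n
      by (intro AE_I2) (simp add: norm_mult norm_exp_imaginary mult_left_le del: of_real_mult)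
  qed auto
  moreover have "(\<lambda>n. LINT s|lborel. u (x0 + c n / (2 * pi) * s) * of_real (std_normal_density s))
      \<longlonglongrightarrow> (LINT s|lborel. u x0 * of_real (std_normal_density s))"
  proof -
    obtain K where K: "\<And>x. \<bar>x\<bar> ^ 0 * cmod ((vderiv ^^ 0) u x) \<le> K"
      using schwartz1_bound[OF u] by blast
    show ?thesis
    proof (rule integral_dominated_convergence)
      show "integrable lborel (\<lambda>s. K * std_normal_density s)"
        using integrable_std_normal_moment[of 0] by simp
      show "AE s in lborel. (\<lambda>n. u (x0 + c n / (2 * pi) * s) * of_real (std_normal_density s))
          \<longlonglongrightarrow> u x0 * of_real (std_normal_density s)"
      proof (rule AE_I2)
        fix s
        have "(\<lambda>n. x0 + c n / (2 * pi) * s) \<longlonglongrightarrow> x0 + 0 / (2 * pi) * s"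
          by (intro tendsto_intros c) auto
        then have "(\<lambda>n. u (x0 + c n / (2 * pi) * s)) \<longlonglongrightarrow> u x0"
          using isCont_tendsto_compose[OF smooth1_isCont[OF schwartz1_smooth1[OF u]]] by simp
        then show "(\<lambda>n. u (x0 + c n / (2 * pi) * s) * of_real (std_normal_density s))
          \<longlonglongrightarrow> u x0 * of_real (std_normal_density s)" by (intro tendsto_intros)
      qed
      show "AE s in lborel. cmod (u (x0 + c n / (2 * pi) * s) * of_real (std_normal_density s))
          \<le> K * std_normal_density s" for n
        using K by (auto simp: norm_mult intro!: mult_right_mono)
    qed auto
  qed
  ultimately have "(LINT y|lborel. fourier1 u (- y) * ?e y) = (LINT s|lborel. u x0 * of_real (std_normal_density s))"
    using c(1) LIMSEQ_unique by (simp only: fourier1_inversion_regularised[OF u c(1)])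
  then show ?thesis using integral_std_normal by (simp add: fourier1_def)
qed

lemma fourier1_modulate:
  "fourier1 (\<lambda>x. exp (2 * complex_of_real pi * \<i> * of_real t * of_real x) * v x) y = fourier1 v (y - t)"
  unfolding fourier1_def
  by (rule Bochner_Integration.integral_cong)
     (auto simp: exp_add[symmetric] algebra_simps exp_minus exp_diff field_simps)

section \<open>Tensor products\<close>

definition tensor :: "('d::finite \<Rightarrow> real \<Rightarrow> complex) \<Rightarrow> real ^ 'd \<Rightarrow> complex" where
  "tensor u x = (\<Prod>i\<in>UNIV. u i (x $ i))"

lemma partial_deriv_tensor:
  fixes u :: "'d::finite \<Rightarrow> real \<Rightarrow> complex"
  assumes "smooth1 (u k)"
  shows "partial_deriv k (tensor u) = tensor (u(k := vderiv (u k)))"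
proof
  fix x :: "real ^ 'd"
  define P where "P = (\<Prod>i\<in>UNIV-{k}. u i (x $ i))"
  have split: "tensor w z = w k (z $ k) * (\<Prod>i\<in>UNIV-{k}. w i (z $ i))" for w and z :: "real ^ 'd"
    unfolding tensor_def by (rule prod.remove) auto
  have "(\<lambda>t. tensor u (x + t *\<^sub>R axis k 1)) = (\<lambda>t. u k (1 * t + x $ k) * P)"
    unfolding P_def split by (auto simp: axis_def add.commute fun_eq_iff intro!: prod.cong)
  moreover have "((\<lambda>t. u k (1 * t + x $ k) * P) has_vector_derivative vderiv (u k) (1 * 0 + x $ k) * P) (at 0)"
    using smooth1_has_vector_derivative[OF smooth1_affine(1)[OF assms, of 1 "x $ k"], of 0]
      vderiv_affine[OF assms, of 1 "x $ k"]
    by (intro has_vector_derivative_mult_left) simp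
  ultimately have "partial_deriv k (tensor u) x = vderiv (u k) (x $ k) * P"
    unfolding partial_deriv_def by (simp add: vector_derivative_at)
  also have "\<dots> = tensor (u(k := vderiv (u k))) x"
    unfolding split P_def by (auto intro!: prod.cong)
  finally show "partial_deriv k (tensor u) x = tensor (u(k := vderiv (u k))) x" .
qed

text \<open>Each differentiation acts on its own factor, so only the multiplicity of a coordinate in
  the list matters and not its position. On tensor products the choice of \<open>coords\<close> is
  thereby immaterial.\<close>

lemma foldr_partial_deriv_tensor:
  assumes "\<And>i. smooth1 (u i)"
  shows "foldr partial_deriv is (tensor u) = tensor (\<lambda>i. (vderiv ^^ count_list is i) (u i))"
proof (induction "is")
  case (Cons k ks)
  then show ?case
    by (subst foldr.simps) (auto simp: partial_deriv_tensor smooth1_vderiv_pow assms intro!: arg_cong[where f = tensor])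
qed simp

lemma tensor_differentiable:
  fixes u :: "'d::finite \<Rightarrow> real \<Rightarrow> complex"
  assumes "\<And>i. smooth1 (u i)"
  shows "tensor u differentiable (at x)"
proof -
  have *: "(\<lambda>x::real ^ 'd. u i (x $ i)) differentiable (at x)" for i
  proof -
    have "(u i \<circ> (\<lambda>x::real ^ 'd. x $ i)) differentiable (at x)"
      by (intro differentiable_chain_at bounded_linear_imp_differentiable bounded_linear_vec_nth
          smooth1_differentiable assms)
    then show ?thesis by (simp add: o_def)
  qed
  have "(\<lambda>x. \<Prod>i\<in>A. u i (x $ i)) differentiable (at x)" if "finite A" for A
    using that by induction (auto intro!: differentiable_mult *)
  then show ?thesis unfolding tensor_def[abs_def] by simp
qed

lemma smooth_tensor: "(\<And>i. smooth1 (u i)) \<Longrightarrow> smooth (tensor u)"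
  unfolding smooth_def by (simp add: foldr_partial_deriv_tensor tensor_differentiable smooth1_vderiv_pow)

text \<open>As a list of coordinates in the order of \<open>coords\<close>, a multi-index admits
  inductions that strip one partial derivative at a time.\<close>

definition mlist :: "nat ^ 'd::finite \<Rightarrow> 'd list" where
  "mlist j = concat (map (\<lambda>i. replicate (j $ i) i) coords)"

lemma mderiv_eq_foldr: "mderiv j \<phi> = foldr partial_deriv (mlist j) \<phi>"
proof -
  have rep: "foldr partial_deriv (replicate n i) \<psi> = (partial_deriv i ^^ n) \<psi>" for n i and \<psi> :: "real ^ 'd \<Rightarrow> complex"
    by (induction n) auto
  have "foldr (\<lambda>i. partial_deriv i ^^ (j $ i)) cs \<phi>
      = foldr partial_deriv (concat (map (\<lambda>i. replicate (j $ i) i) cs)) \<phi>" for cs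
    by (induction cs) (auto simp: rep)
  then show ?thesis by (simp add: mderiv_def mlist_def)
qed

lemma distinct_coords: "distinct (coords :: 'd::finite list)" and set_coords: "set (coords :: 'd::finite list) = UNIV"
proof -
  have "\<exists>is :: 'd list. distinct is \<and> set is = UNIV"
    using finite_distinct_list[of "UNIV :: 'd set"] by auto
  from someI_ex[OF this] show "distinct (coords :: 'd list)" "set (coords :: 'd list) = UNIV"
    by (auto simp: coords_def)
qed

lemma count_mlist: "count_list (mlist j) i = j $ i"
proof -
  have rep: "count_list (replicate n k) i = (if k = i then n else 0)" for n k
    by (induction n) auto
  have "count_list (concat (map (\<lambda>i. replicate (j $ i) i) cs)) i = (if i \<in> set cs then j $ i else 0)"
    if "distinct cs" for cs
    using that by (induction cs) (auto simp: rep)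
  then show ?thesis by (simp add: mlist_def distinct_coords set_coords)
qed

lemma mderiv_tensor:
  "(\<And>i. smooth1 (u i)) \<Longrightarrow> mderiv j (tensor u) = tensor (\<lambda>i. (vderiv ^^ (j $ i)) (u i))"
  by (simp add: mderiv_eq_foldr foldr_partial_deriv_tensor count_mlist)

lemma tensor_weight: "\<bar>\<Prod>i\<in>UNIV. x $ i ^ (a $ i)\<bar> * cmod (tensor u x) = (\<Prod>i\<in>UNIV. \<bar>x $ i\<bar> ^ (a $ i) * cmod (u i (x $ i)))"
  by (simp add: tensor_def abs_prod prod_norm power_abs prod.distrib)

lemma tensor_in_schwartz:
  assumes "\<And>i. schwartz1 (u i)" shows "tensor u \<in> schwartz_space"
proof -
  have sm: "\<And>i. smooth1 (u i)" using assms by (simp add: schwartz1_smooth1)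
  have "bdd_above (range (\<lambda>x. \<bar>\<Prod>i\<in>UNIV. x $ i ^ (a $ i)\<bar> * cmod (mderiv b (tensor u) x)))" for a b
  proof -
    have "\<exists>C. \<forall>i x. \<bar>x\<bar> ^ (a $ i) * cmod ((vderiv ^^ (b $ i)) (u i) x) \<le> C i"
      by (rule choice) (use schwartz1_bound[OF assms] in blast)
    then obtain C where C: "\<And>i x. \<bar>x\<bar> ^ (a $ i) * cmod ((vderiv ^^ (b $ i)) (u i) x) \<le> C i" by blast
    have "\<bar>\<Prod>i\<in>UNIV. x $ i ^ (a $ i)\<bar> * cmod (mderiv b (tensor u) x) \<le> (\<Prod>i\<in>UNIV. C i)" for x
      unfolding mderiv_tensor[OF sm] tensor_weight by (intro prod_mono conjI C mult_nonneg_nonneg) auto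
    then show ?thesis by (intro bdd_aboveI2)
  qed
  then show ?thesis using smooth_tensor[OF sm] by (simp add: schwartz_space_def)
qed

lemma tensor_in_test_functions:
  assumes "\<And>i. test1 (u i)" shows "tensor u \<in> test_functions"
proof -
  have "\<exists>\<rho>. \<forall>i x. \<rho> i < \<bar>x\<bar> \<longrightarrow> u i x = 0"
    using assms unfolding test1_def by metis
  then obtain \<rho> where \<rho>: "\<And>i x. \<rho> i < \<bar>x\<bar> \<Longrightarrow> u i x = 0" by blast
  have "tensor u x = 0" if x: "x \<notin> cbox (\<chi> i. - \<rho> i) (\<chi> i. \<rho> i)" for x
  proof -
    obtain i where "\<not> (- \<rho> i \<le> x $ i \<and> x $ i \<le> \<rho> i)"
      using x by (auto simp: mem_box_cart)
    then have "\<rho> i < \<bar>x $ i\<bar>" by linarith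
    then have "u i (x $ i) = 0" by (rule \<rho>)
    then show ?thesis unfolding tensor_def by (intro prod_zero) auto
  qed
  then show ?thesis
    using assms smooth_tensor[of u] compact_cbox[of "\<chi> i. - \<rho> i" "\<chi> i. \<rho> i"]
    unfolding test_functions_def test1_def by blast
qed

text \<open>Lebesgue measure on the vector space is the image of a product measure indexed by the
  basis vectors, where the integral of a product factors; \<open>ix\<close> recovers the coordinate
  that belongs to a basis vector.\<close>

lemma integral_prod_coordinates:
  fixes w :: "'d::finite \<Rightarrow> real \<Rightarrow> complex"
  assumes int: "\<And>i. integrable lborel (w i)"
  shows "(LINT x|(lborel :: (real ^ 'd) measure). (\<Prod>i\<in>UNIV. w i (x $ i))) = (\<Prod>i\<in>UNIV. (LINT t|lborel. w i t))"
proof -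
  interpret product_sigma_finite "\<lambda>_::real ^ 'd. lborel :: real measure" ..
  let ?ax = "\<lambda>i::'d. axis i 1 :: real ^ 'd"
  define ix where "ix b = (THE i. b = ?ax i)" for b
  have ix: "ix (?ax i) = i" for i by (auto simp: ix_def axis_eq_axis)
  have B: "Basis = range ?ax" by (auto simp: Basis_vec_def)
  have inj: "inj ?ax" by (auto simp: inj_def axis_eq_axis)
  have [measurable]: "w i \<in> borel_measurable borel" for i
    using borel_measurable_integrable[OF int] by simp
  have comp: "(\<Sum>b\<in>Basis. f b *\<^sub>R b) $ i = f (?ax i)" for f :: "real ^ 'd \<Rightarrow> real" and i
  proof -
    have "(\<Sum>b\<in>Basis. f b *\<^sub>R b) $ i = (\<Sum>b\<in>Basis. f b *\<^sub>R b) \<bullet> ?ax i"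
      by (simp add: inner_axis)
    also have "\<dots> = f (?ax i)" using B by (intro inner_sum_left_Basis) auto
    finally show ?thesis .
  qed
  have "(LINT x|(lborel :: (real ^ 'd) measure). (\<Prod>i\<in>UNIV. w i (x $ i)))
      = (LINT f|(\<Pi>\<^sub>M b\<in>Basis. lborel). (\<Prod>i\<in>UNIV. w i ((\<Sum>b\<in>Basis. f b *\<^sub>R b) $ i)))"
    by (subst lborel_eq, subst integral_distr) auto
  also have "\<dots> = (LINT f|(\<Pi>\<^sub>M b\<in>Basis. lborel). (\<Prod>b\<in>Basis. w (ix b) (f b)))"
    unfolding comp unfolding B by (simp add: prod.reindex[OF inj] ix)
  also have "\<dots> = (\<Prod>b\<in>Basis. (LINT t|lborel. w (ix b) t))"
    by (rule product_integral_prod) (auto simp: int)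
  also have "\<dots> = (\<Prod>i\<in>UNIV. (LINT t|lborel. w i t))"
    unfolding B by (simp add: prod.reindex[OF inj] ix)
  finally show ?thesis .
qed

lemma fourier_tensor:
  fixes v :: "'d::finite \<Rightarrow> real \<Rightarrow> complex"
  assumes "\<And>i. schwartz1 (v i)"
  shows "fourier (tensor v) = tensor (\<lambda>i. fourier1 (v i))"
proof
  fix y :: "real ^ 'd"
  have "tensor v x * exp (- 2 * complex_of_real pi * \<i> * complex_of_real (x \<bullet> y))
      = (\<Prod>i\<in>UNIV. v i (x $ i) * exp (- 2 * complex_of_real pi * \<i> * complex_of_real (x $ i * y $ i)))" for x
    by (simp add: tensor_def inner_vec_def prod.distrib sum_distrib_left exp_sum)
  then have "fourier (tensor v) y = (LINT x|lborel. (\<Prod>i\<in>UNIV. v i (x $ i) * exp (- 2 * complex_of_real pi * \<i> * complex_of_real (x $ i * y $ i))))"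
    by (simp add: fourier_def)
  also have "\<dots> = tensor (\<lambda>i. fourier1 (v i)) y"
    unfolding tensor_def fourier1_def
    by (rule integral_prod_coordinates[of "\<lambda>i t. v i t * exp (- 2 * complex_of_real pi * \<i> * complex_of_real (t * y $ i))"])
       (rule integrable_mult_exp[OF schwartz1_integrable[OF assms]])
  finally show "fourier (tensor v) y = tensor (\<lambda>i. fourier1 (v i)) y" .
qed

text \<open>Telescoping with z Z - w W = (z - w) Z + w (Z - W). The bound \<open>B\<close> on the
  unperturbed product travels through the induction because it controls Z as well: |Z| is at most B
  + |E|, as \<open>r\<close> stays below 1.\<close>

lemma prod_perturbation:
  fixes z w :: "'i \<Rightarrow> 'p \<Rightarrow> complex" and r :: "'p \<Rightarrow> real"
  assumes "finite A" "\<And>p. p \<in> P \<Longrightarrow> 0 \<le> r p \<and> r p \<le> 1"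
    and "\<And>i p. i \<in> A \<Longrightarrow> p \<in> P \<Longrightarrow> cmod (w i p) \<le> C i"
    and "\<And>i p. i \<in> A \<Longrightarrow> p \<in> P \<Longrightarrow> cmod (z i p - w i p) \<le> D i * r p"
  shows "\<exists>E B. \<forall>p\<in>P. cmod ((\<Prod>i\<in>A. z i p) - (\<Prod>i\<in>A. w i p)) \<le> E * r p \<and> cmod (\<Prod>i\<in>A. w i p) \<le> B"
  using assms(1,3,4)
proof (induction A)
  case empty
  show ?case by (rule exI[of _ 0], rule exI[of _ 1]) auto
next
  case (insert k A)
  obtain E B where EB: "\<And>p. p \<in> P \<Longrightarrow> cmod ((\<Prod>i\<in>A. z i p) - (\<Prod>i\<in>A. w i p)) \<le> E * r p"
    "\<And>p. p \<in> P \<Longrightarrow> cmod (\<Prod>i\<in>A. w i p) \<le> B"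
    using insert by (metis insertCI)
  have C: "p \<in> P \<Longrightarrow> cmod (w k p) \<le> C k" and D: "p \<in> P \<Longrightarrow> cmod (z k p - w k p) \<le> D k * r p" for p
    using insert by auto
  show ?case
  proof (intro exI ballI conjI)
    fix p assume p: "p \<in> P"
    let ?Z = "\<Prod>i\<in>A. z i p" and ?W = "\<Prod>i\<in>A. w i p"
    have r: "0 \<le> r p" "r p \<le> 1" using assms(2) p by auto
    have D0: "0 \<le> D k * r p" and E0: "0 \<le> E * r p" and B0: "0 \<le> B" and C0: "0 \<le> C k"
      using order.trans[OF norm_ge_zero] D[OF p] EB[OF p] C[OF p] by blast+
    have E1: "E * r p \<le> \<bar>E\<bar>" using r by (metis abs_ge_self abs_mult abs_of_nonneg E0 mult_left_le abs_ge_zero)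
    have "cmod ?Z \<le> cmod ?W + cmod (?Z - ?W)" by (metis norm_triangle_sub add.commute)
    also have "\<dots> \<le> B + \<bar>E\<bar>" using EB[OF p] E1 by linarith
    finally have Z: "cmod ?Z \<le> B + \<bar>E\<bar>" .
    have "z k p * ?Z - w k p * ?W = (z k p - w k p) * ?Z + w k p * (?Z - ?W)"
      by (simp add: algebra_simps)
    then have "cmod (z k p * ?Z - w k p * ?W) \<le> cmod (z k p - w k p) * cmod ?Z + cmod (w k p) * cmod (?Z - ?W)"
      by (metis norm_mult norm_triangle_ineq)
    also have "\<dots> \<le> (D k * r p) * (B + \<bar>E\<bar>) + C k * (E * r p)"
      by (intro add_mono mult_mono D EB C Z p) (use D0 C0 in auto)
    finally show "cmod ((\<Prod>i\<in>insert k A. z i p) - (\<Prod>i\<in>insert k A. w i p)) \<le> (D k * (B + \<bar>E\<bar>) + C k * E) * r p"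
      using insert by (simp add: algebra_simps)
    show "cmod (\<Prod>i\<in>insert k A. w i p) \<le> C k * B"
      using insert C[OF p] EB(2)[OF p] C0 by (simp add: norm_mult mult_mono)
  qed
qed

text \<open>The monomial weight is distributed over the factors, and
  \<open>prod_perturbation\<close> is applied with the pairs (R, x) as parameters and 1/R as the
  small quantity, which makes the constant uniform in both.\<close>

lemma tensor_seminorm_perturbation:
  fixes u :: "'d::finite \<Rightarrow> real \<Rightarrow> complex" and uR :: "real \<Rightarrow> 'd \<Rightarrow> real \<Rightarrow> complex"
  assumes u: "\<And>i. schwartz1 (u i)" and uR: "\<And>R i. R \<ge> 1 \<Longrightarrow> schwartz1 (uR R i)"
    and d: "\<And>i a b. \<exists>C. \<forall>R\<ge>1. \<forall>x. \<bar>x\<bar> ^ a * cmod ((vderiv ^^ b) (uR R i) x - (vderiv ^^ b) (u i) x) \<le> C / R"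
  shows "\<exists>C. \<forall>R\<ge>1. \<forall>x. \<bar>\<Prod>i\<in>UNIV. x $ i ^ (a $ i)\<bar> * cmod (mderiv b (tensor (uR R)) x - mderiv b (tensor u) x) \<le> C / R"
proof -
  have "\<exists>C. \<forall>i x. \<bar>x\<bar> ^ (a $ i) * cmod ((vderiv ^^ (b $ i)) (u i) x) \<le> C i"
    by (rule choice) (use schwartz1_bound[OF u] in blast)
  then obtain C where C: "\<And>i x. \<bar>x\<bar> ^ (a $ i) * cmod ((vderiv ^^ (b $ i)) (u i) x) \<le> C i" by blast
  have "\<exists>D. \<forall>i. \<forall>R\<ge>1. \<forall>x. \<bar>x\<bar> ^ (a $ i) * cmod ((vderiv ^^ (b $ i)) (uR R i) x - (vderiv ^^ (b $ i)) (u i) x) \<le> D i / R"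
    by (rule choice) (use d in blast)
  then obtain D where D: "\<And>i R x. R \<ge> 1 \<Longrightarrow>
      \<bar>x\<bar> ^ (a $ i) * cmod ((vderiv ^^ (b $ i)) (uR R i) x - (vderiv ^^ (b $ i)) (u i) x) \<le> D i / R" by blast
  define z where "z i p = of_real ((snd p $ i) ^ (a $ i)) * (vderiv ^^ (b $ i)) (uR (fst p) i) (snd p $ i)"
    for i and p :: "real \<times> (real ^ 'd)"
  define w where "w i p = of_real ((snd p $ i) ^ (a $ i)) * (vderiv ^^ (b $ i)) (u i) (snd p $ i)"
    for i and p :: "real \<times> (real ^ 'd)"
  have "\<exists>E B. \<forall>p\<in>{1..} \<times> UNIV. cmod ((\<Prod>i\<in>UNIV. z i p) - (\<Prod>i\<in>UNIV. w i p)) \<le> E * (1 / fst p)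
      \<and> cmod (\<Prod>i\<in>UNIV. w i p) \<le> B"
  proof (rule prod_perturbation)
    show "cmod (w i p) \<le> C i" for i p
      using C[of "snd p $ i" i] by (simp add: w_def norm_mult norm_power)
    show "cmod (z i p - w i p) \<le> D i * (1 / fst p)" if "p \<in> {1..} \<times> UNIV" for i p
      using D[of "fst p" "snd p $ i" i] that
      by (simp add: z_def w_def norm_mult norm_power right_diff_distrib[symmetric] mem_Times_iff)
  qed auto
  then obtain E where E: "\<And>p. p \<in> {1..} \<times> UNIV \<Longrightarrow> cmod ((\<Prod>i\<in>UNIV. z i p) - (\<Prod>i\<in>UNIV. w i p)) \<le> E * (1 / fst p)"
    by blast
  have "\<bar>\<Prod>i\<in>UNIV. x $ i ^ (a $ i)\<bar> * cmod (mderiv b (tensor (uR R)) x - mderiv b (tensor u) x) \<le> E / R"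
    if R: "R \<ge> 1" for R and x :: "real ^ 'd"
  proof -
    have "\<bar>\<Prod>i\<in>UNIV. x $ i ^ (a $ i)\<bar> * cmod (mderiv b (tensor (uR R)) x - mderiv b (tensor u) x)
        = cmod (of_real (\<Prod>i\<in>UNIV. x $ i ^ (a $ i)) * (mderiv b (tensor (uR R)) x - mderiv b (tensor u) x))"
      by (simp add: norm_mult del: of_real_prod)
    also have "of_real (\<Prod>i\<in>UNIV. x $ i ^ (a $ i)) * (mderiv b (tensor (uR R)) x - mderiv b (tensor u) x)
        = (\<Prod>i\<in>UNIV. z i (R, x)) - (\<Prod>i\<in>UNIV. w i (R, x))"
      using u uR[OF R] by (simp add: mderiv_tensor schwartz1_smooth1 z_def w_def tensor_def prod.distrib right_diff_distrib)
    finally show ?thesis using E[of "(R, x)"] R by simp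
  qed
  then show ?thesis by blast
qed

section \<open>Smooth functions of several variables\<close>

lemma smooth_coinduct:
  assumes "\<phi> \<in> X" "\<And>\<psi> x. \<psi> \<in> X \<Longrightarrow> \<psi> differentiable (at x)" "\<And>\<psi> i. \<psi> \<in> X \<Longrightarrow> partial_deriv i \<psi> \<in> X"
  shows "smooth \<phi>"
proof -
  have "foldr partial_deriv is \<phi> \<in> X" for "is"
    by (induction "is") (auto simp: assms)
  then show ?thesis using assms(2) by (auto simp: smooth_def)
qed

lemma smooth_differentiable: "smooth \<phi> \<Longrightarrow> \<phi> differentiable (at x)"
  unfolding smooth_def by (metis foldr.simps(1) id_apply)

lemma smooth_partial_deriv: "smooth \<phi> \<Longrightarrow> smooth (partial_deriv i \<phi>)"
  unfolding smooth_def
proof (intro allI)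
  fix ks x assume "\<forall>is x. foldr partial_deriv is \<phi> differentiable (at x)"
  then have "foldr partial_deriv (ks @ [i]) \<phi> differentiable (at x)" by blast
  then show "foldr partial_deriv ks (partial_deriv i \<phi>) differentiable (at x)" by simp
qed

lemma smooth_foldr: "smooth \<phi> \<Longrightarrow> smooth (foldr partial_deriv is \<phi>)"
  by (induction "is") (auto simp: smooth_partial_deriv)

lemma has_partial_deriv:
  assumes "\<phi> differentiable (at x)"
  shows "((\<lambda>t. \<phi> (x + t *\<^sub>R axis i 1)) has_vector_derivative partial_deriv i \<phi> x) (at 0)"
proof -
  have "(\<phi> \<circ> (\<lambda>t. x + t *\<^sub>R axis i 1)) differentiable (at 0)"
    by (rule differentiable_chain_at) (use assms in \<open>auto intro!: derivative_intros\<close>)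
  then show ?thesis
    unfolding partial_deriv_def o_def by (simp add: vector_derivative_works)
qed

lemma partial_derivI:
  "((\<lambda>t. \<phi> (x + t *\<^sub>R axis i 1)) has_vector_derivative D) (at 0) \<Longrightarrow> partial_deriv i \<phi> x = D"
  unfolding partial_deriv_def by (rule vector_derivative_at)

lemma partial_deriv_add:
  assumes "\<phi> differentiable (at x)" "\<psi> differentiable (at x)"
  shows "partial_deriv i (\<lambda>x. \<phi> x + \<psi> x) x = partial_deriv i \<phi> x + partial_deriv i \<psi> x"
  by (rule partial_derivI) (intro has_vector_derivative_add has_partial_deriv assms)

lemma partial_deriv_mult:
  assumes "\<phi> differentiable (at x)" "\<psi> differentiable (at x)"
  shows "partial_deriv i (\<lambda>x. \<phi> x * \<psi> x) x = \<phi> x * partial_deriv i \<psi> x + partial_deriv i \<phi> x * \<psi> x"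
  using has_vector_derivative_mult[OF has_partial_deriv[OF assms(1), of i] has_partial_deriv[OF assms(2), of i]]
  by (intro partial_derivI) simp

lemma partial_deriv_const: "partial_deriv i (\<lambda>x. c) = (\<lambda>x. 0)"
  by (rule ext, rule partial_derivI) simp

lemma smooth_const: "smooth (\<lambda>x. c)"
  by (rule smooth_coinduct[of _ "range (\<lambda>c x. c)"]) (auto simp: partial_deriv_const)

lemma smooth_add:
  assumes "smooth \<phi>" "smooth \<psi>" shows "smooth (\<lambda>x. \<phi> x + \<psi> x)"
proof (rule smooth_coinduct[of _ "{\<lambda>x. \<phi> x + \<psi> x |\<phi> \<psi>. smooth \<phi> \<and> smooth \<psi>}"])
  fix w assume "w \<in> {\<lambda>x. \<phi> x + \<psi> x |\<phi> \<psi>. smooth \<phi> \<and> smooth \<psi>}"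
  then obtain u v where w: "w = (\<lambda>x. u x + v x)" "smooth u" "smooth v" by blast
  show "w differentiable (at x)" for x
    unfolding w by (intro differentiable_add smooth_differentiable w)
  have "partial_deriv i w = (\<lambda>x. partial_deriv i u x + partial_deriv i v x)" for i
    unfolding w(1) using w(2,3) by (simp add: fun_eq_iff partial_deriv_add smooth_differentiable)
  then show "partial_deriv i w \<in> {\<lambda>x. \<phi> x + \<psi> x |\<phi> \<psi>. smooth \<phi> \<and> smooth \<psi>}" for i
    using w(2,3) smooth_partial_deriv by blast
qed (use assms in blast)

inductive_set product_sums :: "(real ^ 'd::finite \<Rightarrow> complex) set" where
  prod: "smooth u \<Longrightarrow> smooth v \<Longrightarrow> (\<lambda>x. u x * v x) \<in> product_sums"
| sum: "u \<in> product_sums \<Longrightarrow> v \<in> product_sums \<Longrightarrow> (\<lambda>x. u x + v x) \<in> product_sums"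

lemma smooth_mult:
  assumes "smooth u" "smooth v" shows "smooth (\<lambda>x. u x * v x)"
proof (rule smooth_coinduct[of _ product_sums])
  show diff: "w differentiable (at x)" if "w \<in> product_sums" for w and x :: "real ^ 'a"
    using that
    by (induction rule: product_sums.induct)
       (simp_all add: differentiable_mult differentiable_add smooth_differentiable)
  show "partial_deriv i w \<in> product_sums" if "w \<in> product_sums" for w :: "real ^ 'a \<Rightarrow> complex" and i
    using that
  proof (induction rule: product_sums.induct)
    case (prod u v)
    have "partial_deriv i (\<lambda>x. u x * v x) = (\<lambda>x. u x * partial_deriv i v x + partial_deriv i u x * v x)"
      using prod by (simp add: fun_eq_iff partial_deriv_mult smooth_differentiable)
    then show ?case
      using prod by (auto intro!: product_sums.intros simp: smooth_partial_deriv)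
  next
    case (sum u v)
    have "partial_deriv i (\<lambda>x. u x + v x) = (\<lambda>x. partial_deriv i u x + partial_deriv i v x)"
      using sum diff by (simp add: fun_eq_iff partial_deriv_add)
    then show ?case using sum by (auto intro!: product_sums.intros)
  qed
qed (use assms product_sums.prod in auto)

section \<open>Linear combinations and dilations\<close>

lemma foldr_partial_deriv_add:
  assumes "smooth \<phi>" "smooth \<psi>"
  shows "foldr partial_deriv is (\<lambda>x. \<phi> x + \<psi> x) = (\<lambda>x. foldr partial_deriv is \<phi> x + foldr partial_deriv is \<psi> x)"
proof (induction "is")
  case (Cons i ks)
  show ?case unfolding foldr.simps comp_apply Cons.IH
    by (rule ext) (intro partial_deriv_add smooth_differentiable smooth_foldr assms)
qed simp

lemma foldr_partial_deriv_cmult: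
  assumes "smooth \<phi>"
  shows "foldr partial_deriv is (\<lambda>x. c * \<phi> x) = (\<lambda>x. c * foldr partial_deriv is \<phi> x)"
proof (induction "is")
  case (Cons i ks)
  show ?case unfolding foldr.simps comp_apply Cons.IH
    by (rule ext, subst partial_deriv_mult)
       (simp_all add: smooth_differentiable smooth_const smooth_foldr partial_deriv_const assms)
qed simp

lemma smooth_lin_comb: "smooth \<phi> \<Longrightarrow> smooth \<psi> \<Longrightarrow> smooth (\<lambda>x. a * \<phi> x + b * \<psi> x)"
  by (intro smooth_add smooth_mult smooth_const)

lemma mderiv_lin_comb:
  "smooth \<phi> \<Longrightarrow> smooth \<psi> \<Longrightarrow> mderiv j (\<lambda>x. a * \<phi> x + b * \<psi> x) = (\<lambda>x. a * mderiv j \<phi> x + b * mderiv j \<psi> x)"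
  unfolding mderiv_eq_foldr
  by (subst foldr_partial_deriv_add) (simp_all add: foldr_partial_deriv_cmult smooth_mult smooth_const)

lemma mderiv_diff:
  "smooth \<phi> \<Longrightarrow> smooth \<psi> \<Longrightarrow> mderiv j (\<lambda>x. \<phi> x - \<psi> x) = (\<lambda>x. mderiv j \<phi> x - mderiv j \<psi> x)"
  using mderiv_lin_comb[of \<phi> \<psi> j 1 "-1"] by simp

lemma has_partial_deriv_dilation:
  assumes "smooth \<phi>"
  shows "((\<lambda>t. a * \<phi> (c *\<^sub>R (x + t *\<^sub>R axis i 1))) has_vector_derivative
    a * of_real c * partial_deriv i \<phi> (c *\<^sub>R x)) (at 0)"
proof -
  have "((\<lambda>t. \<phi> (c *\<^sub>R x + t *\<^sub>R axis i 1)) \<circ> (\<lambda>t. c * t) has_vector_derivative c *\<^sub>R partial_deriv i \<phi> (c *\<^sub>R x)) (at 0)"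
    by (rule vector_diff_chain_at)
       (use has_partial_deriv[OF smooth_differentiable[OF assms]] in
         \<open>auto intro!: derivative_eq_intros simp flip: has_real_derivative_iff_has_vector_derivative\<close>)
  moreover have "c *\<^sub>R (x + t *\<^sub>R axis i 1) = c *\<^sub>R x + (c * t) *\<^sub>R axis i 1" for t
    by (simp add: scaleR_add_right)
  ultimately show ?thesis
    using has_vector_derivative_mult_right[of "\<lambda>t. \<phi> (c *\<^sub>R (x + t *\<^sub>R axis i 1))" _ "at 0" a]
    by (simp add: o_def scaleR_conv_of_real[where 'a = complex] mult.assoc)
qed

lemma smooth_dilation:
  assumes "smooth \<phi>" shows "smooth (\<lambda>x. \<phi> (c *\<^sub>R x))"
proof (rule smooth_coinduct[of _ "{\<lambda>x. a * \<phi> (c *\<^sub>R x) | a \<phi>. smooth \<phi>}"])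
  show "(\<lambda>x. \<phi> (c *\<^sub>R x)) \<in> {\<lambda>x. a * \<phi> (c *\<^sub>R x) | a \<phi>. smooth \<phi>}"
    using assms by (force intro!: exI[of _ 1])
  fix w assume "w \<in> {\<lambda>x. a * \<phi> (c *\<^sub>R x) | a \<phi>. smooth \<phi>}"
  then obtain a u where w: "w = (\<lambda>x. a * u (c *\<^sub>R x))" "smooth u" by blast
  show "w differentiable (at x)" for x
  proof -
    have "(u \<circ> (\<lambda>x. c *\<^sub>R x)) differentiable (at x)"
      by (rule differentiable_chain_at) (use w smooth_differentiable in \<open>auto intro!: derivative_intros\<close>)
    then show ?thesis unfolding w(1) o_def by (intro differentiable_mult) auto
  qed
  have "partial_deriv i w = (\<lambda>x. (a * of_real c) * partial_deriv i u (c *\<^sub>R x))" for i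
    unfolding w(1) by (rule ext, rule partial_derivI, rule has_partial_deriv_dilation[OF w(2)])
  then show "partial_deriv i w \<in> {\<lambda>x. a * \<phi> (c *\<^sub>R x) | a \<phi>. smooth \<phi>}" for i
    using smooth_partial_deriv[OF w(2)] by blast
qed

lemma partial_deriv_dilation:
  "smooth \<phi> \<Longrightarrow> partial_deriv i (\<lambda>x. \<phi> (c *\<^sub>R x)) = (\<lambda>x. of_real c * partial_deriv i \<phi> (c *\<^sub>R x))"
  using has_partial_deriv_dilation[of \<phi> 1] by (intro ext partial_derivI) simp

section \<open>Continuity of tempered distributions\<close>

abbreviation weight :: "nat ^ 'd::finite \<Rightarrow> real ^ 'd \<Rightarrow> real" where
  "weight a x \<equiv> \<bar>\<Prod>i\<in>UNIV. x $ i ^ (a $ i)\<bar>"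

lemma schwartz_smooth: "\<phi> \<in> schwartz_space \<Longrightarrow> smooth \<phi>"
  by (simp add: schwartz_space_def)

lemma schwartz_seminorm_upper:
  "\<phi> \<in> schwartz_space \<Longrightarrow> weight a x * cmod (mderiv b \<phi> x) \<le> schwartz_seminorm a b \<phi>"
  unfolding schwartz_seminorm_def by (rule cSUP_upper) (auto simp: schwartz_space_def)

lemma schwartz_seminorm_least:
  "(\<And>x. weight a x * cmod (mderiv b \<phi> x) \<le> C) \<Longrightarrow> schwartz_seminorm a b \<phi> \<le> C"
  unfolding schwartz_seminorm_def by (rule cSUP_least) auto

lemma schwartz_seminorm_nonneg: "\<phi> \<in> schwartz_space \<Longrightarrow> 0 \<le> schwartz_seminorm a b \<phi>"
  using order.trans[OF _ schwartz_seminorm_upper[where a = a and b = b and x = 0 and \<phi> = \<phi>]] by simp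

lemma schwartz_spaceI:
  assumes "smooth \<phi>" "\<And>a b. \<exists>C. \<forall>x. weight a x * cmod (mderiv b \<phi> x) \<le> C"
  shows "\<phi> \<in> schwartz_space"
  using assms unfolding schwartz_space_def by (auto simp: bdd_above_def)

lemma lin_comb_weight_le:
  assumes "\<phi> \<in> schwartz_space" "\<psi> \<in> schwartz_space"
  shows "weight j x * cmod (mderiv k (\<lambda>x. a * \<phi> x + b * \<psi> x) x)
    \<le> cmod a * schwartz_seminorm j k \<phi> + cmod b * schwartz_seminorm j k \<psi>"
proof -
  have "weight j x * cmod (mderiv k (\<lambda>x. a * \<phi> x + b * \<psi> x) x)
      \<le> weight j x * (cmod a * cmod (mderiv k \<phi> x) + cmod b * cmod (mderiv k \<psi> x))"
    using assms by (intro mult_left_mono)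
      (auto simp: mderiv_lin_comb schwartz_smooth norm_mult intro!: norm_triangle_le)
  also have "\<dots> = cmod a * (weight j x * cmod (mderiv k \<phi> x)) + cmod b * (weight j x * cmod (mderiv k \<psi> x))"
    by (simp add: algebra_simps)
  also have "\<dots> \<le> cmod a * schwartz_seminorm j k \<phi> + cmod b * schwartz_seminorm j k \<psi>"
    by (intro add_mono mult_left_mono schwartz_seminorm_upper assms) auto
  finally show ?thesis .
qed

lemma schwartz_lin_comb:
  assumes "\<phi> \<in> schwartz_space" "\<psi> \<in> schwartz_space"
  shows "(\<lambda>x. a * \<phi> x + b * \<psi> x) \<in> schwartz_space"
proof (rule schwartz_spaceI)
  show "smooth (\<lambda>x. a * \<phi> x + b * \<psi> x)"
    by (intro smooth_lin_comb schwartz_smooth assms)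
  show "\<exists>C. \<forall>x. weight j x * cmod (mderiv k (\<lambda>x. a * \<phi> x + b * \<psi> x) x) \<le> C" for j k
    by (rule exI, rule allI, rule lin_comb_weight_le[OF assms])
qed

lemma schwartz_diff:
  "\<phi> \<in> schwartz_space \<Longrightarrow> \<psi> \<in> schwartz_space \<Longrightarrow> (\<lambda>x. \<phi> x - \<psi> x) \<in> schwartz_space"
  using schwartz_lin_comb[of \<phi> \<psi> 1 "-1"] by simp

lemma schwartz_seminorm_triangle:
  assumes "\<phi> \<in> schwartz_space" "\<psi> \<in> schwartz_space"
  shows "schwartz_seminorm a b (\<lambda>x. \<phi> x + \<psi> x) \<le> schwartz_seminorm a b \<phi> + schwartz_seminorm a b \<psi>"
  using lin_comb_weight_le[OF assms, where j = a and k = b and a = 1 and b = 1] by (intro schwartz_seminorm_least) simp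

lemma schwartz_seminorm_cmult:
  assumes "\<phi> \<in> schwartz_space"
  shows "schwartz_seminorm a b (\<lambda>x. c * \<phi> x) \<le> cmod c * schwartz_seminorm a b \<phi>"
  using lin_comb_weight_le[OF assms assms, where j = a and k = b and a = c and b = 0] by (intro schwartz_seminorm_least) simp

lemma tempered_lin:
  "tempered_distribution f \<Longrightarrow> \<phi> \<in> schwartz_space \<Longrightarrow> \<psi> \<in> schwartz_space \<Longrightarrow>
    f (\<lambda>x. a * \<phi> x + b * \<psi> x) = a * f \<phi> + b * f \<psi>"
  unfolding tempered_distribution_def by blast

lemma tempered_diff:
  "tempered_distribution f \<Longrightarrow> \<phi> \<in> schwartz_space \<Longrightarrow> \<psi> \<in> schwartz_space \<Longrightarrow>
    f (\<lambda>x. \<phi> x - \<psi> x) = f \<phi> - f \<psi>"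
  using tempered_lin[of f \<phi> \<psi> 1 "-1"] by simp

lemma zero_in_schwartz: "(\<lambda>x. 0) \<in> schwartz_space"
proof -
  \<comment> \<open>The dimension is positive, so the tensor product of zero functions is the zero
    function and not the empty product 1.\<close>
  have "tensor (\<lambda>(i::'a) x. 0) \<in> schwartz_space"
    by (rule tensor_in_schwartz) (simp add: test1_schwartz1 test1_def)
  then show ?thesis by (simp add: tensor_def[abs_def] zero_power)
qed

text \<open>Continuity at 0 provides finitely many seminorms whose joint smallness forces |f| < 1,
  and scaling turns this into a linear bound. The topology is generated by seminorm balls around
  arbitrary centres, so that open sets contain such neighbourhoods around each of their points is
  shown by induction over the generation of the topology.\<close>

lemma tempered_distribution_bound:
  fixes f :: "(real ^ 'd::finite \<Rightarrow> complex) \<Rightarrow> complex"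
  assumes f: "tempered_distribution f"
  obtains Q :: "((nat ^ 'd) \<times> (nat ^ 'd)) set" and C where "finite Q" "C \<ge> 0"
    "\<And>\<phi>. \<phi> \<in> schwartz_space \<Longrightarrow> cmod (f \<phi>) \<le> C * (\<Sum>(a, b)\<in>Q. schwartz_seminorm a b \<phi>)"
proof -
  let ?B = "{{\<psi> \<in> schwartz_space. schwartz_seminorm a b (\<lambda>x. \<psi> x - \<phi> x) < e} | \<phi> a b e.
        \<phi> \<in> (schwartz_space :: (real ^ 'd \<Rightarrow> complex) set) \<and> 0 < e}"
  have nbhd: "\<forall>\<phi>\<in>U. \<exists>Q \<delta>. finite Q \<and> \<delta> > 0 \<and> (\<forall>\<psi>\<in>schwartz_space.
      (\<forall>q\<in>Q. schwartz_seminorm (fst q) (snd q) (\<lambda>x. \<psi> x - \<phi> x) < \<delta>) \<longrightarrow> \<psi> \<in> U)"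
    if "generate_topology_on ?B U" for U
    using that
  proof (induction rule: generate_topology_on.induct)
    case Empty
    show ?case by simp
  next
    case (Int U V)
    show ?case
    proof
      fix \<phi> assume "\<phi> \<in> U \<inter> V"
      obtain Q1 \<delta>1 where 1: "finite Q1" "\<delta>1 > 0" "\<forall>\<psi>\<in>schwartz_space.
          (\<forall>q\<in>Q1. schwartz_seminorm (fst q) (snd q) (\<lambda>x. \<psi> x - \<phi> x) < \<delta>1) \<longrightarrow> \<psi> \<in> U"
        using Int.IH(1) \<open>\<phi> \<in> U \<inter> V\<close> by blast
      obtain Q2 \<delta>2 where 2: "finite Q2" "\<delta>2 > 0" "\<forall>\<psi>\<in>schwartz_space.
          (\<forall>q\<in>Q2. schwartz_seminorm (fst q) (snd q) (\<lambda>x. \<psi> x - \<phi> x) < \<delta>2) \<longrightarrow> \<psi> \<in> V"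
        using Int.IH(2) \<open>\<phi> \<in> U \<inter> V\<close> by blast
      show "\<exists>Q \<delta>. finite Q \<and> \<delta> > 0 \<and> (\<forall>\<psi>\<in>schwartz_space.
          (\<forall>q\<in>Q. schwartz_seminorm (fst q) (snd q) (\<lambda>x. \<psi> x - \<phi> x) < \<delta>) \<longrightarrow> \<psi> \<in> U \<inter> V)"
        using 1 2 by (intro exI[of _ "Q1 \<union> Q2"] exI[of _ "min \<delta>1 \<delta>2"]) auto
    qed
  next
    case (UN K)
    show ?case
    proof
      fix \<phi> assume "\<phi> \<in> \<Union>K"
      then obtain U where U: "U \<in> K" "\<phi> \<in> U" by blast
      from UN.IH[OF U(1)] U(2) obtain Q \<delta> where Q: "finite Q" "\<delta> > 0" "\<forall>\<psi>\<in>schwartz_space.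
          (\<forall>q\<in>Q. schwartz_seminorm (fst q) (snd q) (\<lambda>x. \<psi> x - \<phi> x) < \<delta>) \<longrightarrow> \<psi> \<in> U" by blast
      show "\<exists>Q \<delta>. finite Q \<and> \<delta> > 0 \<and> (\<forall>\<psi>\<in>schwartz_space.
          (\<forall>q\<in>Q. schwartz_seminorm (fst q) (snd q) (\<lambda>x. \<psi> x - \<phi> x) < \<delta>) \<longrightarrow> \<psi> \<in> \<Union>K)"
        using Q U(1) by (intro exI[of _ Q] exI[of _ \<delta>]) blast
    qed
  next
    case (Basis U)
    then obtain \<phi>0 a b e where U: "U = {\<psi> \<in> schwartz_space. schwartz_seminorm a b (\<lambda>x. \<psi> x - \<phi>0 x) < e}"
      "\<phi>0 \<in> schwartz_space" by blast
    show ?case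
    proof
      fix \<phi> assume \<phi>: "\<phi> \<in> U"
      \<comment> \<open>The slack in the strict inequality: by the triangle inequality a seminorm
        ball of this radius around \<open>\<phi>\<close> stays inside the subbasic set.\<close>
      let ?d = "e - schwartz_seminorm a b (\<lambda>x. \<phi> x - \<phi>0 x)"
      have "\<psi> \<in> U" if "\<psi> \<in> schwartz_space" "schwartz_seminorm a b (\<lambda>x. \<psi> x - \<phi> x) < ?d" for \<psi>
      proof -
        have "schwartz_seminorm a b (\<lambda>x. (\<psi> x - \<phi> x) + (\<phi> x - \<phi>0 x))
            \<le> schwartz_seminorm a b (\<lambda>x. \<psi> x - \<phi> x) + schwartz_seminorm a b (\<lambda>x. \<phi> x - \<phi>0 x)"
          by (rule schwartz_seminorm_triangle) (use that \<phi> U in \<open>auto intro!: schwartz_diff\<close>)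
        then show ?thesis using that U by simp
      qed
      then show "\<exists>Q \<delta>. finite Q \<and> \<delta> > 0 \<and> (\<forall>\<psi>\<in>schwartz_space.
          (\<forall>q\<in>Q. schwartz_seminorm (fst q) (snd q) (\<lambda>x. \<psi> x - \<phi> x) < \<delta>) \<longrightarrow> \<psi> \<in> U)"
        using \<phi> U by (intro exI[of _ "{(a, b)}"] exI[of _ ?d]) auto
    qed
  qed
  have sn0: "schwartz_seminorm a b (\<lambda>x. 0) = 0" for a b :: "nat ^ 'd"
    using schwartz_seminorm_cmult[OF zero_in_schwartz, of a b 0] schwartz_seminorm_nonneg[OF zero_in_schwartz, of a b]
    by simp
  have top: "topspace schwartz_topology = (schwartz_space :: (real ^ 'd \<Rightarrow> complex) set)"
  proof -
    have "\<phi> \<in> \<Union>?B" if "\<phi> \<in> schwartz_space" for \<phi> :: "real ^ 'd \<Rightarrow> complex"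
    proof -
      have "\<phi> \<in> {\<psi> \<in> schwartz_space. schwartz_seminorm 0 0 (\<lambda>x. \<psi> x - \<phi> x) < 1}"
        using that by (simp add: sn0)
      moreover have "{\<psi> \<in> schwartz_space. schwartz_seminorm 0 0 (\<lambda>x. \<psi> x - \<phi> x) < 1} \<in> ?B"
        using that zero_less_one by blast
      ultimately show ?thesis by blast
    qed
    then show ?thesis unfolding schwartz_topology_def topology_generated_by_topspace by blast
  qed
  have f0: "f (\<lambda>x. 0) = 0"
    using tempered_lin[OF f zero_in_schwartz zero_in_schwartz, of 0 0] by simp
  have "openin schwartz_topology {\<phi> \<in> topspace schwartz_topology. f \<phi> \<in> ball 0 1}"
    by (rule openin_continuous_map_preimage[where Y = euclidean])
       (use f in \<open>simp_all add: tempered_distribution_def\<close>)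
  then have "generate_topology_on ?B {\<phi> \<in> schwartz_space. f \<phi> \<in> ball 0 1}"
    unfolding top unfolding schwartz_topology_def openin_topology_generated_by_iff .
  from nbhd[OF this] have "\<exists>Q \<delta>. finite Q \<and> \<delta> > 0 \<and> (\<forall>\<psi>\<in>schwartz_space.
      (\<forall>q\<in>Q. schwartz_seminorm (fst q) (snd q) (\<lambda>x. \<psi> x - 0) < \<delta>) \<longrightarrow> \<psi> \<in> {\<phi> \<in> schwartz_space. f \<phi> \<in> ball 0 1})"
    by (rule bspec) (simp add: f0 zero_in_schwartz)
  then obtain Q \<delta> where Q: "finite Q" "\<delta> > 0"
    "\<And>\<psi>. \<psi> \<in> schwartz_space \<Longrightarrow> (\<forall>q\<in>Q. schwartz_seminorm (fst q) (snd q) \<psi> < \<delta>) \<Longrightarrow> cmod (f \<psi>) < 1"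
    by (auto simp: dist_norm)
  have "cmod (f \<phi>) \<le> (1 / \<delta>) * (\<Sum>(a, b)\<in>Q. schwartz_seminorm a b \<phi>)" if \<phi>: "\<phi> \<in> schwartz_space" for \<phi>
  proof -
    let ?s = "\<Sum>(a, b)\<in>Q. schwartz_seminorm a b \<phi>"
    have s0: "?s \<ge> 0" by (intro sum_nonneg) (auto simp: schwartz_seminorm_nonneg[OF \<phi>])
    \<comment> \<open>The function is rescaled by \<delta>/t with t strictly above the sum of the
      seminorms, which may itself be 0; the bound then passes to the infimum over t.\<close>
    have "\<delta> * cmod (f \<phi>) \<le> t" if t: "t > ?s" for t
    proof -
      have t0: "t > 0" using s0 t by simp
      have "cmod (f (\<lambda>x. of_real (\<delta> / t) * \<phi> x + 0 * \<phi> x)) < 1"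
      proof (rule Q(3))
        show "(\<lambda>x. of_real (\<delta> / t) * \<phi> x + 0 * \<phi> x) \<in> schwartz_space"
          by (rule schwartz_lin_comb[OF \<phi> \<phi>])
        show "\<forall>q\<in>Q. schwartz_seminorm (fst q) (snd q) (\<lambda>x. of_real (\<delta> / t) * \<phi> x + 0 * \<phi> x) < \<delta>"
        proof
          fix q assume "q \<in> Q"
          then obtain a b where q: "q = (a, b)" and ab: "(a, b) \<in> Q" by (cases q) auto
          have "schwartz_seminorm a b \<phi> \<le> ?s"
            using member_le_sum[OF ab, of "\<lambda>(a, b). schwartz_seminorm a b \<phi>"] Q(1) schwartz_seminorm_nonneg[OF \<phi>] by auto
          then have "schwartz_seminorm a b \<phi> < t" using t by simp
          have "schwartz_seminorm a b (\<lambda>x. of_real (\<delta> / t) * \<phi> x) \<le> cmod (of_real (\<delta> / t)) * schwartz_seminorm a b \<phi>"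
            by (rule schwartz_seminorm_cmult[OF \<phi>])
          also have "\<dots> = \<delta> / t * schwartz_seminorm a b \<phi>"
            using Q(2) t0 by (simp add: norm_divide)
          also have "\<dots> < \<delta> / t * t"
            using Q(2) t0 \<open>schwartz_seminorm a b \<phi> < t\<close> by (intro mult_strict_left_mono) auto
          finally show "schwartz_seminorm (fst q) (snd q) (\<lambda>x. of_real (\<delta> / t) * \<phi> x + 0 * \<phi> x) < \<delta>"
            using t0 by (simp add: q)
        qed
      qed
      then have "\<delta> / t * cmod (f \<phi>) < 1"
        unfolding tempered_lin[OF f \<phi> \<phi>] using Q(2) t0 by (simp add: norm_mult norm_divide)
      then show ?thesis using t0 by (simp add: field_simps)
    qed
    then have "\<delta> * cmod (f \<phi>) \<le> ?s" by (rule dense_ge)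
    then show ?thesis using Q(2) by (simp add: field_simps)
  qed
  then show ?thesis using that[OF Q(1), of "1 / \<delta>"] Q(2) by auto
qed

text \<open>Since finitely many seminorms dominate f, a rate C/R in each of them separately
  suffices. The index \<open>Suc n\<close> keeps R >= 1.\<close>

lemma tempered_perturbation:
  fixes f :: "(real ^ 'd::finite \<Rightarrow> complex) \<Rightarrow> complex"
  assumes f: "tempered_distribution f" and \<phi>: "\<phi> \<in> schwartz_space"
    and \<phi>R: "\<And>R. R \<ge> 1 \<Longrightarrow> \<phi>R R \<in> schwartz_space"
    and d: "\<And>a b. \<exists>C. \<forall>R\<ge>1. \<forall>x. weight a x * cmod (mderiv b (\<phi>R R) x - mderiv b \<phi> x) \<le> C / R"
  shows "(\<lambda>n. f (\<phi>R (Suc n))) \<longlonglongrightarrow> f \<phi>"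
proof -
  obtain Q :: "((nat ^ 'd) \<times> (nat ^ 'd)) set" and C where Q: "finite Q" "C \<ge> 0"
    "\<And>\<phi>. \<phi> \<in> schwartz_space \<Longrightarrow> cmod (f \<phi>) \<le> C * (\<Sum>(a, b)\<in>Q. schwartz_seminorm a b \<phi>)"
    using tempered_distribution_bound[OF f] by blast
  have "\<exists>D. \<forall>q. \<forall>R\<ge>1. \<forall>x. weight (fst q) x * cmod (mderiv (snd q) (\<phi>R R) x - mderiv (snd q) \<phi> x) \<le> D q / R"
    by (rule choice) (use d in blast)
  then obtain D where D0: "\<forall>q. \<forall>R\<ge>1. \<forall>x. weight (fst q) x * cmod (mderiv (snd q) (\<phi>R R) x - mderiv (snd q) \<phi> x) \<le> D q / R"
    by blast
  have D: "weight a x * cmod (mderiv b (\<phi>R R) x - mderiv b \<phi> x) \<le> D (a, b) / R" if "R \<ge> 1" for a b R x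
    using D0[THEN spec, of "(a, b)"] that by simp
  have le: "cmod (f (\<phi>R (Suc n)) - f \<phi>) \<le> C * (\<Sum>q\<in>Q. D q) * (1 / real (Suc n))" for n
  proof -
    have n: "real (Suc n) \<ge> 1" by simp
    have "schwartz_seminorm a b (\<lambda>x. \<phi>R (Suc n) x - \<phi> x) \<le> D (a, b) / real (Suc n)" for a b
      using D[OF n] \<phi> \<phi>R[OF n] by (intro schwartz_seminorm_least) (simp add: mderiv_diff schwartz_smooth)
    then have "(\<Sum>(a, b)\<in>Q. schwartz_seminorm a b (\<lambda>x. \<phi>R (Suc n) x - \<phi> x)) \<le> (\<Sum>q\<in>Q. D q / real (Suc n))"
      by (intro sum_mono) auto
    then have "C * (\<Sum>(a, b)\<in>Q. schwartz_seminorm a b (\<lambda>x. \<phi>R (Suc n) x - \<phi> x)) \<le> C * (\<Sum>q\<in>Q. D q / real (Suc n))"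
      using Q(2) by (rule mult_left_mono)
    moreover have "cmod (f (\<lambda>x. \<phi>R (Suc n) x - \<phi> x)) \<le> C * (\<Sum>(a, b)\<in>Q. schwartz_seminorm a b (\<lambda>x. \<phi>R (Suc n) x - \<phi> x))"
      by (intro Q(3) schwartz_diff \<phi> \<phi>R[OF n])
    ultimately show ?thesis
      unfolding tempered_diff[OF f \<phi>R[OF n] \<phi>] by (simp add: sum_divide_distrib[symmetric])
  qed
  have "(\<lambda>n. C * (\<Sum>q\<in>Q. D q) * (1 / real (Suc n))) \<longlonglongrightarrow> 0"
    using tendsto_mult_right_zero[OF LIMSEQ_inverse_real_of_nat] by (simp add: inverse_eq_divide)
  then have "(\<lambda>n. f (\<phi>R (Suc n)) - f \<phi>) \<longlonglongrightarrow> 0"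
    by (rule Lim_null_comparison[rotated]) (intro always_eventually allI le)
  then show ?thesis by (simp add: LIM_zero_iff)
qed

section \<open>Density of test functions\<close>

text \<open>A sublist of a list sorted by coordinates is again sorted by coordinates. When a
  derivative of a product is expanded, each factor receives a sublist of \<open>mlist b\<close>;
  such a sublist is thus a multi-index derivative in the fixed order, the kind that the Schwartz
  seminorms control.\<close>

lemma subseq_mlist:
  assumes "subseq zs (mlist b)" shows "\<exists>c. zs = mlist c"
proof -
  have "zs = concat (map (\<lambda>i. replicate (count_list zs i) i) cs)"
    if "distinct cs" "subseq zs (concat (map (\<lambda>i. replicate (b $ i) i) cs))" for cs zs
    using that
  proof (induction cs arbitrary: zs)
    case (Cons k cs)
    obtain zs1 zs2 where z: "zs = zs1 @ zs2" "subseq zs1 (replicate (b $ k) k)"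
      "subseq zs2 (concat (map (\<lambda>i. replicate (b $ i) i) cs))"
      using Cons.prems(2) by (auto elim: subseq_appendE)
    have s1: "set zs1 \<subseteq> {k}" using z(2) by (auto elim!: list_emb_set)
    have s2: "set zs2 \<subseteq> set cs" using z(3) by (auto elim!: list_emb_set)
    have c2: "count_list zs2 k = 0" using s2 Cons.prems(1) by (auto intro!: count_notin)
    have z1: "zs1 = replicate (count_list zs k) k"
    proof -
      have "zs1 = replicate (length zs1) k" using s1 by (metis replicate_eqI singletonD subsetD)
      moreover have "count_list (replicate n k) k = n" for n by (induction n) auto
      ultimately have "count_list zs1 k = length zs1" by metis
      then show ?thesis using c2 z(1) \<open>zs1 = replicate (length zs1) k\<close> by simp
    qed
    have c1: "count_list zs1 i = 0" if "i \<in> set cs" for i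
      using that s1 Cons.prems(1) by (auto intro!: count_notin)
    have "zs2 = concat (map (\<lambda>i. replicate (count_list zs2 i) i) cs)"
      by (rule Cons.IH[OF _ z(3)]) (use Cons.prems(1) in simp)
    also have "map (\<lambda>i. replicate (count_list zs2 i) i) cs = map (\<lambda>i. replicate (count_list zs i) i) cs"
      using c1 z(1) by simp
    finally have z2: "zs2 = concat (map (\<lambda>i. replicate (count_list zs i) i) cs)" .
    show ?case unfolding list.map(2) concat.simps(2) z1[symmetric] z2[symmetric] by (rule z(1))
  qed simp
  from this[OF distinct_coords assms[unfolded mlist_def]]
  have "zs = mlist (\<chi> i. count_list zs i)" by (simp add: mlist_def)
  then show ?thesis by blast
qed

text \<open>Quantified over lists, hence over differentiations in every order, so that the class is
  closed under \<open>partial_deriv\<close>.\<close>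

definition bounded_derivs :: "(real ^ 'd::finite \<Rightarrow> complex) \<Rightarrow> bool" where
  "bounded_derivs \<eta> \<longleftrightarrow> smooth \<eta> \<and> (\<forall>is. \<exists>C. \<forall>x. cmod (foldr partial_deriv is \<eta> x) \<le> C)"

lemma bounded_derivs_partial_deriv:
  assumes "bounded_derivs \<eta>" shows "bounded_derivs (partial_deriv i \<eta>)"
  unfolding bounded_derivs_def
proof (intro conjI allI)
  show "smooth (partial_deriv i \<eta>)" using assms by (simp add: bounded_derivs_def smooth_partial_deriv)
  fix ks
  have "\<exists>C. \<forall>x. cmod (foldr partial_deriv (ks @ [i]) \<eta> x) \<le> C"
    using assms unfolding bounded_derivs_def by blast
  then show "\<exists>C. \<forall>x. cmod (foldr partial_deriv ks (partial_deriv i \<eta>) x) \<le> C" by simp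
qed

lemma bounded_derivs_tensor:
  assumes "\<And>i. bounded_derivs1 (u i)" shows "bounded_derivs (tensor u)"
  unfolding bounded_derivs_def
proof (intro conjI allI)
  have sm: "smooth1 (u i)" for i using assms by (simp add: bounded_derivs1_def)
  then show "smooth (tensor u)" by (rule smooth_tensor)
  fix ks
  have "\<exists>C. \<forall>i x. cmod ((vderiv ^^ count_list ks i) (u i) x) \<le> C i"
    by (rule choice) (use assms in \<open>auto simp: bounded_derivs1_def\<close>)
  then obtain C where C: "\<And>i x. cmod ((vderiv ^^ count_list ks i) (u i) x) \<le> C i" by blast
  have "cmod (foldr partial_deriv ks (tensor u) x) \<le> (\<Prod>i\<in>UNIV. C i)" for x
    unfolding foldr_partial_deriv_tensor[OF sm] tensor_def prod_norm[symmetric]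
    by (intro prod_mono conjI C) auto
  then show "\<exists>C. \<forall>x. cmod (foldr partial_deriv ks (tensor u) x) \<le> C" by blast
qed

lemma partial_deriv_cong_open:
  assumes "open S" "x \<in> S" "\<And>y. y \<in> S \<Longrightarrow> \<phi> y = \<psi> y"
  shows "partial_deriv i \<phi> x = partial_deriv i \<psi> x"
  unfolding partial_deriv_def
proof (rule vector_derivative_cong_eq)
  have "isCont (\<lambda>t. x + t *\<^sub>R axis i 1) 0" by (intro continuous_intros)
  then have "((\<lambda>t. x + t *\<^sub>R axis i 1) \<longlongrightarrow> x) (nhds 0)"
    by (simp add: continuous_at tendsto_nhds_iff)
  then have "\<forall>\<^sub>F t in nhds 0. x + t *\<^sub>R axis i 1 \<in> S"
    using assms(1,2) by (rule topological_tendstoD)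
  then show "\<forall>\<^sub>F t in nhds 0. t \<in> UNIV \<longrightarrow> \<phi> (x + t *\<^sub>R axis i 1) = \<psi> (x + t *\<^sub>R axis i 1)"
    by eventually_elim (simp add: assms(3))
qed auto

text \<open>The induction removes the last list entry, which is the derivative applied first. It
  falls either on \<open>\<phi>\<close>, whose later sublists extended by this entry are still
  sublists of the original, or on the dilated \<open>\<eta>\<close>, which gains a factor 1/R. The
  hypothesis on sublists survives in both cases.\<close>

lemma dilated_mult_bound:
  fixes \<eta> \<phi> :: "real ^ 'd::finite \<Rightarrow> complex"
  assumes "bounded_derivs \<eta>" "\<And>x. (\<forall>i. \<bar>x $ i\<bar> < 1) \<Longrightarrow> \<eta> x = 0" "smooth \<phi>"
    and "\<And>zs a. subseq zs is \<Longrightarrow> \<exists>C. \<forall>x. weight a x * cmod (foldr partial_deriv zs \<phi> x) \<le> C"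
  shows "\<exists>C. \<forall>R\<ge>1. \<forall>x. weight a x * cmod (foldr partial_deriv is (\<lambda>x. \<eta> ((1 / R) *\<^sub>R x) * \<phi> x) x) \<le> C / R"
  using assms
proof (induction "is" arbitrary: \<eta> \<phi> rule: rev_induct)
  case Nil
  obtain C where C: "\<And>x. cmod (foldr partial_deriv [] \<eta> x) \<le> C"
    using Nil(1) unfolding bounded_derivs_def by blast
  have C0: "C \<ge> 0" using order.trans[OF norm_ge_zero C[of 0]] .
  \<comment> \<open>Where the dilated \<open>\<eta>\<close> does not vanish, some coordinate has
    size at least R, and one more power of it buys 1/R. Which coordinate it is depends on x;
    therefore every i gets a bound and the final constant contains their sum.\<close>
  have "\<exists>D. \<forall>i x. weight (a + axis i 1) x * cmod (\<phi> x) \<le> D i"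
    by (rule choice, rule allI, rule Nil(4)[of "[]", unfolded foldr.simps id_apply]) simp
  then obtain D where D: "\<And>i x. weight (a + axis i 1) x * cmod (\<phi> x) \<le> D i" by blast
  have D0: "D i \<ge> 0" for i using order.trans[OF _ D[of 0 i]] by simp
  have w: "weight (a + axis i 1) x = \<bar>x $ i\<bar> * weight a x" for i and x :: "real ^ 'd"
  proof -
    have "(\<Prod>k\<in>UNIV. x $ k ^ ((a + axis i 1) $ k)) = (\<Prod>k\<in>UNIV. x $ k ^ (a $ k) * (if k = i then x $ k else 1))"
      by (intro prod.cong) (auto simp: axis_def)
    then show ?thesis by (simp add: prod.distrib abs_mult)
  qed
  have "weight a x * cmod (\<eta> ((1 / R) *\<^sub>R x) * \<phi> x) \<le> C * (\<Sum>i\<in>UNIV. D i) / R" if R: "R \<ge> 1" for x R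
  proof (cases "\<forall>i. \<bar>x $ i\<bar> < R")
    case True
    then have "\<eta> ((1 / R) *\<^sub>R x) = 0" using R by (intro Nil(2)) (simp add: abs_divide)
    then show ?thesis using R C0 D0 by (simp add: sum_nonneg)
  next
    case False
    then obtain i where i: "R \<le> \<bar>x $ i\<bar>" by (auto simp: not_less)
    have "R * (weight a x * cmod (\<phi> x)) \<le> \<bar>x $ i\<bar> * (weight a x * cmod (\<phi> x))"
      using i by (intro mult_right_mono) auto
    also have "\<dots> = weight (a + axis i 1) x * cmod (\<phi> x)" unfolding w by (rule mult.assoc[symmetric])
    also have "\<dots> \<le> D i" by (rule D)
    also have "D i \<le> (\<Sum>i\<in>UNIV. D i)" using D0 by (intro member_le_sum) auto
    finally have "weight a x * cmod (\<phi> x) \<le> (\<Sum>i\<in>UNIV. D i) / R"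
      using R by (simp add: field_simps)
    then have "cmod (\<eta> ((1 / R) *\<^sub>R x)) * (weight a x * cmod (\<phi> x)) \<le> C * ((\<Sum>i\<in>UNIV. D i) / R)"
      using C C0 by (intro mult_mono) auto
    then show ?thesis by (simp add: norm_mult mult_ac)
  qed
  then show ?case by auto
next
  case (snoc i ks)
  have zeros: "partial_deriv i \<eta> x = 0" if "\<forall>i. \<bar>x $ i\<bar> < 1" for x
  proof -
    have "open (box (\<chi> i. -1) (\<chi> i. 1) :: (real ^ 'd) set)" by (rule open_box)
    then have "partial_deriv i \<eta> x = partial_deriv i (\<lambda>_. 0) x"
      by (rule partial_deriv_cong_open)
         (use that snoc.prems(2) in \<open>auto simp: mem_box_cart abs_less_iff minus_less_iff\<close>)
    then show ?thesis by (simp add: partial_deriv_const)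
  qed
  have sm: "smooth \<eta>" "smooth \<phi>" using snoc.prems by (auto simp: bounded_derivs_def)
  have "\<exists>C. \<forall>R\<ge>1. \<forall>x. weight a x * cmod (foldr partial_deriv ks (\<lambda>x. \<eta> ((1 / R) *\<^sub>R x) * partial_deriv i \<phi> x) x) \<le> C / R"
  proof (rule snoc.IH[OF snoc.prems(1,2)])
    show "smooth (partial_deriv i \<phi>)" using sm(2) by (rule smooth_partial_deriv)
    fix zs and a :: "nat ^ 'd" assume "subseq zs ks"
    then have "subseq (zs @ [i]) (ks @ [i])" by simp
    from snoc.prems(4)[OF this, of a]
    show "\<exists>C. \<forall>x. weight a x * cmod (foldr partial_deriv zs (partial_deriv i \<phi>) x) \<le> C" by simp
  qed
  then obtain C where C: "\<And>R x. R \<ge> 1 \<Longrightarrow>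
      weight a x * cmod (foldr partial_deriv ks (\<lambda>x. \<eta> ((1 / R) *\<^sub>R x) * partial_deriv i \<phi> x) x) \<le> C / R" by blast
  have "\<exists>C. \<forall>R\<ge>1. \<forall>x. weight a x * cmod (foldr partial_deriv ks (\<lambda>x. partial_deriv i \<eta> ((1 / R) *\<^sub>R x) * \<phi> x) x) \<le> C / R"
  proof (rule snoc.IH[OF bounded_derivs_partial_deriv[OF snoc.prems(1)] zeros sm(2)])
    fix zs and a :: "nat ^ 'd" assume "subseq zs ks"
    then have "subseq zs (ks @ [i])" by (rule subseq_rev_drop_many)
    from snoc.prems(4)[OF this, of a]
    show "\<exists>C. \<forall>x. weight a x * cmod (foldr partial_deriv zs \<phi> x) \<le> C" .
  qed
  then obtain D where D: "\<And>R x. R \<ge> 1 \<Longrightarrow>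
      weight a x * cmod (foldr partial_deriv ks (\<lambda>x. partial_deriv i \<eta> ((1 / R) *\<^sub>R x) * \<phi> x) x) \<le> D / R" by blast
  have D0: "D \<ge> 0" using order.trans[OF _ D[of 1 0]] by simp
  have "weight a x * cmod (foldr partial_deriv (ks @ [i]) (\<lambda>x. \<eta> ((1 / R) *\<^sub>R x) * \<phi> x) x) \<le> (C + D) / R"
    if R: "R \<ge> 1" for R x
  proof -
    have smR: "smooth (\<lambda>x. \<eta> ((1 / R) *\<^sub>R x))" "smooth (\<lambda>x. partial_deriv i \<eta> ((1 / R) *\<^sub>R x))"
      using smooth_dilation sm(1) smooth_partial_deriv by blast+
    have "partial_deriv i (\<lambda>x. \<eta> ((1 / R) *\<^sub>R x) * \<phi> x)
        = (\<lambda>x. \<eta> ((1 / R) *\<^sub>R x) * partial_deriv i \<phi> x + of_real (1 / R) * (partial_deriv i \<eta> ((1 / R) *\<^sub>R x) * \<phi> x))"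
      using smR sm by (simp add: fun_eq_iff partial_deriv_mult smooth_differentiable
          partial_deriv_dilation[OF sm(1)] mult.assoc)
    then have eq: "foldr partial_deriv (ks @ [i]) (\<lambda>x. \<eta> ((1 / R) *\<^sub>R x) * \<phi> x) x
        = foldr partial_deriv ks (\<lambda>x. \<eta> ((1 / R) *\<^sub>R x) * partial_deriv i \<phi> x) x
          + of_real (1 / R) * foldr partial_deriv ks (\<lambda>x. partial_deriv i \<eta> ((1 / R) *\<^sub>R x) * \<phi> x) x"
      using foldr_partial_deriv_add[OF smooth_mult[OF smR(1) smooth_partial_deriv[OF sm(2)]]
          smooth_mult[OF smooth_const smooth_mult[OF smR(2) sm(2)]], of ks i "of_real (1 / R)"]
        foldr_partial_deriv_cmult[OF smooth_mult[OF smR(2) sm(2)], of ks "of_real (1 / R)"]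
      by (simp only: foldr_append foldr.simps comp_apply id_apply)
    have "cmod (foldr partial_deriv (ks @ [i]) (\<lambda>x. \<eta> ((1 / R) *\<^sub>R x) * \<phi> x) x)
        \<le> cmod (foldr partial_deriv ks (\<lambda>x. \<eta> ((1 / R) *\<^sub>R x) * partial_deriv i \<phi> x) x)
          + 1 / R * cmod (foldr partial_deriv ks (\<lambda>x. partial_deriv i \<eta> ((1 / R) *\<^sub>R x) * \<phi> x) x)"
      unfolding eq by (rule order.trans[OF norm_triangle_ineq]) (use R in \<open>simp add: norm_mult norm_divide\<close>)
    then have "weight a x * cmod (foldr partial_deriv (ks @ [i]) (\<lambda>x. \<eta> ((1 / R) *\<^sub>R x) * \<phi> x) x)
        \<le> weight a x * (cmod (foldr partial_deriv ks (\<lambda>x. \<eta> ((1 / R) *\<^sub>R x) * partial_deriv i \<phi> x) x)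
          + 1 / R * cmod (foldr partial_deriv ks (\<lambda>x. partial_deriv i \<eta> ((1 / R) *\<^sub>R x) * \<phi> x) x))"
      by (intro mult_left_mono) auto
    also have "\<dots> \<le> C / R + 1 / R * (D / R)"
      using C[OF R, of x] mult_left_mono[OF D[OF R, of x], of "1 / R"] R
      by (simp add: distrib_left mult_ac)
    also have "1 / R * (D / R) \<le> 1 * (D / R)"
      using R D0 by (intro mult_right_mono) auto
    finally show ?thesis by (simp add: add_divide_distrib)
  qed
  then show ?case by blast
qed

text \<open>Multiplication by a tensor cutoff at scale R changes \<open>\<phi>\<close> by
  \<open>\<eta> ((1 / R) *\<^sub>R x) * \<phi> x\<close>, where \<open>\<eta>\<close> is the cutoff
  minus 1 and vanishes near the origin, so the error is O(1/R) in every seminorm. One sequence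
  serves all tempered distributions, which is what comparing two of them requires.\<close>

lemma test_functions_dense:
  fixes \<phi> :: "real ^ 'd::finite \<Rightarrow> complex"
  assumes \<phi>: "\<phi> \<in> schwartz_space"
  obtains \<phi>s where "\<And>n. \<phi>s n \<in> test_functions"
    "\<And>f. tempered_distribution f \<Longrightarrow> (\<lambda>n. f (\<phi>s n)) \<longlonglongrightarrow> f \<phi>"
proof -
  obtain \<kappa> :: "real \<Rightarrow> real" where \<kappa>: "smooth1 (\<lambda>x. of_real (\<kappa> x))"
    "\<And>x. \<bar>x\<bar> \<le> 1 \<Longrightarrow> \<kappa> x = 1" "\<And>x. \<bar>x\<bar> \<ge> 2 \<Longrightarrow> \<kappa> x = 0"
    using smooth_cutoff_exists by metis
  have t: "test1 (\<lambda>x. of_real (\<kappa> x))"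
    using \<kappa> unfolding test1_def by (intro conjI exI[of _ 2]) auto
  define X where "X = tensor (\<lambda>(i::'d) x. complex_of_real (\<kappa> x))"
  \<comment> \<open>The constant 1 is written as a tensor product so that its derivatives are
    bounded by the same lemma as those of \<open>X\<close>.\<close>
  define I where "I = tensor (\<lambda>(i::'d) x. 1)"
  define \<eta> where "\<eta> x = X x + (-1) * I x" for x
  have bX: "bounded_derivs X" unfolding X_def
    by (intro bounded_derivs_tensor schwartz1_bounded_derivs1 test1_schwartz1 t)
  have "(vderiv ^^ n) (\<lambda>x. 1) = (\<lambda>x. if n = 0 then 1 else 0)" for n
    by (induction n) (auto simp: vderiv_const)
  then have "bounded_derivs1 (\<lambda>x. 1)" unfolding bounded_derivs1_def
    by (auto intro: exI[of _ 1])
  then have bI: "bounded_derivs I" unfolding I_def by (intro bounded_derivs_tensor)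
  have b\<eta>: "bounded_derivs \<eta>" unfolding bounded_derivs_def
  proof (intro conjI allI)
    have sm: "smooth X" "smooth I" using bX bI by (auto simp: bounded_derivs_def)
    then show "smooth \<eta>" unfolding \<eta>_def by (intro smooth_add smooth_mult smooth_const)
    fix ks
    obtain C D where C: "\<And>x. cmod (foldr partial_deriv ks X x) \<le> C" and D: "\<And>x. cmod (foldr partial_deriv ks I x) \<le> D"
      using bX bI unfolding bounded_derivs_def by metis
    have "foldr partial_deriv ks \<eta> = (\<lambda>x. foldr partial_deriv ks X x + (-1) * foldr partial_deriv ks I x)"
      unfolding \<eta>_def[abs_def] foldr_partial_deriv_add[OF sm(1) smooth_mult[OF smooth_const sm(2)]]
        foldr_partial_deriv_cmult[OF sm(2)] ..
    then have "cmod (foldr partial_deriv ks \<eta> x) \<le> C + D" for x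
      using norm_triangle_mono[OF C[of x] order.trans[OF _ D[of x]], of "(-1) * foldr partial_deriv ks I x"] by simp
    then show "\<exists>C. \<forall>x. cmod (foldr partial_deriv ks \<eta> x) \<le> C" by blast
  qed
  have z\<eta>: "\<eta> x = 0" if "\<forall>i. \<bar>x $ i\<bar> < 1" for x
    using that by (simp add: \<eta>_def X_def I_def tensor_def \<kappa>(2) less_imp_le)
  define \<phi>R where "\<phi>R R x = X ((1 / R) *\<^sub>R x) * \<phi> x" for R x
  have X1: "X y = \<eta> y + 1" for y by (simp add: \<eta>_def I_def tensor_def)
  have smR: "smooth (\<phi>R R)" for R unfolding \<phi>R_def[abs_def]
    using bX \<phi> by (intro smooth_mult smooth_dilation) (auto simp: bounded_derivs_def schwartz_smooth)
  have smE: "smooth (\<lambda>x. \<eta> ((1 / R) *\<^sub>R x) * \<phi> x)" for R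
    using b\<eta> \<phi> by (intro smooth_mult smooth_dilation) (auto simp: bounded_derivs_def schwartz_smooth)
  have dec: "mderiv b (\<phi>R R) x = mderiv b (\<lambda>x. \<eta> ((1 / R) *\<^sub>R x) * \<phi> x) x + mderiv b \<phi> x" for b R x
    unfolding \<phi>R_def[abs_def] X1 distrib_right
    using mderiv_lin_comb[OF smE schwartz_smooth[OF \<phi>], of b 1 R 1] by simp
  have est: "\<exists>C. \<forall>R\<ge>1. \<forall>x. weight a x * cmod (mderiv b (\<lambda>x. \<eta> ((1 / R) *\<^sub>R x) * \<phi> x) x) \<le> C / R" for a b
    unfolding mderiv_eq_foldr
  proof (rule dilated_mult_bound[OF b\<eta> z\<eta> schwartz_smooth[OF \<phi>]])
    fix zs and a :: "nat ^ 'd" assume "subseq zs (mlist b)"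
    then obtain c where "zs = mlist c" using subseq_mlist by blast
    then have "foldr partial_deriv zs \<phi> = mderiv c \<phi>" by (simp add: mderiv_eq_foldr)
    then show "\<exists>C. \<forall>x. weight a x * cmod (foldr partial_deriv zs \<phi> x) \<le> C"
      using schwartz_seminorm_upper[OF \<phi>] by metis
  qed
  have sR: "\<phi>R R \<in> schwartz_space" if R: "R \<ge> 1" for R
  proof (rule schwartz_spaceI[OF smR])
    fix a b
    obtain C where C: "\<And>x. weight a x * cmod (mderiv b (\<lambda>x. \<eta> ((1 / R) *\<^sub>R x) * \<phi> x) x) \<le> C / R"
      using est R by blast
    have "weight a x * cmod (mderiv b (\<phi>R R) x) \<le> C / R + schwartz_seminorm a b \<phi>" for x
    proof -
      have "weight a x * cmod (mderiv b (\<phi>R R) x)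
          \<le> weight a x * (cmod (mderiv b (\<lambda>x. \<eta> ((1 / R) *\<^sub>R x) * \<phi> x) x) + cmod (mderiv b \<phi> x))"
        unfolding dec by (intro mult_left_mono norm_triangle_ineq) auto
      also have "\<dots> \<le> C / R + schwartz_seminorm a b \<phi>"
        unfolding distrib_left by (intro add_mono C schwartz_seminorm_upper \<phi>)
      finally show ?thesis .
    qed
    then show "\<exists>C. \<forall>x. weight a x * cmod (mderiv b (\<phi>R R) x) \<le> C" by blast
  qed
  have tR: "\<phi>R R \<in> test_functions" if R: "R \<ge> 1" for R
  proof -
    have "\<phi>R R x = 0" if x: "x \<notin> cbox (\<chi> i. - 2 * R) (\<chi> i. 2 * R)" for x
    proof -
      obtain i where "\<not> (- 2 * R \<le> x $ i \<and> x $ i \<le> 2 * R)"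
        using x by (auto simp: mem_box_cart)
      then have "2 * R \<le> \<bar>x $ i\<bar>" by linarith
      then have "2 \<le> \<bar>((1 / R) *\<^sub>R x) $ i\<bar>" using R by (simp add: abs_divide field_simps)
      then have "\<kappa> (((1 / R) *\<^sub>R x) $ i) = 0" by (rule \<kappa>(3))
      then have "X ((1 / R) *\<^sub>R x) = 0" unfolding X_def tensor_def by (intro prod_zero) auto
      then show ?thesis by (simp add: \<phi>R_def)
    qed
    then show ?thesis unfolding test_functions_def using smR compact_cbox by blast
  qed
  show ?thesis
  proof (rule that[of "\<lambda>n. \<phi>R (Suc n)"])
    show "\<phi>R (Suc n) \<in> test_functions" for n by (rule tR) simp
    show "(\<lambda>n. f (\<phi>R (Suc n))) \<longlonglongrightarrow> f \<phi>" if "tempered_distribution f" for f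
      by (rule tempered_perturbation[OF that \<phi> sR]) (use est in \<open>simp_all add: dec\<close>)
  qed
qed

section \<open>Atomic measures\<close>

text \<open>Singletons are bounded Borel sets, so the weights in the definition must be the point
  masses of \<open>\<mu>\<close>, and points outside \<open>A\<close> carry none. This removes the
  unspecified \<open>A\<close> and \<open>a\<close> from all later arguments.\<close>

lemma atomic_measure_has_sum:
  assumes \<mu>: "atomic_measure \<mu>"
  shows "B \<in> bounded_borel \<Longrightarrow> ((\<lambda>s. \<mu> {s}) has_sum \<mu> B) B"
    and "countable {s. \<mu> {s} \<noteq> 0}"
proof -
  obtain A a where A: "countable A" "\<And>B. B \<in> bounded_borel \<Longrightarrow> (a has_sum \<mu> B) (A \<inter> B)"
    using \<mu> unfolding atomic_measure_def by blast
  have sing: "{s} \<in> bounded_borel" for s by (simp add: bounded_borel_def)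
  have in_A: "\<mu> {s} = a s" if "s \<in> A" for s
  proof -
    have "(a has_sum \<mu> {s}) {s}" using A(2)[OF sing[of s]] that by simp
    from infsumI[OF this] show ?thesis by simp
  qed
  have out_A: "\<mu> {s} = 0" if "s \<notin> A" for s
  proof -
    have "(a has_sum \<mu> {s}) {}" using A(2)[OF sing[of s]] that by simp
    from infsumI[OF this] show ?thesis by simp
  qed
  show "countable {s. \<mu> {s} \<noteq> 0}"
    by (rule countable_subset[OF _ A(1)]) (use out_A in auto)
  show "((\<lambda>s. \<mu> {s}) has_sum \<mu> B) B" if "B \<in> bounded_borel"
    using A(2)[OF that] by (subst has_sum_cong_neutral[where g = a and T = "A \<inter> B"]) (auto simp: in_A out_A)
qed

text \<open>The identity map moves the measure from the power set to the Borel sets, on which the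
  variation measures are defined.\<close>

definition weighted_counting :: "('a::topological_space \<Rightarrow> ennreal) \<Rightarrow> 'a measure" where
  "weighted_counting w = distr (density (count_space UNIV) w) borel (\<lambda>x. x)"

lemma space_weighted_counting [simp]: "space (weighted_counting w) = UNIV"
  and sets_weighted_counting [simp]: "sets (weighted_counting w) = sets borel"
  by (simp_all add: weighted_counting_def)

lemma emeasure_weighted_counting:
  assumes "B \<in> sets borel"
  shows "emeasure (weighted_counting w) B = (\<integral>\<^sup>+s. w s \<partial>count_space B)"
  using assms unfolding weighted_counting_def
  by (subst emeasure_distr) (auto simp: emeasure_density nn_integral_count_space_indicator)

lemma nn_integral_count_space_has_sum:
  fixes c :: "'a \<Rightarrow> real"
  assumes "(c has_sum S) C" "\<And>s. s \<in> C \<Longrightarrow> 0 \<le> c s"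
  shows "(\<integral>\<^sup>+s. ennreal (c s) \<partial>count_space C) = ennreal S"
proof -
  have "(\<lambda>s. norm (c s)) summable_on C"
    using has_sum_imp_summable[OF assms(1)] assms(2) by (subst summable_on_cong[where g = c]) auto
  then have "Infinite_Set_Sum.abs_summable_on c C" using abs_summable_equivalent by blast
  then show ?thesis
    using nn_integral_conv_infsetsum[of c C] assms infsetsum_infsum[of c C] infsumI[OF assms(1)] by simp
qed

text \<open>\<open>measure_of\<close> yields the intended values only for a countably additive set
  function; agreement with an existing measure on the Borel sets supplies this at once.\<close>

lemma measure_of_eq_weighted_counting:
  assumes "\<And>B. B \<in> sets borel \<Longrightarrow> F B = emeasure (weighted_counting w) B"
  shows "measure_of UNIV (sets borel) F = weighted_counting w"
proof -
  have "measure_of UNIV (sets borel) F = measure_of UNIV (sets borel) (emeasure (weighted_counting w))"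
    using assms by (intro measure_of_eq) (auto simp: sets.sigma_sets_eq[of borel, simplified])
  also have "\<dots> = weighted_counting w"
    using measure_of_of_measure[of "weighted_counting w"] by simp
  finally show ?thesis .
qed

text \<open>Continuity from below along balls. The variations are suprema over bounded Borel sets
  only, whereas their arguments may be unbounded.\<close>

lemma emeasure_bounded_exhaustion:
  fixes M :: "'a::euclidean_space measure"
  assumes M: "sets M = sets borel" and B: "B \<in> sets borel"
    and le: "\<And>n::nat. emeasure M (B \<inter> ball 0 n) \<le> K"
  shows "emeasure M B \<le> K"
proof -
  have "(\<Union>n::nat. B \<inter> ball 0 (real n)) = B"
    using reals_Archimedean2 by auto
  moreover have "(SUP n::nat. emeasure M (B \<inter> ball 0 (real n))) = emeasure M (\<Union>n::nat. B \<inter> ball 0 (real n))"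
  proof (rule SUP_emeasure_incseq)
    have "B \<inter> ball 0 (real n) \<in> sets M" for n
      unfolding M by (intro sets.Int B borel_open open_ball)
    then show "range (\<lambda>n::nat. B \<inter> ball 0 (real n)) \<subseteq> sets M" by blast
    show "incseq (\<lambda>n::nat. B \<inter> ball 0 (real n))"
      by (intro monoI Int_mono order.refl subset_ball) simp
  qed
  ultimately have "emeasure M B = (SUP n::nat. emeasure M (B \<inter> ball 0 (real n)))" by simp
  also have "\<dots> \<le> K" by (rule SUP_least) (rule le)
  finally show ?thesis .
qed

text \<open>On a bounded set the supremum is attained at the set of its positive atoms, which is
  countable and hence Borel. Since \<open>ennreal\<close> sends negative numbers to 0, the weight is
  already the positive part.\<close>

lemma positive_variation_eq:
  fixes c :: "real ^ 'd::finite \<Rightarrow> real"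
  assumes sum: "\<And>B. B \<in> bounded_borel \<Longrightarrow> (c has_sum \<rho> B) B" and count: "countable {s. c s \<noteq> 0}"
  shows "positive_variation \<rho> = weighted_counting (\<lambda>s. ennreal (c s))"
  unfolding positive_variation_def
proof (rule measure_of_eq_weighted_counting)
  let ?W = "weighted_counting (\<lambda>s. ennreal (c s))"
  fix B :: "(real ^ 'd) set" assume B: "B \<in> sets borel"
  define pos where "pos C = {s \<in> C. 0 < c s}" for C
  have pos_bb: "pos C \<in> bounded_borel" if "C \<in> bounded_borel" for C
  proof -
    have "countable (pos C)" by (rule countable_subset[OF _ count]) (auto simp: pos_def)
    then have "pos C \<in> sets borel" by (rule sets.countable[rotated]) simp
    moreover have "bounded (pos C)" using that by (auto simp: pos_def bounded_borel_def intro: bounded_subset)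
    ultimately show ?thesis by (simp add: bounded_borel_def)
  qed
  have W: "emeasure ?W C = ennreal (\<rho> (pos C))" if "C \<in> bounded_borel" for C
  proof -
    have "emeasure ?W C = (\<integral>\<^sup>+s. ennreal (c s) \<partial>count_space C)"
      using that by (intro emeasure_weighted_counting) (simp add: bounded_borel_def)
    also have "\<dots> = (\<integral>\<^sup>+s. ennreal (c s) \<partial>count_space (pos C))"
      by (rule nn_integral_count_space_eq) (auto simp: pos_def ennreal_neg)
    also have "\<dots> = ennreal (\<rho> (pos C))"
      by (rule nn_integral_count_space_has_sum[OF sum[OF pos_bb[OF that]]]) (simp add: pos_def)
    finally show ?thesis .
  qed
  show "(SUP C\<in>{C \<in> bounded_borel. C \<subseteq> B}. ennreal (\<rho> C)) = emeasure ?W B"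
  proof (rule antisym)
    show "(SUP C\<in>{C \<in> bounded_borel. C \<subseteq> B}. ennreal (\<rho> C)) \<le> emeasure ?W B"
    proof (rule SUP_least)
      fix C assume "C \<in> {C \<in> bounded_borel. C \<subseteq> B}"
      then have C: "C \<in> bounded_borel" "C \<subseteq> B" by auto
      have "\<rho> C \<le> \<rho> (pos C)"
        by (rule has_sum_mono_neutral[OF sum[OF C(1)] sum[OF pos_bb[OF C(1)]]]) (auto simp: pos_def)
      then have "ennreal (\<rho> C) \<le> emeasure ?W C" using W[OF C(1)] by (simp add: ennreal_leI)
      also have "\<dots> \<le> emeasure ?W B" by (rule emeasure_mono) (use C B in auto)
      finally show "ennreal (\<rho> C) \<le> emeasure ?W B" .
    qed
    show "emeasure ?W B \<le> (SUP C\<in>{C \<in> bounded_borel. C \<subseteq> B}. ennreal (\<rho> C))"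
    proof (rule emeasure_bounded_exhaustion[OF _ B])
      fix n :: nat
      have bb: "B \<inter> ball 0 (real n) \<in> bounded_borel"
        using B by (auto simp: bounded_borel_def intro: bounded_subset[OF bounded_ball])
      show "emeasure ?W (B \<inter> ball 0 (real n)) \<le> (SUP C\<in>{C \<in> bounded_borel. C \<subseteq> B}. ennreal (\<rho> C))"
        unfolding W[OF bb] using pos_bb[OF bb] by (intro SUP_upper) (auto simp: pos_def)
    qed simp
  qed
qed

text \<open>The triangle inequality bounds every finite family from above; conversely the singletons
  of a finite set of atoms form an admissible family, and finite sets of atoms exhaust the
  sum.\<close>

lemma total_variation_eq:
  fixes \<mu> :: "(real ^ 'd::finite) set \<Rightarrow> complex"
  assumes sum: "\<And>B. B \<in> bounded_borel \<Longrightarrow> ((\<lambda>s. \<mu> {s}) has_sum \<mu> B) B"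
  shows "total_variation \<mu> = weighted_counting (\<lambda>s. ennreal (cmod (\<mu> {s})))"
  unfolding total_variation_def
proof (rule measure_of_eq_weighted_counting)
  let ?W = "weighted_counting (\<lambda>s. ennreal (cmod (\<mu> {s})))"
  fix B :: "(real ^ 'd) set" assume B: "B \<in> sets borel"
  let ?PP = "{P. finite P \<and> disjoint P \<and> P \<subseteq> bounded_borel \<and> \<Union>P \<subseteq> B}"
  have abs: "(\<lambda>s. cmod (\<mu> {s})) summable_on C" if "C \<in> bounded_borel" for C
    by (rule has_sum_imp_summable[OF sum[OF that], THEN summable_on_iff_abs_summable_on_complex[THEN iffD1]])
  have W: "emeasure ?W C = ennreal (\<Sum>\<^sub>\<infinity>s\<in>C. cmod (\<mu> {s}))" if "C \<in> bounded_borel" for C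
    using that emeasure_weighted_counting[of C]
      nn_integral_count_space_has_sum[OF has_sum_infsum[OF abs[OF that]]] by (simp add: bounded_borel_def)
  have le_W: "ennreal (cmod (\<mu> C)) \<le> emeasure ?W C" if "C \<in> bounded_borel" for C
    using norm_infsum_bound[OF abs[OF that]] infsumI[OF sum[OF that]] W[OF that] by (simp add: ennreal_leI)
  show "(SUP P\<in>?PP. \<Sum>C\<in>P. ennreal (cmod (\<mu> C))) = emeasure ?W B"
  proof (rule antisym)
    show "(SUP P\<in>?PP. \<Sum>C\<in>P. ennreal (cmod (\<mu> C))) \<le> emeasure ?W B"
    proof (rule SUP_least)
      fix P assume "P \<in> ?PP"
      then have P: "finite P" "disjoint P" "P \<subseteq> bounded_borel" "\<Union>P \<subseteq> B" by auto
      have "(\<Sum>C\<in>P. ennreal (cmod (\<mu> C))) \<le> (\<Sum>C\<in>P. emeasure ?W C)"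
        using P(3) le_W by (intro sum_mono) auto
      also have "\<dots> = emeasure ?W (\<Union>P)"
      proof -
        have "P \<subseteq> sets borel" using P(3) by (auto simp: bounded_borel_def)
        then show ?thesis
          using sum_emeasure[of "\<lambda>C. C" P ?W] P(1,2) by (simp add: disjoint_family_on_def disjoint_def)
      qed
      also have "\<dots> \<le> emeasure ?W B" using P(4) B by (intro emeasure_mono) auto
      finally show "(\<Sum>C\<in>P. ennreal (cmod (\<mu> C))) \<le> emeasure ?W B" .
    qed
    show "emeasure ?W B \<le> (SUP P\<in>?PP. \<Sum>C\<in>P. ennreal (cmod (\<mu> C)))" (is "_ \<le> ?K")
    proof (rule emeasure_bounded_exhaustion[OF _ B])
      fix n :: nat
      have bb: "B \<inter> ball 0 (real n) \<in> bounded_borel"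
        using B by (auto simp: bounded_borel_def intro: bounded_subset[OF bounded_ball])
      show "emeasure ?W (B \<inter> ball 0 (real n)) \<le> ?K"
      proof (cases "?K = top")
        case False
        then have lt: "?K < top" by (simp only: top.not_eq_extremum)
        have "(\<Sum>s\<in>F. cmod (\<mu> {s})) \<le> enn2real ?K" if F: "finite F" "F \<subseteq> B \<inter> ball 0 (real n)" for F
        proof -
          have "ennreal (\<Sum>s\<in>F. cmod (\<mu> {s})) = (\<Sum>C\<in>(\<lambda>s. {s}) ` F. ennreal (cmod (\<mu> C)))"
            by (subst sum.reindex) (auto simp: inj_on_def sum_ennreal)
          also have "\<dots> \<le> ?K"
            using F by (intro SUP_upper) (auto simp: bounded_borel_def disjoint_def)
          finally have "ennreal (\<Sum>s\<in>F. cmod (\<mu> {s})) \<le> ?K" .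
          from enn2real_mono[OF this lt] show ?thesis by (simp add: sum_nonneg)
        qed
        then have "(\<Sum>\<^sub>\<infinity>s\<in>B \<inter> ball 0 (real n). cmod (\<mu> {s})) \<le> enn2real ?K"
          by (intro infsum_le_finite_sums abs[OF bb])
        then have "ennreal (\<Sum>\<^sub>\<infinity>s\<in>B \<inter> ball 0 (real n). cmod (\<mu> {s})) \<le> ennreal (enn2real ?K)"
          by (rule ennreal_leI)
        also have "ennreal (enn2real ?K) = ?K"
          by (rule ennreal_enn2real[OF lt])
        finally show ?thesis unfolding W[OF bb] .
      qed (simp only: top_greatest)
    qed simp
  qed
qed

section \<open>Integration against an atomic measure\<close>

lemma integral_weighted_counting:
  fixes \<phi> :: "'a::topological_space \<Rightarrow> complex"
  assumes "\<phi> \<in> borel_measurable borel" "\<And>s. 0 \<le> g s"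
  shows "(LINT x|weighted_counting (\<lambda>s. ennreal (g s)). \<phi> x) = (LINT s|count_space UNIV. g s *\<^sub>R \<phi> s)"
  unfolding weighted_counting_def using assms
  by (subst integral_distr, simp, simp, subst integral_density) auto

lemma integrable_count_space_iff:
  fixes h :: "'a \<Rightarrow> complex"
  shows "integrable (count_space UNIV) h \<longleftrightarrow> (\<lambda>s. cmod (h s)) summable_on UNIV"
  using abs_summable_equivalent[of h UNIV] by (simp add: Infinite_Set_Sum.abs_summable_on_def)

lemma has_sum_integral_count_space:
  fixes h :: "'a \<Rightarrow> complex"
  assumes "integrable (count_space UNIV) h"
  shows "(h has_sum (LINT s|count_space UNIV. h s)) UNIV"
proof -
  have "h summable_on UNIV"
    using assms by (simp add: integrable_count_space_iff abs_summable_summable)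
  moreover have "infsum h UNIV = (LINT s|count_space UNIV. h s)"
    using infsetsum_infsum[of h UNIV] assms by (simp add: Infinite_Set_Sum.abs_summable_on_def infsetsum_def)
  ultimately show ?thesis using has_sum_infsum by metis
qed

text \<open>The four Jordan parts are weighted counting measures whose weights are the positive
  parts of \<plusminus>Re and \<plusminus>Im of the point masses. Each of them is dominated by the
  modulus of the mass, so the four integrals exist and recombine under one integral sign.\<close>

lemma complex_measure_integral_eq:
  fixes \<mu> :: "(real ^ 'd::finite) set \<Rightarrow> complex"
  assumes \<mu>: "atomic_measure \<mu>" and \<phi>: "\<phi> \<in> borel_measurable borel"
    and int: "integrable (count_space UNIV) (\<lambda>s. \<mu> {s} * \<phi> s)"
  shows "complex_measure_integral \<mu> \<phi> = (LINT s|count_space UNIV. \<mu> {s} * \<phi> s)"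
proof -
  note sum = atomic_measure_has_sum(1)[OF \<mu>]
  have pv: "(LINT x|positive_variation \<rho>. \<phi> x) = (LINT s|count_space UNIV. max 0 (c s) *\<^sub>R \<phi> s)"
    if "\<And>B. B \<in> bounded_borel \<Longrightarrow> (c has_sum \<rho> B) B" "\<And>s. c s \<noteq> 0 \<Longrightarrow> \<mu> {s} \<noteq> 0" for c \<rho>
  proof -
    have "positive_variation \<rho> = weighted_counting (\<lambda>s. ennreal (c s))"
      by (rule positive_variation_eq[OF that(1)], assumption,
          rule countable_subset[OF _ atomic_measure_has_sum(2)[OF \<mu>]]) (use that(2) in auto)
    \<comment> \<open>Nothing changes in \<open>ennreal\<close>, but the density formula for the
      integral asks for a nonnegative real weight.\<close>
    also have "(\<lambda>s. ennreal (c s)) = (\<lambda>s. ennreal (max 0 (c s)))"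
      by (auto simp: fun_eq_iff max_def ennreal_neg)
    finally show ?thesis using integral_weighted_counting[OF \<phi>, of "\<lambda>s. max 0 (c s)"] by simp
  qed
  have i: "integrable (count_space UNIV) (\<lambda>s. max 0 (c s) *\<^sub>R \<phi> s)" if "\<And>s. \<bar>c s\<bar> \<le> cmod (\<mu> {s})" for c
    by (rule Bochner_Integration.integrable_bound[OF int])
       (use that in \<open>auto simp: AE_count_space norm_mult max_def intro!: mult_right_mono intro: order.trans[OF abs_ge_self]\<close>)
  let ?L = "\<lambda>c. LINT s|count_space UNIV. max 0 (c s) *\<^sub>R \<phi> s"
  have pv1: "(LINT x|positive_variation (\<lambda>B. Re (\<mu> B)). \<phi> x) = ?L (\<lambda>s. Re (\<mu> {s}))"
    by (rule pv) (auto intro: has_sum_Re sum)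
  have pv2: "(LINT x|positive_variation (\<lambda>B. - Re (\<mu> B)). \<phi> x) = ?L (\<lambda>s. - Re (\<mu> {s}))"
    by (rule pv) (auto intro: has_sum_Re sum simp: has_sum_uminus)
  have pv3: "(LINT x|positive_variation (\<lambda>B. Im (\<mu> B)). \<phi> x) = ?L (\<lambda>s. Im (\<mu> {s}))"
    by (rule pv) (auto intro: has_sum_Im sum)
  have pv4: "(LINT x|positive_variation (\<lambda>B. - Im (\<mu> B)). \<phi> x) = ?L (\<lambda>s. - Im (\<mu> {s}))"
    by (rule pv) (auto intro: has_sum_Im sum simp: has_sum_uminus)
  have "complex_measure_integral \<mu> \<phi> = ?L (\<lambda>s. Re (\<mu> {s})) - ?L (\<lambda>s. - Re (\<mu> {s}))
      + \<i> * (?L (\<lambda>s. Im (\<mu> {s})) - ?L (\<lambda>s. - Im (\<mu> {s})))"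
    unfolding complex_measure_integral_def pv1 pv2 pv3 pv4 ..
  also have "\<dots> = (LINT s|count_space UNIV. max 0 (Re (\<mu> {s})) *\<^sub>R \<phi> s - max 0 (- Re (\<mu> {s})) *\<^sub>R \<phi> s
      + \<i> * (max 0 (Im (\<mu> {s})) *\<^sub>R \<phi> s - max 0 (- Im (\<mu> {s})) *\<^sub>R \<phi> s))"
    using i[of "\<lambda>s. Re (\<mu> {s})"] i[of "\<lambda>s. - Re (\<mu> {s})"] i[of "\<lambda>s. Im (\<mu> {s})"] i[of "\<lambda>s. - Im (\<mu> {s})"]
    by (simp add: abs_Re_le_cmod abs_Im_le_cmod)
  also have "\<dots> = (LINT s|count_space UNIV. \<mu> {s} * \<phi> s)"
  proof (rule Bochner_Integration.integral_cong[OF refl])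
    fix s
    have "\<mu> {s} = of_real (max 0 (Re (\<mu> {s}))) - of_real (max 0 (- Re (\<mu> {s})))
      + \<i> * (of_real (max 0 (Im (\<mu> {s}))) - of_real (max 0 (- Im (\<mu> {s}))))"
      by (simp add: complex_eq_iff max_def)
    then show "max 0 (Re (\<mu> {s})) *\<^sub>R \<phi> s - max 0 (- Re (\<mu> {s})) *\<^sub>R \<phi> s
      + \<i> * (max 0 (Im (\<mu> {s})) *\<^sub>R \<phi> s - max 0 (- Im (\<mu> {s})) *\<^sub>R \<phi> s) = \<mu> {s} * \<phi> s"
      unfolding scaleR_conv_of_real by (simp only: left_diff_distrib[symmetric] distrib_right[symmetric] mult.assoc[symmetric])
  qed
  finally show ?thesis .
qed

lemma test_function_continuous: "\<phi> \<in> test_functions \<Longrightarrow> continuous_on UNIV \<phi>"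
  unfolding test_functions_def
  by (auto intro!: continuous_at_imp_continuous_on differentiable_imp_continuous_within smooth_differentiable)

text \<open>The masses are summable over the compact set \<open>K\<close>, which is bounded and
  Borel, and for complex numbers unconditional summability is absolute; the test function
  contributes a bounded factor.\<close>

lemma test_function_integrable:
  fixes \<mu> :: "(real ^ 'd::finite) set \<Rightarrow> complex"
  assumes \<mu>: "atomic_measure \<mu>" and \<phi>: "\<phi> \<in> test_functions"
  shows "integrable (count_space UNIV) (\<lambda>s. \<mu> {s} * \<phi> s)"
proof -
  obtain K where K: "compact K" "\<And>x. x \<notin> K \<Longrightarrow> \<phi> x = 0" using \<phi> by (auto simp: test_functions_def)
  have "compact (\<phi> ` K)"
    by (rule compact_continuous_image[OF continuous_on_subset[OF test_function_continuous[OF \<phi>]] K(1)]) simp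
  then obtain C where C: "\<And>x. x \<in> K \<Longrightarrow> cmod (\<phi> x) \<le> C"
    using compact_imp_bounded by (metis bounded_iff imageI)
  have "K \<in> bounded_borel" using K(1) by (simp add: bounded_borel_def compact_imp_bounded borel_compact)
  then have "(\<lambda>s. cmod (\<mu> {s})) summable_on K"
    by (rule has_sum_imp_summable[OF atomic_measure_has_sum(1)[OF \<mu>],
          THEN summable_on_iff_abs_summable_on_complex[THEN iffD1]])
  then have "(\<lambda>s. cmod (\<mu> {s}) * C) summable_on K" by (rule summable_on_cmult_left)
  then have "(\<lambda>s. cmod (\<mu> {s} * \<phi> s)) summable_on K"
    by (rule Infinite_Sum.abs_summable_on_comparison_test') (auto simp: norm_mult intro!: mult_left_mono C)
  then have "(\<lambda>s. cmod (\<mu> {s} * \<phi> s)) summable_on UNIV"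
    by (rule summable_on_cong_neutral[THEN iffD1, rotated -1]) (auto simp: K(2))
  then show ?thesis by (simp add: integrable_count_space_iff)
qed

lemma complex_measure_integral_test:
  assumes "atomic_measure \<mu>" "\<phi> \<in> test_functions"
  shows "complex_measure_integral \<mu> \<phi> = (LINT s|count_space UNIV. \<mu> {s} * \<phi> s)"
  using assms by (intro complex_measure_integral_eq test_function_integrable borel_measurable_continuous_onI test_function_continuous)

section \<open>Polynomial growth of a tempered atomic measure\<close>

text \<open>Under dilation the weight scales like R^a, while the derivative gains (1/R)^b, which is
  at most 1.\<close>

lemma dilation_weight_bound:
  fixes \<kappa> :: "real \<Rightarrow> complex"
  assumes "test1 \<kappa>"
  obtains C where "C \<ge> 0" "\<And>R x. R \<ge> 1 \<Longrightarrow> \<bar>x\<bar> ^ a * cmod ((vderiv ^^ b) (\<lambda>x. \<kappa> (x / R)) x) \<le> C * R ^ a"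
proof -
  obtain C where C: "\<And>x. \<bar>x\<bar> ^ a * cmod ((vderiv ^^ b) \<kappa> x) \<le> C"
    using test1_bounded[OF test1_vderiv_pow[OF assms, of b], of a] by blast
  have sm: "smooth1 \<kappa>" using assms by (simp add: test1_def)
  have "\<bar>x\<bar> ^ a * cmod ((vderiv ^^ b) (\<lambda>x. \<kappa> (x / R)) x) \<le> C * R ^ a" if R: "R \<ge> 1" for R x
  proof -
    have "(vderiv ^^ b) (\<lambda>x. \<kappa> (x / R)) x = of_real (1 / R) ^ b * (vderiv ^^ b) \<kappa> (x / R)"
      using fun_cong[OF vderiv_pow_affine[OF sm, of b "1 / R" 0], of x] by simp
    then have "cmod ((vderiv ^^ b) (\<lambda>x. \<kappa> (x / R)) x) = (1 / R) ^ b * cmod ((vderiv ^^ b) \<kappa> (x / R))"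
      using R by (simp add: norm_mult norm_power norm_divide)
    also have "\<dots> \<le> 1 * cmod ((vderiv ^^ b) \<kappa> (x / R))"
      using R by (intro mult_right_mono power_le_one) auto
    finally have "\<bar>x\<bar> ^ a * cmod ((vderiv ^^ b) (\<lambda>x. \<kappa> (x / R)) x) \<le> \<bar>x\<bar> ^ a * cmod ((vderiv ^^ b) \<kappa> (x / R))"
      by (intro mult_left_mono) auto
    also have "\<dots> = (\<bar>x / R\<bar> ^ a * cmod ((vderiv ^^ b) \<kappa> (x / R))) * R ^ a"
      using R by (simp add: abs_divide power_divide)
    also have "\<dots> \<le> C * R ^ a" using C[of "x / R"] R by (intro mult_right_mono) auto
    finally show ?thesis .
  qed
  moreover have "C \<ge> 0" using order.trans[OF _ C[of 0]] by simp
  ultimately show ?thesis using that by blast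
qed

text \<open>The total variation is tested against a nonnegative cutoff at scale R that is 1 on a
  cube containing \<open>cball 0 R\<close>: its value dominates the mass of the ball, and by
  temperateness it is bounded by seminorms of the cutoff, which grow polynomially in R.\<close>

lemma tempered_variation_growth:
  fixes \<mu> :: "(real ^ 'd::finite) set \<Rightarrow> complex"
  assumes \<mu>: "atomic_measure \<mu>" and temp: "tempered_measure (total_variation \<mu>)"
  obtains C n where "C \<ge> 0"
    "\<And>R F. R \<ge> 1 \<Longrightarrow> finite F \<Longrightarrow> F \<subseteq> cball 0 R \<Longrightarrow> (\<Sum>s\<in>F. cmod (\<mu> {s})) \<le> C * R ^ n"
proof -
  obtain T where T: "tempered_distribution T" "\<And>\<phi>. \<phi> \<in> test_functions \<Longrightarrow> T \<phi> = (LINT x|total_variation \<mu>. \<phi> x)"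
    using temp unfolding tempered_measure_def by blast
  obtain Q :: "((nat ^ 'd) \<times> (nat ^ 'd)) set" and C where Q: "finite Q" "C \<ge> 0"
    "\<And>\<phi>. \<phi> \<in> schwartz_space \<Longrightarrow> cmod (T \<phi>) \<le> C * (\<Sum>(a, b)\<in>Q. schwartz_seminorm a b \<phi>)"
    using tempered_distribution_bound[OF T(1)] by blast
  obtain \<kappa> :: "real \<Rightarrow> real" where \<kappa>: "smooth1 (\<lambda>x. of_real (\<kappa> x))" "\<And>x. 0 \<le> \<kappa> x"
    "\<And>x. \<bar>x\<bar> \<le> 1 \<Longrightarrow> \<kappa> x = 1" "\<And>x. \<bar>x\<bar> \<ge> 2 \<Longrightarrow> \<kappa> x = 0"
    using smooth_cutoff_exists by metis
  have t: "test1 (\<lambda>x. of_real (\<kappa> x))"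
    using \<kappa> unfolding test1_def by (intro conjI exI[of _ 2]) auto
  define X where "X R = tensor (\<lambda>(i::'d) x. complex_of_real (\<kappa> (x / R)))" for R
  have t1: "test1 (\<lambda>x. complex_of_real (\<kappa> (x / R)))" if R: "R \<ge> 1" for R
    unfolding test1_def
  proof (intro conjI exI[of _ "2 * R"] allI impI)
    show "smooth1 (\<lambda>x. complex_of_real (\<kappa> (x / R)))" using smooth1_affine(1)[OF \<kappa>(1), of "1 / R" 0] by simp
    show "complex_of_real (\<kappa> (x / R)) = 0" if "2 * R < \<bar>x\<bar>" for x
      using \<kappa>(4)[of "x / R"] that R by (simp add: abs_divide field_simps)
  qed
  have "\<exists>K. \<forall>(q :: (nat ^ 'd) \<times> (nat ^ 'd)) i. K q i \<ge> 0 \<and> (\<forall>R\<ge>1. \<forall>x. \<bar>x\<bar> ^ (fst q $ i)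
      * cmod ((vderiv ^^ (snd q $ i)) (\<lambda>x. complex_of_real (\<kappa> (x / R))) x) \<le> K q i * R ^ (fst q $ i))"
    by (rule choice, rule allI, rule choice, rule allI) (use dilation_weight_bound[OF t] in metis)
  then obtain K where K: "\<And>(q :: (nat ^ 'd) \<times> (nat ^ 'd)) i. K q i \<ge> 0"
    "\<And>(q :: (nat ^ 'd) \<times> (nat ^ 'd)) i R x. R \<ge> 1 \<Longrightarrow> \<bar>x\<bar> ^ (fst q $ i)
      * cmod ((vderiv ^^ (snd q $ i)) (\<lambda>x. complex_of_real (\<kappa> (x / R))) x) \<le> K q i * R ^ (fst q $ i)"
    by blast
  \<comment> \<open>A crude exponent that dominates the degree of every weight in \<open>Q\<close>
    at once; as R >= 1, raising the exponent is harmless.\<close>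
  define n where "n = (\<Sum>q\<in>Q. \<Sum>i\<in>UNIV. fst q $ i)"
  have sn: "schwartz_seminorm a b (X R) \<le> (\<Prod>i\<in>UNIV. K (a, b) i) * R ^ n" if ab: "(a, b) \<in> Q" and R: "R \<ge> 1" for a b R
  proof (rule schwartz_seminorm_least)
    fix x
    have sm: "\<And>i::'d. smooth1 (\<lambda>x. complex_of_real (\<kappa> (x / R)))" using t1[OF R] by (simp add: test1_def)
    have "weight a x * cmod (mderiv b (X R) x) \<le> (\<Prod>i\<in>UNIV. K (a, b) i * R ^ (a $ i))"
      unfolding X_def mderiv_tensor[OF sm] tensor_weight
      using K(2)[OF R, of _ "(a, b)"] by (intro prod_mono) auto
    also have "\<dots> = (\<Prod>i\<in>UNIV. K (a, b) i) * R ^ (\<Sum>i\<in>UNIV. a $ i)"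
      by (simp add: prod.distrib power_sum)
    also have "\<dots> \<le> (\<Prod>i\<in>UNIV. K (a, b) i) * R ^ n"
    proof (intro mult_left_mono power_increasing R prod_nonneg ballI K)
      show "(\<Sum>i\<in>UNIV. a $ i) \<le> n"
        using member_le_sum[OF ab, of "\<lambda>q. \<Sum>i\<in>UNIV. fst q $ i"] Q(1) by (simp add: n_def)
    qed
    finally show "weight a x * cmod (mderiv b (X R) x) \<le> (\<Prod>i\<in>UNIV. K (a, b) i) * R ^ n" .
  qed
  define D where "D = C * (\<Sum>q\<in>Q. \<Prod>i\<in>UNIV. K q i)"
  show ?thesis
  proof (rule that)
    show "D \<ge> 0" unfolding D_def using Q(2) K(1) by (intro mult_nonneg_nonneg sum_nonneg prod_nonneg) auto
    fix R F assume R: "R \<ge> (1::real)" and F: "finite F" "F \<subseteq> cball (0 :: real ^ 'd) R"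
    have Xt: "X R \<in> test_functions" unfolding X_def by (rule tensor_in_test_functions) (rule t1[OF R])
    have Xs: "X R \<in> schwartz_space" unfolding X_def by (rule tensor_in_schwartz) (rule test1_schwartz1[OF t1[OF R]])
    define h where "h s = cmod (\<mu> {s}) * (\<Prod>i\<in>UNIV. \<kappa> (s $ i / R))" for s :: "real ^ 'd"
    have Xh: "cmod (\<mu> {s}) *\<^sub>R X R s = complex_of_real (h s)" for s
      by (simp add: X_def tensor_def h_def scaleR_conv_of_real)
    have h0: "h s \<ge> 0" for s unfolding h_def by (intro mult_nonneg_nonneg prod_nonneg) (auto simp: \<kappa>)
    have int: "integrable (count_space UNIV) (\<lambda>s. complex_of_real (h s))"
      by (rule Bochner_Integration.integrable_bound[OF test_function_integrable[OF \<mu> Xt]])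
         (auto simp: Xh[symmetric] norm_mult AE_count_space)
    have tv: "total_variation \<mu> = weighted_counting (\<lambda>s. ennreal (cmod (\<mu> {s})))"
      by (rule total_variation_eq) (rule atomic_measure_has_sum(1)[OF \<mu>])
    have "T (X R) = (LINT s|count_space UNIV. complex_of_real (h s))"
      unfolding T(2)[OF Xt] tv Xh[symmetric]
      by (intro integral_weighted_counting borel_measurable_continuous_onI test_function_continuous[OF Xt]) auto
    then have hs: "((\<lambda>s. complex_of_real (h s)) has_sum T (X R)) UNIV"
      using has_sum_integral_count_space[OF int] by simp
    have hs': "(h has_sum Re (T (X R))) UNIV" using has_sum_Re[OF hs] by simp
    have "(\<Sum>s\<in>F. cmod (\<mu> {s})) = (\<Sum>s\<in>F. h s)"
    proof (rule sum.cong[OF refl])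
      fix s assume "s \<in> F"
      then have "norm s \<le> R" using F by auto
      then have "\<bar>s $ i\<bar> \<le> R" for i using component_le_norm_cart[of s i] by simp
      then have "\<kappa> (s $ i / R) = 1" for i using R by (intro \<kappa>) (simp add: abs_divide)
      then show "cmod (\<mu> {s}) = h s" by (simp add: h_def)
    qed
    also have "\<dots> \<le> Re (T (X R))"
      by (rule finite_sum_le_has_sum[OF hs' F(1)]) (auto simp: h0)
    also have "\<dots> \<le> cmod (T (X R))" by (rule complex_Re_le_cmod)
    also have "\<dots> \<le> C * (\<Sum>(a, b)\<in>Q. schwartz_seminorm a b (X R))" by (rule Q(3)[OF Xs])
    also have "\<dots> \<le> C * (\<Sum>q\<in>Q. (\<Prod>i\<in>UNIV. K q i) * R ^ n)"
      using sn[OF _ R] Q(2) by (intro mult_left_mono sum_mono) auto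
    also have "\<dots> = D * R ^ n" by (simp add: D_def sum_distrib_right mult.assoc)
    finally show "(\<Sum>s\<in>F. cmod (\<mu> {s})) \<le> D * R ^ n" .
  qed
qed

text \<open>The space is cut into shells k <= |s| < k + 1. The mass of a shell is at most C (k +
  1)^n and the weight there at most K / (k + 1)^(n + 2); the two surplus powers leave the convergent
  series of 1/(k + 1)^2.\<close>

lemma growth_imp_weighted_summable:
  fixes \<alpha> w :: "'a::real_normed_vector \<Rightarrow> real"
  assumes \<alpha>: "\<And>s. 0 \<le> \<alpha> s" and C: "C \<ge> 0"
    and growth: "\<And>R F. R \<ge> 1 \<Longrightarrow> finite F \<Longrightarrow> F \<subseteq> cball 0 R \<Longrightarrow> (\<Sum>s\<in>F. \<alpha> s) \<le> C * R ^ n"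
    and w: "\<And>s. 0 \<le> w s" "\<And>s. w s * (1 + norm s) ^ (n + 2) \<le> K"
  shows "(\<lambda>s. \<alpha> s * w s) summable_on UNIV"
proof (rule nonneg_bdd_above_summable_on)
  have K: "K \<ge> 0" using order.trans[OF _ w(2)[of 0]] w(1)[of 0] by simp
  have sm: "summable (\<lambda>k. 1 / (real (Suc k))\<^sup>2)"
    using summable_Suc_iff[of "\<lambda>k. 1 / (real k)\<^sup>2"] inverse_power_summable[of 2, where 'a = real]
    by (simp add: inverse_eq_divide)
  define Z where "Z = (\<Sum>k. 1 / (real (Suc k))\<^sup>2)"
  have "(\<Sum>s\<in>F. \<alpha> s * w s) \<le> C * K * Z" if F: "finite F" for F
  proof -
    define fl where "fl s = nat \<lfloor>norm s\<rfloor>" for s :: 'a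
    have fl: "real (fl s) \<le> norm s" "norm s \<le> real (fl s) + 1" for s by (simp_all add: fl_def)
    have "(\<Sum>s\<in>F. \<alpha> s * w s) = (\<Sum>k\<in>fl ` F. \<Sum>s\<in>{s \<in> F. fl s = k}. \<alpha> s * w s)"
      by (rule sum.image_gen[OF F])
    also have "\<dots> \<le> (\<Sum>k\<in>fl ` F. C * K * (1 / (real (Suc k))\<^sup>2))"
    proof (rule sum_mono)
      fix k
      let ?F = "{s \<in> F. fl s = k}"
      have "(\<Sum>s\<in>?F. \<alpha> s * w s) \<le> (\<Sum>s\<in>?F. \<alpha> s * (K / (real (Suc k)) ^ (n + 2)))"
      proof (intro sum_mono mult_left_mono \<alpha>)
        fix s assume "s \<in> ?F"
        then have "real (Suc k) \<le> 1 + norm s" using fl(1)[of s] by auto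
        then have "w s * real (Suc k) ^ (n + 2) \<le> w s * (1 + norm s) ^ (n + 2)"
          by (intro mult_left_mono power_mono w) auto
        also have "\<dots> \<le> K" by (rule w)
        finally show "w s \<le> K / (real (Suc k)) ^ (n + 2)" by (simp add: pos_le_divide_eq del: of_nat_Suc)
      qed
      also have "\<dots> = (\<Sum>s\<in>?F. \<alpha> s) * (K / (real (Suc k)) ^ (n + 2))" by (simp only: sum_distrib_right)
      also have "\<dots> \<le> (C * real (Suc k) ^ n) * (K / (real (Suc k)) ^ (n + 2))"
      proof (intro mult_right_mono growth)
        show "?F \<subseteq> cball 0 (real (Suc k))" using fl(2) by (auto simp: add.commute)
      qed (use F K in auto)
      also have "\<dots> = C * K * (1 / (real (Suc k))\<^sup>2)"
        by (simp add: power_add power2_eq_square field_simps del: of_nat_Suc)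
      finally show "(\<Sum>s\<in>?F. \<alpha> s * w s) \<le> C * K * (1 / (real (Suc k))\<^sup>2)" .
    qed
    also have "\<dots> = C * K * (\<Sum>k\<in>fl ` F. 1 / (real (Suc k))\<^sup>2)" by (simp only: sum_distrib_left)
    also have "\<dots> \<le> C * K * Z"
      unfolding Z_def using sm F C K by (intro mult_left_mono sum_le_suminf) auto
    finally show ?thesis .
  qed
  then show "bdd_above (sum (\<lambda>s. \<alpha> s * w s) ` {F. F \<subseteq> UNIV \<and> finite F})"
    by (intro bdd_aboveI2[where M = "C * K * Z"]) auto
qed (simp add: \<alpha> w)

text \<open>By the l1 bound on the norm, 1 + |s| is at most the product of the factors 1 + |s_i|, so
  the weight splits into one-dimensional weights.\<close>

lemma tensor_decay:
  fixes v :: "'d::finite \<Rightarrow> real \<Rightarrow> complex"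
  assumes "\<And>i. schwartz1 (v i)"
  obtains K where "\<And>s. cmod (tensor v s) * (1 + norm s) ^ n \<le> K"
proof -
  have "\<exists>K. \<forall>i x. cmod (v i x) * (1 + \<bar>x\<bar>) ^ n \<le> K i"
  proof (rule choice, rule allI)
    fix i
    obtain A where A: "\<And>x. \<bar>x\<bar> ^ 0 * cmod ((vderiv ^^ 0) (v i) x) \<le> A"
      using schwartz1_bound[OF assms] by blast
    obtain B where B: "\<And>x. \<bar>x\<bar> ^ n * cmod ((vderiv ^^ 0) (v i) x) \<le> B"
      using schwartz1_bound[OF assms] by blast
    have "cmod (v i x) * (1 + \<bar>x\<bar>) ^ n \<le> 2 ^ n * (A + B)" for x
    proof -
      have "(1 + \<bar>x\<bar>) ^ n \<le> (2 * max 1 \<bar>x\<bar>) ^ n" by (intro power_mono) auto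
      also have "\<dots> \<le> 2 ^ n * (1 + \<bar>x\<bar> ^ n)" by (auto simp: power_mult_distrib max_def)
      finally have "cmod (v i x) * (1 + \<bar>x\<bar>) ^ n \<le> cmod (v i x) * (2 ^ n * (1 + \<bar>x\<bar> ^ n))"
        by (intro mult_left_mono) auto
      also have "\<dots> = 2 ^ n * (cmod (v i x) + \<bar>x\<bar> ^ n * cmod (v i x))" by (simp add: algebra_simps)
      also have "\<dots> \<le> 2 ^ n * (A + B)" using A[of x] B[of x] by simp
      finally show ?thesis .
    qed
    then show "\<exists>K. \<forall>x. cmod (v i x) * (1 + \<bar>x\<bar>) ^ n \<le> K" by blast
  qed
  then obtain K where K: "\<And>i x. cmod (v i x) * (1 + \<bar>x\<bar>) ^ n \<le> K i" by blast
  have "cmod (tensor v s) * (1 + norm s) ^ n \<le> (\<Prod>i\<in>UNIV. K i)" for s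
  proof -
    have "1 + (\<Sum>i\<in>A. \<bar>s $ i\<bar>) \<le> (\<Prod>i\<in>A. 1 + \<bar>s $ i\<bar>)" if "finite A" for A
      using that
    proof induction
      case (insert k A)
      have "1 + (\<Sum>i\<in>insert k A. \<bar>s $ i\<bar>) \<le> (1 + \<bar>s $ k\<bar>) * (1 + (\<Sum>i\<in>A. \<bar>s $ i\<bar>))"
        using insert by (simp add: algebra_simps sum_nonneg)
      also have "\<dots> \<le> (1 + \<bar>s $ k\<bar>) * (\<Prod>i\<in>A. 1 + \<bar>s $ i\<bar>)" by (intro mult_left_mono insert) auto
      finally show ?case using insert by simp
    qed simp
    from this[of UNIV] have "1 + norm s \<le> (\<Prod>i\<in>UNIV. 1 + \<bar>s $ i\<bar>)"
      using norm_le_l1_cart[of s] by simp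
    then have "cmod (tensor v s) * (1 + norm s) ^ n \<le> cmod (tensor v s) * (\<Prod>i\<in>UNIV. 1 + \<bar>s $ i\<bar>) ^ n"
      by (intro mult_left_mono power_mono) auto
    also have "\<dots> = (\<Prod>i\<in>UNIV. cmod (v i (s $ i)) * (1 + \<bar>s $ i\<bar>) ^ n)"
      by (simp add: tensor_def prod_norm prod_power_distrib prod.distrib)
    also have "\<dots> \<le> (\<Prod>i\<in>UNIV. K i)" by (intro prod_mono conjI K mult_nonneg_nonneg) auto
    finally show ?thesis .
  qed
  then show ?thesis by (rule that)
qed

section \<open>Translates as absolutely convergent exponential sums\<close>

text \<open>With \<open>u\<close> the Fourier transform of \<open>v\<close>, the \<open>t\<close>-translate of \<open>u\<close> is the transform of
  \<open>v\<close> times a character. The measure \<open>\<mu>\<close> is only known to represent the transform of \<open>f\<close> on test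
  functions, so \<open>v\<close> is cut off at scale \<open>R\<close> and the limit \<open>R \<rightarrow> \<infinity>\<close> is taken on both sides.\<close>

lemma translate_exponential_sum:
  fixes f :: "(real ^ 'd::finite \<Rightarrow> complex) \<Rightarrow> complex" and u :: "'d \<Rightarrow> real \<Rightarrow> complex"
  assumes f: "tempered_distribution f" and f\<mu>: "distr_is_measure (fourier_distr f) \<mu>"
    and \<mu>: "atomic_measure \<mu>" "tempered_measure (total_variation \<mu>)"
    and u: "\<And>i. schwartz1 (u i)"
  obtains \<beta> where "(\<lambda>s. cmod (\<beta> s)) summable_on UNIV"
    "\<And>t. ((\<lambda>s. \<beta> s * exp (2 * pi * \<i> * (s \<bullet> t))) has_sum f (tensor (\<lambda>i y. u i (y - t $ i)))) UNIV"
proof -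
  obtain C n where C: "C \<ge> 0" and growth:
    "\<And>R F. R \<ge> 1 \<Longrightarrow> finite F \<Longrightarrow> F \<subseteq> cball 0 R \<Longrightarrow> (\<Sum>s\<in>F. cmod (\<mu> {s})) \<le> C * R ^ n"
    using tempered_variation_growth[OF \<mu>] by blast
  \<comment> \<open>The reflected transform, chosen so that by inversion its own transform is
    \<open>u i\<close>.\<close>
  define v where "v i y = fourier1 (u i) (- y)" for i y
  have v: "schwartz1 (v i)" for i
    unfolding v_def by (rule schwartz1_reflect[OF schwartz1_fourier1[OF u]])
  have uv: "fourier1 (v i) = u i" for i
    using fourier1_inversion[OF u] by (simp add: v_def[abs_def] fun_eq_iff)
  obtain K where K: "\<And>s. cmod (tensor v s) * (1 + norm s) ^ (n + 2) \<le> K"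
    using tensor_decay[of v "n + 2", OF v] by blast
  have summ: "(\<lambda>s. cmod (\<mu> {s}) * cmod (tensor v s)) summable_on UNIV"
    by (rule growth_imp_weighted_summable[OF _ C growth _ K]) auto
  define \<beta> where "\<beta> s = \<mu> {s} * tensor v s" for s
  have \<beta>: "(\<lambda>s. cmod (\<beta> s)) summable_on UNIV" using summ by (simp add: \<beta>_def norm_mult)
  obtain \<kappa> :: "real \<Rightarrow> real" where \<kappa>: "smooth1 (\<lambda>x. of_real (\<kappa> x))" "\<And>x. 0 \<le> \<kappa> x" "\<And>x. \<kappa> x \<le> 1"
    "\<And>x. \<bar>x\<bar> \<le> 1 \<Longrightarrow> \<kappa> x = 1" "\<And>x. \<bar>x\<bar> \<ge> 2 \<Longrightarrow> \<kappa> x = 0"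
    using smooth_cutoff_exists by metis
  have t\<kappa>: "test1 (\<lambda>x. of_real (\<kappa> x))"
    using \<kappa> unfolding test1_def by (intro conjI exI[of _ 2]) auto
  \<comment> \<open>Cutoff minus 1: it vanishes near 0, and its dilate times \<open>V i\<close> is
    the truncation error at scale R, to which the 1/R estimates apply.\<close>
  define \<eta> where "\<eta> x = complex_of_real (\<kappa> x) + (-1)" for x
  have b\<eta>: "bounded_derivs1 \<eta>"
    unfolding bounded_derivs1_def
  proof (intro conjI allI)
    show "smooth1 \<eta>" unfolding \<eta>_def[abs_def] by (intro smooth1_add \<kappa> smooth1_const)
    fix b
    obtain D where D: "\<And>x. cmod ((vderiv ^^ b) (\<lambda>x. of_real (\<kappa> x)) x) \<le> D"
      using schwartz1_bounded_derivs1[OF test1_schwartz1[OF t\<kappa>]] unfolding bounded_derivs1_def by blast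
    have c: "(vderiv ^^ b) (\<lambda>x. -1) = (\<lambda>x. if b = 0 then -1 else 0)"
      by (induction b) (auto simp: vderiv_const)
    have "cmod ((vderiv ^^ b) \<eta> x) \<le> D + 1" for x
      unfolding \<eta>_def[abs_def] vderiv_pow_add[OF \<kappa>(1) smooth1_const] c
      by (rule order.trans[OF norm_triangle_ineq add_mono[OF D]]) simp
    then show "\<exists>D. \<forall>x. cmod ((vderiv ^^ b) \<eta> x) \<le> D" by blast
  qed
  have z\<eta>: "\<eta> x = 0" if "\<bar>x\<bar> < 1" for x using that \<kappa>(4)[of x] by (simp add: \<eta>_def)
  show ?thesis
  proof (rule that[OF \<beta>])
    fix t :: "real ^ 'd"
    \<comment> \<open>Modulating \<open>v\<close> by the frequency t translates its transform by t
      and leaves the modulus unchanged, so the summability of \<open>\<beta>\<close> serves every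
      t.\<close>
    define V where "V i x = exp (2 * complex_of_real pi * \<i> * of_real (t $ i) * of_real x) * v i x" for i x
    have V: "schwartz1 (V i)" for i
      unfolding V_def[abs_def] by (intro schwartz1_bounded_mult bounded_derivs1_exp v) simp
    have FV: "fourier1 (V i) = (\<lambda>y. u i (y - t $ i))" for i
      unfolding V_def[abs_def] by (simp add: fun_eq_iff fourier1_modulate uv)
    define VR where "VR R i x = complex_of_real (\<kappa> (x / R)) * V i x" for R i x
    have VR: "test1 (VR R i)" if R: "R \<ge> 1" for R i
      unfolding test1_def
    proof (intro conjI exI[of _ "2 * R"] allI impI)
      show "smooth1 (VR R i)" unfolding VR_def[abs_def]
        using smooth1_affine(1)[OF \<kappa>(1), of "1 / R" 0] by (intro smooth1_mult schwartz1_smooth1[OF V]) simp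
      show "VR R i x = 0" if "2 * R < \<bar>x\<bar>" for x
        using \<kappa>(5)[of "x / R"] that R by (simp add: VR_def abs_divide field_simps)
    qed
    have dec: "fourier1 (VR R i) = (\<lambda>y. fourier1 (\<lambda>x. \<eta> (x / R) * V i x) y + fourier1 (V i) y)"
      and sE: "schwartz1 (\<lambda>x. \<eta> (x / R) * V i x)" for R i
    proof -
      show s: "schwartz1 (\<lambda>x. \<eta> (x / R) * V i x)"
        using schwartz1_bounded_mult[OF bounded_derivs1_affine[OF b\<eta>, of "1 / R" 0] V[of i]] by simp
      have "VR R i = (\<lambda>x. \<eta> (x / R) * V i x + V i x)" by (simp add: VR_def \<eta>_def fun_eq_iff algebra_simps)
      then show "fourier1 (VR R i) = (\<lambda>y. fourier1 (\<lambda>x. \<eta> (x / R) * V i x) y + fourier1 (V i) y)"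
        using integrable_mult_exp[OF schwartz1_integrable[OF s]] integrable_mult_exp[OF schwartz1_integrable[OF V]]
        by (simp add: fourier1_def fun_eq_iff distrib_right)
    qed
    have lim1: "(\<lambda>n. f (tensor (\<lambda>i. fourier1 (VR (Suc n) i)))) \<longlonglongrightarrow> f (tensor (\<lambda>i. fourier1 (V i)))"
    proof (rule tempered_perturbation[OF f])
      show "tensor (\<lambda>i. fourier1 (V i)) \<in> schwartz_space"
        by (intro tensor_in_schwartz schwartz1_fourier1 V)
      show "tensor (\<lambda>i. fourier1 (VR R i)) \<in> schwartz_space" if "R \<ge> 1" for R
        by (intro tensor_in_schwartz schwartz1_fourier1 test1_schwartz1 VR that)
      fix a b
      show "\<exists>C. \<forall>R\<ge>1. \<forall>x. weight a x * cmod (mderiv b (tensor (\<lambda>i. fourier1 (VR R i))) x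
          - mderiv b (tensor (\<lambda>i. fourier1 (V i))) x) \<le> C / R"
      proof (rule tensor_seminorm_perturbation)
        show "schwartz1 (fourier1 (V i))" for i by (intro schwartz1_fourier1 V)
        show "schwartz1 (fourier1 (VR R i))" if "R \<ge> 1" for R i
          by (intro schwartz1_fourier1 test1_schwartz1 VR that)
        fix i a b
        show "\<exists>C. \<forall>R\<ge>1. \<forall>x. \<bar>x\<bar> ^ a * cmod ((vderiv ^^ b) (fourier1 (VR R i)) x - (vderiv ^^ b) (fourier1 (V i)) x) \<le> C / R"
          unfolding dec vderiv_pow_add[OF smooth1_fourier1[OF sE] smooth1_fourier1[OF V]] add_diff_cancel_right'
          by (rule fourier1_dilated_mult_bound[OF b\<eta> z\<eta> V])
      qed
    qed
    have VRt: "tensor (VR R) \<in> test_functions" if "R \<ge> 1" for R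
      by (intro tensor_in_test_functions VR that)
    have "f (tensor (\<lambda>i. fourier1 (VR R i))) = (LINT s|count_space UNIV. \<mu> {s} * tensor (VR R) s)" if R: "R \<ge> 1" for R
    proof -
      have "fourier (tensor (VR R)) = tensor (\<lambda>i. fourier1 (VR R i))"
        by (intro fourier_tensor test1_schwartz1 VR R)
      then have "f (tensor (\<lambda>i. fourier1 (VR R i))) = fourier_distr f (tensor (VR R))"
        by (simp add: fourier_distr_def)
      also have "\<dots> = complex_measure_integral \<mu> (tensor (VR R))"
        using f\<mu> VRt[OF R] unfolding distr_is_measure_def by blast
      also have "\<dots> = (LINT s|count_space UNIV. \<mu> {s} * tensor (VR R) s)"
        by (rule complex_measure_integral_test[OF \<mu>(1) VRt[OF R]])
      finally show ?thesis .
    qed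
    then have lim1': "(\<lambda>n. LINT s|count_space UNIV. \<mu> {s} * tensor (VR (Suc n)) s) \<longlonglongrightarrow> f (tensor (\<lambda>i. fourier1 (V i)))"
      using lim1 by simp
    have tV: "tensor V s = exp (2 * pi * \<i> * (s \<bullet> t)) * tensor v s" for s
      by (simp add: tensor_def V_def prod.distrib exp_sum[symmetric] inner_vec_def sum_distrib_left mult_ac)
    have e1: "cmod (exp (2 * pi * \<i> * (s \<bullet> t))) = 1" for s by (simp add: norm_exp_eq_Re)
    have tVR: "tensor (VR R) s = of_real (\<Prod>i\<in>UNIV. \<kappa> (s $ i / R)) * tensor V s" for R s
      by (simp add: tensor_def VR_def prod.distrib)
    have int: "integrable (count_space UNIV) (\<lambda>s. \<mu> {s} * tensor V s)"
      unfolding integrable_count_space_iff using summ by (simp add: norm_mult tV e1)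
    have lim2: "(\<lambda>n. LINT s|count_space UNIV. \<mu> {s} * tensor (VR (Suc n)) s) \<longlonglongrightarrow> (LINT s|count_space UNIV. \<mu> {s} * tensor V s)"
    proof (rule integral_dominated_convergence)
      show "integrable (count_space UNIV) (\<lambda>s. cmod (\<mu> {s} * tensor V s))" by (rule integrable_norm[OF int])
      show "AE s in count_space UNIV. (\<lambda>n. \<mu> {s} * tensor (VR (Suc n)) s) \<longlonglongrightarrow> \<mu> {s} * tensor V s"
        unfolding AE_count_space
      proof
        fix s :: "real ^ 'd"
        obtain N :: nat where N: "norm s \<le> N" using real_arch_simple by blast
        \<comment> \<open>For fixed s the truncation is already inactive once the scale exceeds |s|,
          so the sequence is eventually constant.\<close>
        have "\<forall>\<^sub>F n in sequentially. \<mu> {s} * tensor V s = \<mu> {s} * tensor (VR (Suc n)) s"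
          using eventually_ge_at_top[of N]
        proof eventually_elim
          case (elim n)
          have "\<bar>s $ i\<bar> \<le> Suc n" for i using component_le_norm_cart[of s i] N elim by linarith
          then have "\<kappa> (s $ i / real (Suc n)) = 1" for i by (intro \<kappa>) (simp add: abs_divide)
          then show ?case by (simp add: tVR)
        qed
        then show "(\<lambda>n. \<mu> {s} * tensor (VR (Suc n)) s) \<longlonglongrightarrow> \<mu> {s} * tensor V s"
          by (rule Lim_transform_eventually[OF tendsto_const])
      qed
      show "AE s in count_space UNIV. cmod (\<mu> {s} * tensor (VR (Suc n)) s) \<le> cmod (\<mu> {s} * tensor V s)" for n
        unfolding AE_count_space
      proof
        fix s :: "real ^ 'd"
        have "(\<Prod>i\<in>UNIV. \<kappa> (s $ i / real (Suc n))) \<le> 1" by (intro prod_le_1 conjI \<kappa>)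
        moreover have "0 \<le> (\<Prod>i\<in>UNIV. \<kappa> (s $ i / real (Suc n)))" by (intro prod_nonneg ballI \<kappa>)
        ultimately have "cmod (of_real (\<Prod>i\<in>UNIV. \<kappa> (s $ i / real (Suc n)))) * cmod (tensor V s) \<le> 1 * cmod (tensor V s)"
          by (intro mult_right_mono) (simp_all del: of_real_prod)
        then show "cmod (\<mu> {s} * tensor (VR (Suc n)) s) \<le> cmod (\<mu> {s} * tensor V s)"
          unfolding tVR norm_mult by (intro mult_left_mono) auto
      qed
    qed auto
    have "f (tensor (\<lambda>i y. u i (y - t $ i))) = (LINT s|count_space UNIV. \<mu> {s} * tensor V s)"
      using LIMSEQ_unique[OF lim1' lim2] by (simp add: FV)
    then show "((\<lambda>s. \<beta> s * exp (2 * pi * \<i> * (s \<bullet> t))) has_sum f (tensor (\<lambda>i y. u i (y - t $ i)))) UNIV"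
      using has_sum_integral_count_space[OF int] by (simp add: \<beta>_def tV mult_ac)
  qed
qed

section \<open>Almost periodicity\<close>

lemma bounded_sequences_common_subsequence:
  fixes e :: "'s \<Rightarrow> nat \<Rightarrow> complex"
  assumes "finite S" "\<And>s k. cmod (e s k) \<le> B"
  shows "\<exists>\<sigma>. strict_mono \<sigma> \<and> (\<forall>s\<in>S. convergent (\<lambda>k. e s (\<sigma> k)))"
  using assms(1)
proof (induction S)
  case empty
  show ?case by (rule exI[of _ id]) (simp add: strict_mono_def)
next
  case (insert a S)
  then obtain \<sigma> where \<sigma>: "strict_mono \<sigma>" "\<forall>s\<in>S. convergent (\<lambda>k. e s (\<sigma> k))" by blast
  have "bounded (range (\<lambda>k. e a (\<sigma> k)))" using assms(2) by (auto simp: bounded_iff)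
  then obtain l \<tau> where \<tau>: "strict_mono \<tau>" "((\<lambda>k. e a (\<sigma> k)) \<circ> \<tau>) \<longlonglongrightarrow> l"
    using bounded_imp_convergent_subsequence by metis
  show ?case
  proof (intro exI[of _ "\<sigma> \<circ> \<tau>"] conjI ballI)
    show "strict_mono (\<sigma> \<circ> \<tau>)" using \<sigma>(1) \<tau>(1) by (rule strict_mono_o)
    fix s assume "s \<in> insert a S"
    then show "convergent (\<lambda>k. e s ((\<sigma> \<circ> \<tau>) k))"
      using \<tau> \<sigma>(2) convergent_subseq_convergent[of "\<lambda>k. e s (\<sigma> k)" \<tau>]
      by (auto simp: o_def convergent_def)
  qed
qed

lemma has_sum_diff:
  fixes f g :: "'a \<Rightarrow> 'b::real_normed_vector"
  assumes "(f has_sum a) A" "(g has_sum b) A"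
  shows "((\<lambda>x. f x - g x) has_sum (a - b)) A"
  using has_sum_add[OF assms(1), where g = "\<lambda>x. - g x" and b = "- b"] assms(2) by (simp add: has_sum_uminus)

text \<open>A subsequence of \<open>x\<close> makes the translates of \<open>F\<close> uniformly Cauchy; comparing
  \<open>F t = F ((t - x k) + x k)\<close> with \<open>F ((t - x k) + x l)\<close> for fixed \<open>k\<close> and \<open>l \<rightarrow> \<infinity>\<close> gives the claim.\<close>

lemma exponential_sum_vanishing:
  fixes \<beta> :: "'a::real_inner \<Rightarrow> complex" and F :: "'a \<Rightarrow> complex"
  assumes \<beta>: "(\<lambda>s. cmod (\<beta> s)) summable_on UNIV"
    and F: "\<And>t. ((\<lambda>s. \<beta> s * exp (2 * pi * \<i> * (s \<bullet> t))) has_sum F t) UNIV"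
    and x: "\<And>t. (\<lambda>k. F (t + x k)) \<longlonglongrightarrow> 0"
  shows "F t = 0"
proof -
  define e where "e s t = exp (2 * pi * \<i> * complex_of_real (s \<bullet> t))" for s t :: 'a
  have e1: "cmod (e s t) = 1" for s t by (simp add: e_def norm_exp_eq_Re)
  have e_add: "e s (t + t') = e s t * e s t'" for s t t'
    by (simp add: e_def exp_add[symmetric] inner_add_right algebra_simps)
  have "cmod (F t) \<le> 3 * \<epsilon>" if \<epsilon>: "\<epsilon> > 0" for \<epsilon>
  proof -
    \<comment> \<open>The infinitely many frequencies outside \<open>S\<close> carry mass at most
      \<epsilon>/2; only the finitely many in \<open>S\<close> have to be synchronised.\<close>
    obtain S where S: "finite S" "dist (\<Sum>s\<in>S. cmod (\<beta> s)) (\<Sum>\<^sub>\<infinity>s. cmod (\<beta> s)) \<le> \<epsilon> / 2"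
      using infsum_finite_approximation[OF \<beta>, of "\<epsilon> / 2"] \<epsilon> by auto
    have tail: "(\<Sum>\<^sub>\<infinity>s\<in>-S. cmod (\<beta> s)) \<le> \<epsilon> / 2"
    proof -
      have "(\<Sum>\<^sub>\<infinity>s\<in>UNIV - S. cmod (\<beta> s)) = (\<Sum>\<^sub>\<infinity>s. cmod (\<beta> s)) - (\<Sum>\<^sub>\<infinity>s\<in>S. cmod (\<beta> s))"
        by (rule infsum_Diff) (use \<beta> S(1) in auto)
      moreover have "\<bar>(\<Sum>s\<in>S. cmod (\<beta> s)) - (\<Sum>\<^sub>\<infinity>s. cmod (\<beta> s))\<bar> \<le> \<epsilon> / 2"
        using S(2) by (simp add: dist_real_def)
      ultimately show ?thesis using S(1) unfolding Compl_eq_Diff_UNIV by (simp only: infsum_finite)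
    qed
    obtain \<sigma> where \<sigma>: "strict_mono \<sigma>" "\<And>s. s \<in> S \<Longrightarrow> convergent (\<lambda>k. e s (x (\<sigma> k)))"
      using bounded_sequences_common_subsequence[OF S(1), of "\<lambda>s k. e s (x k)" 1] e1 by auto
    \<comment> \<open>The summand 1 keeps the quotient \<epsilon>/M defined when all coefficients in
      \<open>S\<close> vanish.\<close>
    define M where "M = (\<Sum>s\<in>S. cmod (\<beta> s)) + 1"
    have M: "M > 0" unfolding M_def by (simp add: add_nonneg_pos sum_nonneg)
    have "\<exists>k0. \<forall>k\<ge>k0. \<forall>l\<ge>k0. \<forall>s\<in>S. cmod (e s (x (\<sigma> k)) - e s (x (\<sigma> l))) < \<epsilon> / M"
    proof -
      have "\<forall>\<^sub>F k0 in sequentially. \<forall>s\<in>S. \<forall>k\<ge>k0. \<forall>l\<ge>k0. cmod (e s (x (\<sigma> k)) - e s (x (\<sigma> l))) < \<epsilon> / M"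
      proof (rule eventually_ball_finite[OF S(1)], intro ballI)
        fix s assume "s \<in> S"
        then have "Cauchy (\<lambda>k. e s (x (\<sigma> k)))" using \<sigma>(2) convergent_Cauchy by blast
        then obtain k0 where "\<forall>k\<ge>k0. \<forall>l\<ge>k0. cmod (e s (x (\<sigma> k)) - e s (x (\<sigma> l))) < \<epsilon> / M"
          using CauchyD[of _ "\<epsilon> / M"] \<epsilon> M by fastforce
        then show "\<forall>\<^sub>F k0 in sequentially. \<forall>k\<ge>k0. \<forall>l\<ge>k0. cmod (e s (x (\<sigma> k)) - e s (x (\<sigma> l))) < \<epsilon> / M"
          by (intro eventually_sequentiallyI[of k0]) auto
      qed
      then obtain k0 where "\<forall>s\<in>S. \<forall>k\<ge>k0. \<forall>l\<ge>k0. cmod (e s (x (\<sigma> k)) - e s (x (\<sigma> l))) < \<epsilon> / M"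
        by (auto simp only: eventually_sequentially)
      then show ?thesis by (intro exI[of _ k0]) simp
    qed
    then obtain k0 where k0: "\<And>k l s. k \<ge> k0 \<Longrightarrow> l \<ge> k0 \<Longrightarrow> s \<in> S \<Longrightarrow> cmod (e s (x (\<sigma> k)) - e s (x (\<sigma> l))) < \<epsilon> / M"
      by blast
    \<comment> \<open>The frequencies in \<open>S\<close> contribute at most M times \<epsilon>/M,
      the others at most twice their mass. The bound does not involve \<open>y\<close> because |e s
      y| = 1.\<close>
    have near: "cmod (F (y + x (\<sigma> k)) - F (y + x (\<sigma> l))) \<le> 2 * \<epsilon>" if kl: "k \<ge> k0" "l \<ge> k0" for y k l
    proof -
      define h where "h s = \<beta> s * e s (y + x (\<sigma> k)) - \<beta> s * e s (y + x (\<sigma> l))" for s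
      have hs: "(h has_sum (F (y + x (\<sigma> k)) - F (y + x (\<sigma> l)))) UNIV"
        unfolding h_def using F by (intro has_sum_diff) (simp_all add: e_def)
      have h_eq: "cmod (h s) = cmod (\<beta> s) * cmod (e s (x (\<sigma> k)) - e s (x (\<sigma> l)))" for s
      proof -
        have "h s = \<beta> s * e s y * (e s (x (\<sigma> k)) - e s (x (\<sigma> l)))"
          by (simp add: h_def e_add algebra_simps)
        then show ?thesis by (simp add: norm_mult e1)
      qed
      have h2: "cmod (h s) \<le> cmod (\<beta> s) * 2" for s
        unfolding h_eq using norm_triangle_ineq4[of "e s (x (\<sigma> k))" "e s (x (\<sigma> l))"]
        by (intro mult_left_mono) (simp_all add: e1)
      have b2: "(\<lambda>s. cmod (\<beta> s) * 2) summable_on A" for A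
        by (intro summable_on_cmult_left summable_on_subset[OF \<beta>]) simp
      have habs: "(\<lambda>s. cmod (h s)) summable_on A" for A
        by (rule Infinite_Sum.abs_summable_on_comparison_test'[OF b2 h2])
      have "F (y + x (\<sigma> k)) - F (y + x (\<sigma> l)) = infsum h UNIV" using infsumI[OF hs] by simp
      then have "cmod (F (y + x (\<sigma> k)) - F (y + x (\<sigma> l))) \<le> (\<Sum>\<^sub>\<infinity>s. cmod (h s))"
        using norm_infsum_bound[OF habs] by simp
      also have "\<dots> = (\<Sum>\<^sub>\<infinity>s\<in>S. cmod (h s)) + (\<Sum>\<^sub>\<infinity>s\<in>-S. cmod (h s))"
        using infsum_Un_disjoint[OF habs habs, of S "-S"] by (simp add: Compl_partition)
      also have "(\<Sum>\<^sub>\<infinity>s\<in>S. cmod (h s)) \<le> \<epsilon>"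
      proof -
        have "(\<Sum>\<^sub>\<infinity>s\<in>S. cmod (h s)) = (\<Sum>s\<in>S. cmod (h s))" using S(1) by simp
        also have "\<dots> \<le> (\<Sum>s\<in>S. cmod (\<beta> s) * (\<epsilon> / M))"
          unfolding h_eq using k0[OF kl] by (intro sum_mono mult_left_mono) (auto intro: less_imp_le)
        also have "\<dots> = (\<Sum>s\<in>S. cmod (\<beta> s)) * (\<epsilon> / M)" by (rule sum_distrib_right[symmetric])
        also have "\<dots> \<le> M * (\<epsilon> / M)" using \<epsilon> M by (intro mult_right_mono) (auto simp: M_def)
        finally show ?thesis using M by simp
      qed
      also have "(\<Sum>\<^sub>\<infinity>s\<in>-S. cmod (h s)) \<le> (\<Sum>\<^sub>\<infinity>s\<in>-S. cmod (\<beta> s) * 2)"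
        by (rule infsum_mono[OF habs b2 h2])
      also have "\<dots> = (\<Sum>\<^sub>\<infinity>s\<in>-S. cmod (\<beta> s)) * 2"
        by (rule infsum_cmult_left) (rule summable_on_subset[OF \<beta>], simp)
      also have "\<dots> \<le> \<epsilon>" using tail by simp
      finally show ?thesis by simp
    qed
    \<comment> \<open>With base point t - x (\<sigma> k0) the term of index k0 is \<open>F t\<close>
      itself, while the hypothesis on F sends the terms of index l to 0.\<close>
    have "(\<lambda>l. F (t - x (\<sigma> k0) + x (\<sigma> l))) \<longlonglongrightarrow> 0"
      using LIMSEQ_subseq_LIMSEQ[OF x \<sigma>(1)] by (simp add: o_def)
    then have "\<forall>\<^sub>F l in sequentially. cmod (F (t - x (\<sigma> k0) + x (\<sigma> l))) < \<epsilon>"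
      using \<epsilon> by (auto simp: tendsto_iff)
    then have "\<forall>\<^sub>F l in sequentially. cmod (F (t - x (\<sigma> k0) + x (\<sigma> l))) < \<epsilon> \<and> l \<ge> k0"
      using eventually_ge_at_top by (rule eventually_conj)
    then obtain l where l: "cmod (F (t - x (\<sigma> k0) + x (\<sigma> l))) < \<epsilon>" "l \<ge> k0"
      using eventually_happens by fastforce
    show ?thesis
      using near[of k0 l "t - x (\<sigma> k0)"] l norm_triangle_sub[of "F t" "F (t - x (\<sigma> k0) + x (\<sigma> l))"] by simp
  qed
  then have "cmod (F t) \<le> 0 + \<delta>" if "\<delta> > 0" for \<delta>
    using that by (metis add_0 mult.commute nonzero_divide_eq_eq zero_less_divide_iff zero_less_numeral zero_neq_numeral)
  then have "cmod (F t) \<le> 0" by (rule field_le_epsilon)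
  then show ?thesis by simp
qed

section \<open>Matched coefficients far out\<close>

lemma summable_times_bounded:
  fixes p \<psi> :: "'a \<Rightarrow> complex"
  assumes "(\<lambda>s. cmod (p s)) summable_on L" "\<And>s. cmod (\<psi> s) \<le> B"
  shows "(\<lambda>s. cmod (p s * \<psi> s)) summable_on L"
  by (rule Infinite_Sum.abs_summable_on_comparison_test'[OF summable_on_cmult_left[OF assms(1), of B]])
     (auto simp: norm_mult intro!: mult_left_mono assms(2))

text \<open>The sets \<open>L\<close> are not assumed bounded: finitely many of the sets of the theorem may be
  unbounded, and their contribution vanishes because the coefficients are summable.\<close>

lemma escaping_sum_tendsto_0:
  fixes p \<psi> :: "'a::real_normed_vector \<Rightarrow> complex" and y :: "nat \<Rightarrow> 'a"
  assumes p: "(\<lambda>s. cmod (p s)) summable_on L"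
    and \<psi>: "\<And>z. cmod (\<psi> z) \<le> B" "\<And>z. \<rho> \<le> norm z \<Longrightarrow> \<psi> z = 0"
    and y: "filterlim y at_infinity sequentially"
  shows "(\<lambda>k. \<Sum>\<^sub>\<infinity>s\<in>L. p s * \<psi> (s - y k)) \<longlonglongrightarrow> 0"
proof (rule LIMSEQ_I)
  fix \<epsilon> :: real assume \<epsilon>: "\<epsilon> > 0"
  have B: "B \<ge> 0" using order.trans[OF norm_ge_zero \<psi>(1)[of 0]] .
  define \<delta> where "\<delta> = \<epsilon> / (B + 1)"
  have \<delta>: "\<delta> > 0" using \<epsilon> B by (simp add: \<delta>_def)
  obtain X where X: "finite X" "X \<subseteq> L" "dist (\<Sum>s\<in>X. cmod (p s)) (\<Sum>\<^sub>\<infinity>s\<in>L. cmod (p s)) \<le> \<delta>"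
    using infsum_finite_approximation[OF p \<delta>] by blast
  have tail: "(\<Sum>\<^sub>\<infinity>s\<in>L - X. cmod (p s)) \<le> \<delta>"
  proof -
    have "(\<Sum>\<^sub>\<infinity>s\<in>L - X. cmod (p s)) = (\<Sum>\<^sub>\<infinity>s\<in>L. cmod (p s)) - (\<Sum>\<^sub>\<infinity>s\<in>X. cmod (p s))"
      by (rule infsum_Diff) (use p X in auto)
    then show ?thesis using X by (simp add: dist_real_def)
  qed
  \<comment> \<open>The finite set \<open>X\<close> is left behind: from some k on the translated
    \<open>\<psi>\<close> vanishes on it, and only the tail of the coefficients remains.\<close>
  have "\<forall>\<^sub>F k in sequentially. \<forall>s\<in>X. \<rho> + norm s \<le> norm (y k)"
    using y X(1) by (intro eventually_ball_finite) (auto simp: filterlim_at_infinity_conv_norm_at_top filterlim_at_top)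
  then have "\<forall>\<^sub>F k in sequentially. norm ((\<Sum>\<^sub>\<infinity>s\<in>L. p s * \<psi> (s - y k)) - 0) < \<epsilon>"
  proof eventually_elim
    case (elim k)
    have z: "\<psi> (s - y k) = 0" if "s \<in> X" for s
    proof (rule \<psi>(2))
      have "norm (y k) - norm s \<le> norm (s - y k)" by (metis norm_minus_commute norm_triangle_ineq2)
      then show "\<rho> \<le> norm (s - y k)" using elim that by fastforce
    qed
    have p': "(\<lambda>s. cmod (p s)) summable_on (L - X)" by (rule summable_on_subset[OF p]) auto
    have a: "(\<lambda>s. cmod (p s * \<psi> (s - y k))) summable_on (L - X)"
      by (rule summable_times_bounded[OF p' \<psi>(1)])
    have "(\<Sum>\<^sub>\<infinity>s\<in>L. p s * \<psi> (s - y k)) = (\<Sum>\<^sub>\<infinity>s\<in>L - X. p s * \<psi> (s - y k))"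
      by (rule infsum_cong_neutral) (auto simp: z)
    then have "cmod (\<Sum>\<^sub>\<infinity>s\<in>L. p s * \<psi> (s - y k)) \<le> (\<Sum>\<^sub>\<infinity>s\<in>L - X. cmod (p s * \<psi> (s - y k)))"
      using norm_infsum_bound[OF a] by simp
    also have "\<dots> \<le> (\<Sum>\<^sub>\<infinity>s\<in>L - X. cmod (p s) * B)"
      by (rule infsum_mono[OF a summable_on_cmult_left[OF p']]) (auto simp: norm_mult intro!: mult_left_mono \<psi>)
    also have "\<dots> = (\<Sum>\<^sub>\<infinity>s\<in>L - X. cmod (p s)) * B" by (rule infsum_cmult_left) (rule p')
    also have "\<dots> \<le> \<delta> * B" by (rule mult_right_mono[OF tail B])
    also have "\<dots> < \<epsilon>" using \<epsilon> B by (simp add: \<delta>_def field_simps)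
    finally show ?case by simp
  qed
  then show "\<exists>no. \<forall>n\<ge>no. norm ((\<Sum>\<^sub>\<infinity>s\<in>L. p s * \<psi> (s - y n)) - 0) < \<epsilon>"
    by (simp add: eventually_sequentially)
qed

text \<open>Replacing \<open>\<psi>\<close> by the constant \<open>c\<close> costs at most
  \<open>\<epsilon>\<close> per unit of coefficient mass. This links weighted sums to the plain
  coefficient sums that hypothesis (iv) compares.\<close>

lemma clustered_sum_near:
  fixes p \<psi> :: "'a \<Rightarrow> complex"
  assumes p: "(\<lambda>s. cmod (p s)) summable_on L" and \<psi>: "\<And>s. s \<in> L \<Longrightarrow> cmod (\<psi> s - c) \<le> \<epsilon>"
  shows "cmod ((\<Sum>\<^sub>\<infinity>s\<in>L. p s * \<psi> s) - c * (\<Sum>\<^sub>\<infinity>s\<in>L. p s)) \<le> \<epsilon> * (\<Sum>\<^sub>\<infinity>s\<in>L. cmod (p s))"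
proof -
  have a: "(\<lambda>s. cmod (p s * (\<psi> s - c))) summable_on L"
    by (rule Infinite_Sum.abs_summable_on_comparison_test'[OF summable_on_cmult_left[OF p, of \<epsilon>]])
       (auto simp: norm_mult intro!: mult_left_mono \<psi>)
  have p1: "p summable_on L" by (rule abs_summable_summable[OF p])
  have "(\<Sum>\<^sub>\<infinity>s\<in>L. p s * \<psi> s) = (\<Sum>\<^sub>\<infinity>s\<in>L. p s * (\<psi> s - c) + p s * c)"
    by (simp add: algebra_simps)
  also have "\<dots> = (\<Sum>\<^sub>\<infinity>s\<in>L. p s * (\<psi> s - c)) + (\<Sum>\<^sub>\<infinity>s\<in>L. p s * c)"
    by (intro infsum_add abs_summable_summable[OF a] summable_on_cmult_left p1)
  also have "(\<Sum>\<^sub>\<infinity>s\<in>L. p s * c) = (\<Sum>\<^sub>\<infinity>s\<in>L. p s) * c" by (rule infsum_cmult_left) (rule p1)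
  finally have "(\<Sum>\<^sub>\<infinity>s\<in>L. p s * \<psi> s) - c * (\<Sum>\<^sub>\<infinity>s\<in>L. p s) = (\<Sum>\<^sub>\<infinity>s\<in>L. p s * (\<psi> s - c))"
    by simp
  also have "cmod \<dots> \<le> (\<Sum>\<^sub>\<infinity>s\<in>L. cmod (p s * (\<psi> s - c)))" by (rule norm_infsum_bound[OF a])
  also have "\<dots> \<le> (\<Sum>\<^sub>\<infinity>s\<in>L. cmod (p s) * \<epsilon>)"
    by (rule infsum_mono[OF a summable_on_cmult_left[OF p]]) (auto simp: norm_mult intro!: mult_left_mono \<psi>)
  also have "\<dots> = (\<Sum>\<^sub>\<infinity>s\<in>L. cmod (p s)) * \<epsilon>" by (rule infsum_cmult_left) (rule p)
  finally show ?thesis by (simp add: mult.commute)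
qed

section \<open>Compactly supported continuous weights on shrinking clusters\<close>

lemma compactly_supported_bounded:
  fixes \<psi> :: "'a::euclidean_space \<Rightarrow> complex"
  assumes "continuous_on UNIV \<psi>" "\<And>z. \<rho> \<le> norm z \<Longrightarrow> \<psi> z = 0"
  obtains B where "\<And>z. cmod (\<psi> z) \<le> B"
proof -
  have "compact (\<psi> ` cball 0 \<rho>)"
    by (rule compact_continuous_image[OF continuous_on_subset[OF assms(1)]]) auto
  then obtain B where B: "B > 0" "\<And>z. z \<in> cball 0 \<rho> \<Longrightarrow> cmod (\<psi> z) \<le> B"
    using compact_imp_bounded[of "\<psi> ` cball 0 \<rho>"] unfolding bounded_pos by (metis imageI)
  have "cmod (\<psi> z) \<le> B" for z
    using B assms(2)[of z] by (cases "\<rho> \<le> norm z") auto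
  then show ?thesis by (rule that)
qed

text \<open>The ball is enlarged by 1 and distances are kept below 1: then either both points lie in
  the larger ball, where compactness applies, or both lie outside the support.\<close>

lemma compactly_supported_uniformly_continuous:
  fixes \<psi> :: "'a::euclidean_space \<Rightarrow> complex"
  assumes c: "continuous_on UNIV \<psi>" and z: "\<And>z. \<rho> \<le> norm z \<Longrightarrow> \<psi> z = 0" and \<epsilon>: "\<epsilon> > 0"
  obtains \<delta> where "\<delta> > 0" "\<And>z z'. dist z z' < \<delta> \<Longrightarrow> cmod (\<psi> z - \<psi> z') \<le> \<epsilon>"
proof -
  have "uniformly_continuous_on (cball 0 (\<rho> + 1)) \<psi>"
    by (rule compact_uniformly_continuous[OF continuous_on_subset[OF c]]) auto
  then obtain \<delta> where \<delta>: "\<delta> > 0" "\<And>z z'. z \<in> cball 0 (\<rho> + 1) \<Longrightarrow> z' \<in> cball 0 (\<rho> + 1) \<Longrightarrow> dist z' z < \<delta> \<Longrightarrow> dist (\<psi> z') (\<psi> z) < \<epsilon>"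
    unfolding uniformly_continuous_on_def using \<epsilon> by metis
  have "cmod (\<psi> z - \<psi> z') \<le> \<epsilon>" if d: "dist z z' < min \<delta> 1" for z z'
  proof (cases "norm z \<le> \<rho> + 1 \<and> norm z' \<le> \<rho> + 1")
    case True
    then show ?thesis using \<delta>(2)[of z' z] d by (simp add: dist_norm less_imp_le)
  next
    case False
    have "norm z \<le> norm z' + dist z z'" "norm z' \<le> norm z + dist z z'"
      by (metis dist_norm norm_triangle_sub, metis dist_norm norm_triangle_sub norm_minus_commute)
    then have "\<rho> \<le> norm z" "\<rho> \<le> norm z'" using False d by auto
    then show ?thesis using z \<epsilon> by simp
  qed
  then show ?thesis using \<delta>(1) that[of "min \<delta> 1"] by simp
qed

text \<open>The clusters have small diameter and the modulus of continuity of \<open>\<psi>\<close>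
  is invariant under translation, so on each late cluster \<open>\<psi>\<close> is nearly its value
  \<open>c\<close> at one point, for all \<open>y\<close> simultaneously. Both sums are then close
  to \<open>c\<close> times their plain sums, which match. Boundedness is assumed because
  \<open>diameter\<close> controls distances only in bounded sets.\<close>

lemma matched_sums_uniformly_small:
  fixes p q \<psi> :: "'a::euclidean_space \<Rightarrow> complex" and Ls Gs :: "nat \<Rightarrow> 'a set"
  assumes \<psi>: "continuous_on UNIV \<psi>" "\<And>z. \<rho> \<le> norm z \<Longrightarrow> \<psi> z = 0"
    and bd: "\<forall>\<^sub>F n in sequentially. bounded (Ls n \<union> Gs n)"
    and diam: "(\<lambda>n. diameter (Ls n \<union> Gs n)) \<longlonglongrightarrow> 0"
    and match: "(\<lambda>n. (\<Sum>\<^sub>\<infinity>s\<in>Ls n. p s) - (\<Sum>\<^sub>\<infinity>t\<in>Gs n. q t)) \<longlonglongrightarrow> 0"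
    and p: "\<And>n. (\<lambda>s. cmod (p s)) summable_on Ls n" "\<And>n. (\<Sum>\<^sub>\<infinity>s\<in>Ls n. cmod (p s)) \<le> K"
    and q: "\<And>n. (\<lambda>s. cmod (q s)) summable_on Gs n" "\<And>n. (\<Sum>\<^sub>\<infinity>s\<in>Gs n. cmod (q s)) \<le> K"
    and \<epsilon>: "\<epsilon> > 0"
  shows "\<forall>\<^sub>F n in sequentially. \<forall>y. cmod ((\<Sum>\<^sub>\<infinity>s\<in>Ls n. p s * \<psi> (s - y)) - (\<Sum>\<^sub>\<infinity>t\<in>Gs n. q t * \<psi> (t - y))) \<le> \<epsilon>"
proof -
  obtain B where B: "\<And>z. cmod (\<psi> z) \<le> B" using compactly_supported_bounded[OF \<psi>] by blast
  have B0: "B \<ge> 0" using order.trans[OF norm_ge_zero B[of 0]] .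
  have K0: "K \<ge> 0" using order.trans[OF infsum_nonneg p(2)[of 0]] by simp
  \<comment> \<open>One third of \<open>\<epsilon>\<close> for each of the two oscillation errors
    and one for the mismatch of the plain sums; adding 1 to \<open>K\<close> and \<open>B\<close>
    guards against division by 0.\<close>
  define \<epsilon>1 where "\<epsilon>1 = \<epsilon> / (3 * (K + 1))"
  define \<epsilon>2 where "\<epsilon>2 = \<epsilon> / (3 * (B + 1))"
  have \<epsilon>1: "\<epsilon>1 > 0" "\<epsilon>1 * K \<le> \<epsilon> / 3" using \<epsilon> K0 by (auto simp: \<epsilon>1_def field_simps)
  have \<epsilon>2: "\<epsilon>2 > 0" "B * \<epsilon>2 \<le> \<epsilon> / 3" using \<epsilon> B0 by (auto simp: \<epsilon>2_def field_simps)
  obtain \<delta> where \<delta>: "\<delta> > 0" "\<And>z z'. dist z z' < \<delta> \<Longrightarrow> cmod (\<psi> z - \<psi> z') \<le> \<epsilon>1"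
    using compactly_supported_uniformly_continuous[OF \<psi> \<epsilon>1(1)] by blast
  have e1: "\<forall>\<^sub>F n in sequentially. diameter (Ls n \<union> Gs n) < \<delta>"
    using diam \<delta>(1) by (rule order_tendstoD(2))
  have e2: "\<forall>\<^sub>F n in sequentially. cmod ((\<Sum>\<^sub>\<infinity>s\<in>Ls n. p s) - (\<Sum>\<^sub>\<infinity>t\<in>Gs n. q t)) < \<epsilon>2"
    using match \<epsilon>2(1) by (simp add: tendsto_iff)
  from bd e1 e2 show ?thesis
  proof (eventually_elim, intro allI)
    case (elim n)
    fix y
    show "cmod ((\<Sum>\<^sub>\<infinity>s\<in>Ls n. p s * \<psi> (s - y)) - (\<Sum>\<^sub>\<infinity>t\<in>Gs n. q t * \<psi> (t - y))) \<le> \<epsilon>"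
    proof (cases "Ls n \<union> Gs n = {}")
      case True
      then show ?thesis using \<epsilon> by simp
    next
      case False
      then obtain s0 where s0: "s0 \<in> Ls n \<union> Gs n" by blast
      define c where "c = \<psi> (s0 - y)"
      have near: "cmod (\<psi> (s - y) - c) \<le> \<epsilon>1" if "s \<in> Ls n \<union> Gs n" for s
        unfolding c_def
      proof (rule \<delta>(2))
        have "dist s s0 \<le> diameter (Ls n \<union> Gs n)"
          using diameter_bounded_bound[OF elim(1) that s0] .
        then show "dist (s - y) (s0 - y) < \<delta>" using elim(2) by (simp add: dist_norm)
      qed
      define P where "P = (\<Sum>\<^sub>\<infinity>s\<in>Ls n. p s * \<psi> (s - y))"
      define Q where "Q = (\<Sum>\<^sub>\<infinity>t\<in>Gs n. q t * \<psi> (t - y))"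
      define P' where "P' = (\<Sum>\<^sub>\<infinity>s\<in>Ls n. p s)"
      define Q' where "Q' = (\<Sum>\<^sub>\<infinity>t\<in>Gs n. q t)"
      have 1: "cmod (P - c * P') \<le> \<epsilon> / 3"
        unfolding P_def P'_def
        by (rule order.trans[OF clustered_sum_near[OF p(1), of n "\<lambda>s. \<psi> (s - y)" c \<epsilon>1]])
           (use near \<epsilon>1 p(2)[of n] order.trans[OF mult_left_mono[OF p(2)[of n], of \<epsilon>1] \<epsilon>1(2)] in auto)
      have 2: "cmod (Q - c * Q') \<le> \<epsilon> / 3"
        unfolding Q_def Q'_def
        by (rule order.trans[OF clustered_sum_near[OF q(1), of n "\<lambda>s. \<psi> (s - y)" c \<epsilon>1]])
           (use near \<epsilon>1 q(2)[of n] order.trans[OF mult_left_mono[OF q(2)[of n], of \<epsilon>1] \<epsilon>1(2)] in auto)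
      have "cmod (c * (P' - Q')) \<le> B * \<epsilon>2"
        unfolding norm_mult using elim(3) B[of "s0 - y"] B0
        by (intro mult_mono) (auto simp: c_def P'_def Q'_def)
      then have 3: "cmod (c * (P' - Q')) \<le> \<epsilon> / 3" using \<epsilon>2(2) by simp
      have eq: "P - Q = (P - c * P') - (Q - c * Q') + c * (P' - Q')" by (simp add: algebra_simps)
      have "cmod (P - Q) \<le> cmod (P - c * P') + cmod (Q - c * Q') + cmod (c * (P' - Q'))"
        unfolding eq using norm_triangle_ineq[of "(P - c * P') - (Q - c * Q')" "c * (P' - Q')"]
          norm_triangle_ineq4[of "P - c * P'" "Q - c * Q'"] by linarith
      also have "\<dots> \<le> \<epsilon>" using 1 2 3 by simp
      finally show ?thesis unfolding P_def Q_def .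
    qed
  qed
qed

section \<open>Grouping a series into clusters\<close>

lemma has_sum_finite_sum:
  fixes f :: "'j \<Rightarrow> 'a \<Rightarrow> 'b::topological_comm_monoid_add"
  assumes "finite J" "\<And>j. j \<in> J \<Longrightarrow> (f j has_sum S j) A"
  shows "((\<lambda>s. \<Sum>j\<in>J. f j s) has_sum (\<Sum>j\<in>J. S j)) A"
  using assms by induction (auto intro: has_sum_add has_sum_0)

text \<open>The support of the translated \<open>\<psi>\<close> lies inside E, where L is
  partitioned by the clusters, and only clusters indexed by I can reach it; every other term is 0. A
  cluster that protrudes from the ball is still summed in full, which costs nothing because the
  weight vanishes there.\<close>

lemma localized_series_decomposition:
  fixes p \<psi> :: "'j \<Rightarrow> 'a::real_normed_vector \<Rightarrow> complex"
  assumes J: "finite J" and \<psi>: "\<And>j z. j \<in> J \<Longrightarrow> cmod (\<psi> j z) \<le> B j" "\<And>j z. j \<in> J \<Longrightarrow> \<rho> \<le> norm z \<Longrightarrow> \<psi> j z = 0"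
    and disj: "disjoint_family Ls" and L: "L \<inter> E = (\<Union>n. Ls n)"
    and p: "\<And>j n. j \<in> J \<Longrightarrow> (\<lambda>s. cmod (p j s)) summable_on Ls n"
    and E: "cball y \<rho> \<subseteq> E" and I: "finite I" "\<And>n. Ls n \<inter> ball y \<rho> \<noteq> {} \<Longrightarrow> n \<in> I"
    and S: "((\<lambda>s. \<Sum>j\<in>J. p j s * \<psi> j (s - y)) has_sum S) L"
  shows "S = (\<Sum>n\<in>I. \<Sum>j\<in>J. \<Sum>\<^sub>\<infinity>s\<in>Ls n. p j s * \<psi> j (s - y))"
proof -
  have "((\<lambda>s. \<Sum>j\<in>J. p j s * \<psi> j (s - y)) has_sum (\<Sum>n\<in>I. \<Sum>j\<in>J. \<Sum>\<^sub>\<infinity>s\<in>Ls n. p j s * \<psi> j (s - y))) (\<Union>n\<in>I. Ls n)"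
  proof (rule sum_has_sum[OF I(1)])
    show "((\<lambda>s. \<Sum>j\<in>J. p j s * \<psi> j (s - y)) has_sum (\<Sum>j\<in>J. \<Sum>\<^sub>\<infinity>s\<in>Ls n. p j s * \<psi> j (s - y))) (Ls n)" for n
    proof (rule has_sum_finite_sum[OF J])
      fix j assume j: "j \<in> J"
      have "(\<lambda>s. cmod (p j s * \<psi> j (s - y))) summable_on Ls n"
        by (rule summable_times_bounded[OF p[OF j] \<psi>(1)[OF j]])
      then show "((\<lambda>s. p j s * \<psi> j (s - y)) has_sum (\<Sum>\<^sub>\<infinity>s\<in>Ls n. p j s * \<psi> j (s - y))) (Ls n)"
        by (rule has_sum_infsum[OF abs_summable_summable])
    qed
    show "Ls n \<inter> Ls n' = {}" if "n \<noteq> n'" for n n'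
      using disj that by (auto simp: disjoint_family_on_def)
  qed
  also have "?this \<longleftrightarrow> ((\<lambda>s. \<Sum>j\<in>J. p j s * \<psi> j (s - y)) has_sum (\<Sum>n\<in>I. \<Sum>j\<in>J. \<Sum>\<^sub>\<infinity>s\<in>Ls n. p j s * \<psi> j (s - y))) L"
  proof (rule has_sum_cong_neutral)
    fix s assume s: "s \<in> L - (\<Union>n\<in>I. Ls n)"
    have "\<rho> \<le> norm (s - y)"
    proof (rule ccontr)
      assume "\<not> \<rho> \<le> norm (s - y)"
      then have sb: "s \<in> ball y \<rho>" by (simp add: dist_norm norm_minus_commute)
      then obtain n where "s \<in> Ls n" using s L E by fastforce
      then show False using sb I(2)[of n] s by blast
    qed
    then show "(\<Sum>j\<in>J. p j s * \<psi> j (s - y)) = 0" using \<psi>(2) by (intro sum.neutral) auto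
  qed (use L in auto)
  finally show ?thesis by (rule infsumI[OF S, symmetric, THEN trans, OF infsumI])
qed

text \<open>The clusters are split at an index n0. Those from n0 on are uniformly small, and the
  number meeting the ball is bounded independently of k; each of the finitely many earlier ones is a
  fixed summable family from which \<open>y k\<close> moves away.\<close>

lemma matched_series_difference_tendsto_0:
  fixes p q \<psi> :: "'j \<Rightarrow> 'a::euclidean_space \<Rightarrow> complex" and Ls Gs :: "nat \<Rightarrow> 'a set" and y :: "nat \<Rightarrow> 'a"
  assumes J: "finite J" and \<psi>: "\<And>j. j \<in> J \<Longrightarrow> continuous_on UNIV (\<psi> j)"
      "\<And>j z. j \<in> J \<Longrightarrow> \<rho> \<le> norm z \<Longrightarrow> \<psi> j z = 0"
    and disj: "disjoint_family Ls" "disjoint_family Gs"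
    and ii: "L \<inter> E = (\<Union>n. Ls n)" "G \<inter> E = (\<Union>n. Gs n)"
    and iii: "\<And>y. y \<in> E \<Longrightarrow> finite {n. (Ls n \<union> Gs n) \<inter> ball y 1 \<noteq> {}}"
      "\<And>y. y \<in> E \<Longrightarrow> card {n. (Ls n \<union> Gs n) \<inter> ball y 1 \<noteq> {}} \<le> N"
    and bd: "\<forall>\<^sub>F n in sequentially. bounded (Ls n \<union> Gs n)"
    and diam: "(\<lambda>n. diameter (Ls n \<union> Gs n)) \<longlonglongrightarrow> 0"
    and match: "\<And>j. j \<in> J \<Longrightarrow> (\<lambda>n. (\<Sum>\<^sub>\<infinity>s\<in>Ls n. p j s) - (\<Sum>\<^sub>\<infinity>t\<in>Gs n. q j t)) \<longlonglongrightarrow> 0"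
    and p: "\<And>j n. j \<in> J \<Longrightarrow> (\<lambda>s. cmod (p j s)) summable_on Ls n" "\<And>j n. j \<in> J \<Longrightarrow> (\<Sum>\<^sub>\<infinity>s\<in>Ls n. cmod (p j s)) \<le> K"
    and q: "\<And>j n. j \<in> J \<Longrightarrow> (\<lambda>s. cmod (q j s)) summable_on Gs n" "\<And>j n. j \<in> J \<Longrightarrow> (\<Sum>\<^sub>\<infinity>s\<in>Gs n. cmod (q j s)) \<le> K"
    and y: "filterlim y at_infinity sequentially" "\<forall>\<^sub>F k in sequentially. cball (y k) \<rho> \<subseteq> E"
    and S: "\<And>k. ((\<lambda>s. \<Sum>j\<in>J. p j s * \<psi> j (s - y k)) has_sum S k) L"
      "\<And>k. ((\<lambda>s. \<Sum>j\<in>J. q j s * \<psi> j (s - y k)) has_sum T k) G"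
  shows "(\<lambda>k. S k - T k) \<longlonglongrightarrow> 0"
proof (rule LIMSEQ_I)
  fix \<epsilon> :: real assume \<epsilon>: "\<epsilon> > 0"
  have "\<exists>B. \<forall>j. j \<in> J \<longrightarrow> (\<forall>z. cmod (\<psi> j z) \<le> B j)"
    by (rule choice) (use compactly_supported_bounded[OF \<psi>] in metis)
  then obtain B where B: "\<And>j z. j \<in> J \<Longrightarrow> cmod (\<psi> j z) \<le> B j" by blast
  \<comment> \<open>Hypothesis (iii) counts clusters in unit balls centred in E. A finite set of
    centres, chosen inside the closed ball so that its translates stay in E, transfers the count to
    radius \<open>\<rho>\<close>.\<close>
  obtain Z :: "'a set" where Z: "finite Z" "Z \<subseteq> cball 0 \<rho>" "cball 0 \<rho> \<subseteq> (\<Union>z\<in>Z. ball z 1)"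
    using seq_compact_imp_totally_bounded[of "cball 0 \<rho> :: 'a set"] compact_imp_seq_compact[OF compact_cball] zero_less_one
    by metis
  define I where "I k = {n. (Ls n \<union> Gs n) \<inter> ball (y k) \<rho> \<noteq> {}}" for k
  define d where "d j n k = (\<Sum>\<^sub>\<infinity>s\<in>Ls n. p j s * \<psi> j (s - y k)) - (\<Sum>\<^sub>\<infinity>t\<in>Gs n. q j t * \<psi> j (t - y k))" for j n k
  have I: "finite (I k)" "card (I k) \<le> card Z * N" if k: "cball (y k) \<rho> \<subseteq> E" for k
  proof -
    have zE: "y k + z \<in> E" if "z \<in> Z" for z
      using that Z(2) k by (auto simp: dist_norm subset_iff)
    have sub: "I k \<subseteq> (\<Union>z\<in>Z. {n. (Ls n \<union> Gs n) \<inter> ball (y k + z) 1 \<noteq> {}})"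
    proof
      fix n assume "n \<in> I k"
      then obtain s where s: "s \<in> Ls n \<union> Gs n" "s \<in> ball (y k) \<rho>" unfolding I_def by blast
      then have "s - y k \<in> cball 0 \<rho>" by (simp add: dist_norm norm_minus_commute)
      then obtain z where z: "z \<in> Z" "s - y k \<in> ball z 1" using Z(3) by blast
      then have "s \<in> ball (y k + z) 1" by (simp add: dist_norm algebra_simps)
      then show "n \<in> (\<Union>z\<in>Z. {n. (Ls n \<union> Gs n) \<inter> ball (y k + z) 1 \<noteq> {}})" using z(1) s(1) by blast
    qed
    have fin: "finite (\<Union>z\<in>Z. {n. (Ls n \<union> Gs n) \<inter> ball (y k + z) 1 \<noteq> {}})"
      using Z(1) iii(1)[OF zE] by blast
    show "finite (I k)" by (rule finite_subset[OF sub fin])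
    have "card (I k) \<le> card (\<Union>z\<in>Z. {n. (Ls n \<union> Gs n) \<inter> ball (y k + z) 1 \<noteq> {}})"
      by (rule card_mono[OF fin sub])
    also have "\<dots> \<le> (\<Sum>z\<in>Z. card {n. (Ls n \<union> Gs n) \<inter> ball (y k + z) 1 \<noteq> {}})"
      by (rule card_UN_le[OF Z(1)])
    also have "\<dots> \<le> (\<Sum>z\<in>Z. N)" by (intro sum_mono iii(2) zE)
    finally show "card (I k) \<le> card Z * N" by simp
  qed
  have dec: "S k - T k = (\<Sum>n\<in>I k. \<Sum>j\<in>J. d j n k)" if k: "cball (y k) \<rho> \<subseteq> E" for k
  proof -
    have "S k = (\<Sum>n\<in>I k. \<Sum>j\<in>J. \<Sum>\<^sub>\<infinity>s\<in>Ls n. p j s * \<psi> j (s - y k))"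
      by (rule localized_series_decomposition[OF J B \<psi>(2) disj(1) ii(1) p(1) k I(1)[OF k] _ S(1)])
         (auto simp: I_def)
    moreover have "T k = (\<Sum>n\<in>I k. \<Sum>j\<in>J. \<Sum>\<^sub>\<infinity>s\<in>Gs n. q j s * \<psi> j (s - y k))"
      by (rule localized_series_decomposition[OF J B \<psi>(2) disj(2) ii(2) q(1) k I(1)[OF k] _ S(2)])
         (auto simp: I_def)
    ultimately show ?thesis by (simp add: d_def sum_subtractf)
  qed
  \<comment> \<open>\<open>M\<close> bounds the number of pairs of a cluster near \<open>y k\<close>
    and a multi-index; half of \<open>\<epsilon>\<close> is spread over these pairs, and the other
    half is kept for the clusters below n0.\<close>
  define M where "M = real (card Z * N * card J)"
  define \<epsilon>' where "\<epsilon>' = \<epsilon> / (2 * (M + 1))"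
  have M0: "M \<ge> 0" by (simp add: M_def)
  have \<epsilon>': "\<epsilon>' > 0" "M * \<epsilon>' < \<epsilon> / 2" using \<epsilon> M0 by (auto simp: \<epsilon>'_def field_simps)
  have "\<forall>\<^sub>F n in sequentially. \<forall>j\<in>J. \<forall>k. cmod (d j n k) \<le> \<epsilon>'"
  proof (rule eventually_ball_finite[OF J], rule ballI)
    fix j assume j: "j \<in> J"
    have "\<forall>\<^sub>F n in sequentially. \<forall>y. cmod ((\<Sum>\<^sub>\<infinity>s\<in>Ls n. p j s * \<psi> j (s - y)) - (\<Sum>\<^sub>\<infinity>t\<in>Gs n. q j t * \<psi> j (t - y))) \<le> \<epsilon>'"
      by (rule matched_sums_uniformly_small[OF \<psi>(1)[OF j] \<psi>(2)[OF j] bd diam match[OF j] p(1)[OF j] p(2)[OF j] q(1)[OF j] q(2)[OF j] \<epsilon>'(1)])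
    then show "\<forall>\<^sub>F n in sequentially. \<forall>k. cmod (d j n k) \<le> \<epsilon>'"
      by eventually_elim (simp add: d_def)
  qed
  then obtain n0 where n0: "\<And>n j k. n \<ge> n0 \<Longrightarrow> j \<in> J \<Longrightarrow> cmod (d j n k) \<le> \<epsilon>'"
    unfolding eventually_sequentially by blast
  \<comment> \<open>For a fixed n the two sums tend to 0 separately, with no use of
    matching.\<close>
  have "(\<lambda>k. d j n k) \<longlonglongrightarrow> 0 - 0" if j: "j \<in> J" for j n
    unfolding d_def
    by (intro tendsto_diff escaping_sum_tendsto_0[OF p(1)[OF j] B[OF j] \<psi>(2)[OF j] y(1)]
        escaping_sum_tendsto_0[OF q(1)[OF j] B[OF j] \<psi>(2)[OF j] y(1)])
  then have "(\<lambda>k. \<Sum>n<n0. \<Sum>j\<in>J. cmod (d j n k)) \<longlonglongrightarrow> 0"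
    by (intro tendsto_null_sum tendsto_norm_zero) simp
  then have "\<forall>\<^sub>F k in sequentially. (\<Sum>n<n0. \<Sum>j\<in>J. cmod (d j n k)) < \<epsilon> / 2"
    by (rule order_tendstoD(2)) (use \<epsilon> in simp)
  with y(2) have "\<forall>\<^sub>F k in sequentially. norm (S k - T k - 0) < \<epsilon>"
  proof eventually_elim
    case (elim k)
    note fin = I(1)[OF elim(1)] and card = I(2)[OF elim(1)]
    have "cmod (S k - T k) \<le> (\<Sum>n\<in>I k. \<Sum>j\<in>J. cmod (d j n k))"
      unfolding dec[OF elim(1)] by (intro sum_norm_le order.refl)
    also have "\<dots> \<le> (\<Sum>n\<in>{..<n0} \<union> {n \<in> I k. n0 \<le> n}. \<Sum>j\<in>J. cmod (d j n k))"
      using fin by (intro sum_mono2) (auto intro: sum_nonneg)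
    also have "\<dots> = (\<Sum>n<n0. \<Sum>j\<in>J. cmod (d j n k)) + (\<Sum>n\<in>{n \<in> I k. n0 \<le> n}. \<Sum>j\<in>J. cmod (d j n k))"
      using fin by (intro sum.union_disjoint) auto
    also have "(\<Sum>n\<in>{n \<in> I k. n0 \<le> n}. \<Sum>j\<in>J. cmod (d j n k)) \<le> (\<Sum>n\<in>{n \<in> I k. n0 \<le> n}. \<Sum>j\<in>J. \<epsilon>')"
      using n0 by (intro sum_mono) auto
    also have "\<dots> = real (card {n \<in> I k. n0 \<le> n}) * (card J * \<epsilon>')" by simp
    also have "\<dots> \<le> real (card Z * N) * (card J * \<epsilon>')"
    proof (intro mult_right_mono)
      have "card {n \<in> I k. n0 \<le> n} \<le> card (I k)" using fin by (intro card_mono) auto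
      then show "real (card {n \<in> I k. n0 \<le> n}) \<le> real (card Z * N)" using card by linarith
    qed (use \<epsilon>' in auto)
    also have "\<dots> = M * \<epsilon>'" by (simp add: M_def)
    finally show ?case using elim(2) \<epsilon>'(2) by simp
  qed
  then show "\<exists>no. \<forall>k\<ge>no. norm (S k - T k - 0) < \<epsilon>" by (simp add: eventually_sequentially)
qed

section \<open>Recovering the coefficients\<close>

lemma closed_distr_support: "closed (distr_support f)"
proof -
  define P where "P U \<longleftrightarrow> (\<exists>\<phi>\<in>test_functions. (\<exists>K. compact K \<and> K \<subseteq> U \<and> (\<forall>y. y \<notin> K \<longrightarrow> \<phi> y = 0)) \<and> f \<phi> \<noteq> 0)" for U
  have "- distr_support f = \<Union>{U. open U \<and> \<not> P U}"
    by (auto simp: distr_support_def P_def[symmetric])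
  then show ?thesis by (simp only: closed_def) auto
qed

text \<open>The point \<open>x\<close> may lie outside A. Closedness excludes that A accumulates at
  such a point, and discreteness excludes it at the points of A.\<close>

lemma closed_discrete_isolating_ball:
  fixes A :: "'a::metric_space set"
  assumes "closed A" "discrete A"
  obtains \<epsilon> where "\<epsilon> > 0" "A \<inter> ball x \<epsilon> \<subseteq> {x}"
proof -
  have "\<not> x islimpt A"
    using assms closed_limpt discreteD isolated_in_islimpt_iff by blast
  then obtain \<epsilon> where "\<epsilon> > 0" "\<forall>y\<in>A. y \<noteq> x \<longrightarrow> \<epsilon> \<le> dist y x"
    by (auto simp: islimpt_approachable not_less)
  then show ?thesis by (intro that[of \<epsilon>]) (auto simp: dist_commute)
qed

lemma vderiv_pow_monomial:
  "(vderiv ^^ k) (\<lambda>x. of_real x ^ a / fact a) = (\<lambda>x. if k \<le> a then of_real x ^ (a - k) / fact (a - k) else 0)"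
proof (induction k)
  case (Suc k)
  have d: "vderiv (\<lambda>x. of_real x ^ n / fact n) = (\<lambda>x. if n = 0 then 0 else of_real x ^ (n - 1) / fact (n - 1))" for n
  proof (rule vderivI)
    fix x :: real
    have "((\<lambda>z. z ^ n / fact n) has_field_derivative of_nat n * of_real x ^ (n - 1) / fact n) (at (complex_of_real x))"
      by (auto intro!: derivative_eq_intros)
    from has_vector_derivative_real_field[OF this]
    have "((\<lambda>x. complex_of_real x ^ n / fact n) has_vector_derivative of_nat n * of_real x ^ (n - 1) / fact n) (at x)" .
    moreover have "of_nat n * complex_of_real x ^ (n - 1) / fact n = (if n = 0 then 0 else of_real x ^ (n - 1) / fact (n - 1))"
      by (cases n) (auto simp del: of_nat_Suc)
    ultimately show "((\<lambda>x. complex_of_real x ^ n / fact n) has_vector_derivative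
        (if n = 0 then 0 else of_real x ^ (n - 1) / fact (n - 1))) (at x)" by simp
  qed
  show ?case
  proof (cases "k \<le> a")
    case True
    then have "(vderiv ^^ Suc k) (\<lambda>x. of_real x ^ a / fact a) = vderiv (\<lambda>x. of_real x ^ (a - k) / fact (a - k))"
      using Suc by simp
    also have "\<dots> = (\<lambda>x. if Suc k \<le> a then of_real x ^ (a - Suc k) / fact (a - Suc k) else 0)"
      unfolding d using True by (auto simp: fun_eq_iff)
    finally show ?thesis .
  qed (use Suc in \<open>simp add: vderiv_const\<close>)
qed simp

text \<open>The function x^a / a! times a cutoff that is 1 near 0: at 0 it has the jet of the
  monomial, in which only the derivative of order a survives, with value 1.\<close>

lemma localized_monomial_exists:
  assumes "\<delta> > 0"
  obtains u where "test1 u" "\<And>x. 2 * \<delta> \<le> \<bar>x\<bar> \<Longrightarrow> u x = 0" "\<And>k. (vderiv ^^ k) u 0 = (if k = a then 1 else 0)"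
proof -
  obtain \<kappa> :: "real \<Rightarrow> real" where \<kappa>: "smooth1 (\<lambda>x. of_real (\<kappa> x))"
    "\<And>x. \<bar>x\<bar> \<le> 1 \<Longrightarrow> \<kappa> x = 1" "\<And>x. \<bar>x\<bar> \<ge> 2 \<Longrightarrow> \<kappa> x = 0"
    using smooth_cutoff_exists by metis
  define u where "u x = (1 / fact a) * (complex_of_real x ^ a) * of_real (\<kappa> (x / \<delta>))" for x
  have z: "u x = 0" if "2 * \<delta> \<le> \<bar>x\<bar>" for x
    using \<kappa>(3)[of "x / \<delta>"] that assms by (simp add: u_def abs_divide field_simps)
  have sm: "smooth1 u"
    unfolding u_def[abs_def] using smooth1_affine(1)[OF \<kappa>(1), of "1 / \<delta>" 0]
    by (intro smooth1_mult smooth1_power smooth1_of_real smooth1_const) simp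
  have "test1 u" unfolding test1_def using sm z by (intro conjI exI[of _ "2 * \<delta>"]) auto
  moreover have "(vderiv ^^ k) u 0 = (if k = a then 1 else 0)" for k
  proof -
    have "(vderiv ^^ k) u 0 = (vderiv ^^ k) (\<lambda>x. of_real x ^ a / fact a) 0"
    proof (rule vderiv_pow_cong_open[of "ball 0 \<delta>"])
      show "u y = of_real y ^ a / fact a" if "y \<in> ball 0 \<delta>" for y
        using that assms by (simp add: u_def \<kappa>(2) abs_divide)
    qed (use assms in auto)
    then show ?thesis by (auto simp: vderiv_pow_monomial)
  qed
  ultimately show ?thesis using z that by blast
qed

lemma finite_mnorm_le: "finite {j :: nat ^ 'd::finite. mnorm j \<le> m}"
proof -
  have "{j :: nat ^ 'd. mnorm j \<le> m} \<subseteq> vec_lambda ` (UNIV \<rightarrow>\<^sub>E {..m})"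
  proof
    fix j :: "nat ^ 'd" assume "j \<in> {j. mnorm j \<le> m}"
    then have "($) j \<in> UNIV \<rightarrow>\<^sub>E {..m}" by (simp add: mnorm_def PiE_def Pi_def)
    moreover have "j = vec_lambda (($) j)" by simp
    ultimately show "j \<in> vec_lambda ` (UNIV \<rightarrow>\<^sub>E {..m})" by blast
  qed
  then show ?thesis by (rule finite_subset) (intro finite_imageI finite_PiE; simp)
qed

section \<open>Delta series on translates of tensor products\<close>

lemma test1_translate:
  assumes "test1 u" shows "test1 (\<lambda>y. u (y - t))"
proof -
  obtain \<rho> where \<rho>: "\<And>x. \<rho> < \<bar>x\<bar> \<Longrightarrow> u x = 0" using assms by (auto simp: test1_def)
  have "smooth1 (\<lambda>y. u (y - t))"
    using smooth1_affine(1)[of u 1 "- t"] assms by (simp add: test1_def)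
  moreover have "u (x - t) = 0" if "\<rho> + \<bar>t\<bar> < \<bar>x\<bar>" for x by (rule \<rho>) (use that in linarith)
  ultimately show ?thesis unfolding test1_def by blast
qed

lemma mderiv_tensor_translate:
  assumes "\<And>i. smooth1 (u i)"
  shows "mderiv j (tensor (\<lambda>i y. u i (y - t $ i))) s = mderiv j (tensor u) (s - t)"
proof -
  have a: "(vderiv ^^ n) (\<lambda>y. u i (y - c)) = (\<lambda>y. (vderiv ^^ n) (u i) (y - c))"
    and b: "smooth1 (\<lambda>y. u i (y - c))" for n i c
    using vderiv_pow_affine[OF assms, of n i 1 "- c"] smooth1_affine(1)[OF assms, of i 1 "- c"] by simp_all
  show ?thesis by (simp add: mderiv_tensor assms a b) (simp add: tensor_def)
qed

text \<open>The value at \<open>tensor u\<close> of the j-th derivative of the unit mass at z; the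
  sign is the one from the definition of distributional derivatives.\<close>

abbreviation jet_test :: "('d::finite \<Rightarrow> real \<Rightarrow> complex) \<Rightarrow> nat ^ 'd \<Rightarrow> real ^ 'd \<Rightarrow> complex" where
  "jet_test u j z \<equiv> (- 1) ^ (\<Sum>i\<in>UNIV. j $ i) * mderiv j (tensor u) z"

lemma delta_series_translate:
  assumes f: "is_delta_series m L p f" and u: "\<And>i. test1 (u i)"
  shows "((\<lambda>s. \<Sum>j\<in>{j. mnorm j \<le> m}. p s j * jet_test u j (s - t))
    has_sum f (tensor (\<lambda>i y. u i (y - t $ i)))) L"
proof -
  have "tensor (\<lambda>i y. u i (y - t $ i)) \<in> test_functions"
    by (intro tensor_in_test_functions test1_translate u)
  moreover have "\<And>i. smooth1 (u i)" using u by (simp add: test1_def)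
  ultimately show ?thesis
    using f[unfolded is_delta_series_def, rule_format, of "tensor (\<lambda>i y. u i (y - t $ i))"]
    by (simp add: distr_deriv_def delta_def mderiv_tensor_translate[where u = u])
qed

lemma jet_test_eq_0:
  assumes u: "\<And>i. test1 (u i)" and z: "\<And>i x. \<rho> < \<bar>x\<bar> \<Longrightarrow> u i x = 0" and x: "\<rho> < \<bar>x $ i\<bar>"
  shows "jet_test u j x = 0"
proof -
  have "(vderiv ^^ (j $ i)) (u i) (x $ i) = (vderiv ^^ (j $ i)) (\<lambda>_. 0) (x $ i)"
    by (rule vderiv_pow_cong_open[of "{y. \<rho> < \<bar>y\<bar>}"])
       (use z x in \<open>auto intro!: open_Collect_less continuous_intros\<close>)
  also have "(vderiv ^^ n) (\<lambda>_. 0) = (\<lambda>_. 0)" for n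
    by (induction n) (simp_all add: vderiv_const)
  finally have "(vderiv ^^ (j $ i)) (u i) (x $ i) = 0" .
  then have "mderiv j (tensor u) x = 0"
    using u by (subst mderiv_tensor) (auto simp: test1_def tensor_def intro!: prod_zero)
  then show ?thesis by simp
qed

lemma continuous_on_jet_test:
  assumes "\<And>i. smooth1 (u i)" shows "continuous_on UNIV (jet_test u j)"
proof -
  have "mderiv j (tensor u) differentiable (at x)" for x
    unfolding mderiv_eq_foldr by (intro smooth_differentiable smooth_foldr smooth_tensor assms)
  then have "continuous_on UNIV (mderiv j (tensor u))"
    by (auto intro: continuous_at_imp_continuous_on differentiable_imp_continuous_within)
  then show ?thesis by (intro continuous_intros)
qed

lemma norm_ge_imp_component:
  fixes x :: "real ^ 'd::finite"
  assumes "real CARD('d) * c < norm x"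
  shows "\<exists>i. c < \<bar>x $ i\<bar>"
proof (rule ccontr)
  assume "\<nexists>i. c < \<bar>x $ i\<bar>"
  then have "(\<Sum>i\<in>UNIV. \<bar>x $ i\<bar>) \<le> (\<Sum>i\<in>(UNIV :: 'd set). c)" by (intro sum_mono) (auto simp: not_less)
  then show False using assms norm_le_l1_cart[of x] by simp
qed

text \<open>Away from \<open>t\<close>, a point of L has distance at least
  \<open>\<epsilon>\<close>, hence some coordinate of its offset exceeds \<open>\<delta>\<close>,
  and the test function vanishes near it with all derivatives. At \<open>t\<close> the jets cancel
  every multi-index except \<open>j0\<close>.\<close>

lemma delta_series_coefficient:
  fixes u :: "'d::finite \<Rightarrow> real \<Rightarrow> complex"
  assumes f: "is_delta_series m L p f" and j0: "mnorm j0 \<le> m" and u: "\<And>i. test1 (u i)"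
    and \<epsilon>: "L \<inter> ball t \<epsilon> \<subseteq> {t}"
    and z: "\<And>i x. \<delta> < \<bar>x\<bar> \<Longrightarrow> u i x = 0" "real CARD('d) * \<delta> < \<epsilon>"
    and jet: "\<And>i k. (vderiv ^^ k) (u i) 0 = (if k = j0 $ i then 1 else 0)"
  shows "f (tensor (\<lambda>i y. u i (y - t $ i))) = (if t \<in> L then (- 1) ^ (\<Sum>i\<in>UNIV. j0 $ i) * p t j0 else 0)"
proof -
  let ?J = "{j :: nat ^ 'd. mnorm j \<le> m}"
  let ?h = "\<lambda>s. \<Sum>j\<in>?J. p s j * jet_test u j (s - t)"
  have "?h s = 0" if s: "s \<in> L - {t}" for s
  proof -
    have "\<epsilon> \<le> dist t s" using s \<epsilon> by (meson Diff_iff IntI in_mono mem_ball not_less)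
    then have "real CARD('d) * \<delta> < norm (s - t)" using z(2) by (simp add: dist_norm norm_minus_commute)
    then obtain i where "\<delta> < \<bar>(s - t) $ i\<bar>" using norm_ge_imp_component by blast
    then have "jet_test u j (s - t) = 0" for j
      by (intro jet_test_eq_0[where u = u and \<rho> = \<delta> and i = i] u z(1))
    then show ?thesis by simp
  qed
  then have "(?h has_sum f (tensor (\<lambda>i y. u i (y - t $ i)))) (L \<inter> {t})"
    by (subst has_sum_cong_neutral[where g = ?h and T = L]) (auto intro: delta_series_translate[OF f u])
  then have "f (tensor (\<lambda>i y. u i (y - t $ i))) = (if t \<in> L then ?h t else 0)"
    using infsumI by fastforce
  moreover have "?h t = (- 1) ^ (\<Sum>i\<in>UNIV. j0 $ i) * p t j0"
  proof -
    have sm: "\<And>i. smooth1 (u i)" using u by (simp add: test1_def)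
    have "mderiv j (tensor u) 0 = (if j = j0 then 1 else 0)" for j
    proof -
      have "mderiv j (tensor u) 0 = (\<Prod>i\<in>UNIV. if j $ i = j0 $ i then 1 else 0)"
        by (simp add: mderiv_tensor[OF sm] tensor_def jet)
      also have "\<dots> = (if j = j0 then 1 else 0)"
      proof (cases "j = j0")
        case False
        then obtain i where "j $ i \<noteq> j0 $ i" by (auto simp: vec_eq_iff)
        then show ?thesis using False by (auto intro!: prod_zero)
      qed simp
      finally show ?thesis .
    qed
    then have "?h t = (\<Sum>j\<in>?J. if j = j0 then (- 1) ^ (\<Sum>i\<in>UNIV. j0 $ i) * p t j0 else 0)"
      by (intro sum.cong) auto
    then show ?thesis using j0 by (simp add: finite_mnorm_le)
  qed
  ultimately show ?thesis by simp
qed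

text \<open>Hypothesis (v) is stated with sums in \<open>ennreal\<close>, where divergence shows as
  infinity, while a divergent real \<open>infsum\<close> would be 0 by default. Finite partial sums
  carry the bound over and yield summability as well.\<close>

lemma ennreal_infsum_bound:
  fixes c :: "'a \<Rightarrow> real"
  assumes c: "\<And>s. 0 \<le> c s" and K: "(\<Sum>\<^sub>\<infinity>s\<in>A. ennreal (c s)) \<le> ennreal K" "0 \<le> K"
  shows "c summable_on A" "(\<Sum>\<^sub>\<infinity>s\<in>A. c s) \<le> K"
proof -
  have le: "(\<Sum>s\<in>F. c s) \<le> K" if F: "finite F" "F \<subseteq> A" for F
  proof -
    have "ennreal (\<Sum>s\<in>F. c s) = (\<Sum>s\<in>F. ennreal (c s))" using c by (simp add: sum_ennreal)
    also have "\<dots> \<le> (\<Sum>\<^sub>\<infinity>s\<in>A. ennreal (c s))"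
      unfolding nonneg_infsum_complete[of A "\<lambda>s. ennreal (c s)", OF zero_le] using F by (intro SUP_upper) simp
    also have "\<dots> \<le> ennreal K" by (rule K)
    finally show ?thesis using K(2) by simp
  qed
  show s: "c summable_on A"
    by (rule nonneg_bdd_above_summable_on[OF c]) (auto intro!: bdd_aboveI2[where M = K] le)
  show "(\<Sum>\<^sub>\<infinity>s\<in>A. c s) \<le> K" by (rule infsum_le_finite_sums[OF s le])
qed

lemma Max_SUP_ennreal_finite:
  fixes c :: "nat \<Rightarrow> 'j \<Rightarrow> 'a \<Rightarrow> real"
  assumes "finite J" "(MAX j\<in>J. SUP n. \<Sum>\<^sub>\<infinity>s\<in>A n. ennreal (c n j s)) < \<infinity>" "\<And>n j s. 0 \<le> c n j s"
  obtains K where "\<And>n j. j \<in> J \<Longrightarrow> c n j summable_on A n" "\<And>n j. j \<in> J \<Longrightarrow> (\<Sum>\<^sub>\<infinity>s\<in>A n. c n j s) \<le> K"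
proof -
  define M where "M = (MAX j\<in>J. SUP n. \<Sum>\<^sub>\<infinity>s\<in>A n. ennreal (c n j s))"
  have le: "(\<Sum>\<^sub>\<infinity>s\<in>A n. ennreal (c n j s)) \<le> ennreal (enn2real M)" if "j \<in> J" for n j
  proof -
    have "(\<Sum>\<^sub>\<infinity>s\<in>A n. ennreal (c n j s)) \<le> (SUP n. \<Sum>\<^sub>\<infinity>s\<in>A n. ennreal (c n j s))"
      by (rule SUP_upper) simp
    also have "\<dots> \<le> M" unfolding M_def using assms(1) that by (intro Max_ge) auto
    also have "\<dots> = ennreal (enn2real M)" using assms(2) by (simp add: M_def)
    finally show ?thesis .
  qed
  show ?thesis
    by (rule that[of "enn2real M"]) (rule ennreal_infsum_bound[OF assms(3) le], assumption, simp)+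
qed

text \<open>Both coefficient families are extended by 0 to the whole space, so that the comparison
  also covers points that lie in only one of L and G.\<close>

lemma coefficients_determine_delta_series:
  fixes f g :: "(real ^ 'd::finite \<Rightarrow> complex) \<Rightarrow> complex"
  assumes f: "is_delta_series m L p f" and g: "is_delta_series m G q g"
    and eq: "\<And>t j. mnorm j \<le> m \<Longrightarrow> (if t \<in> L then p t j else 0) = (if t \<in> G then q t j else 0)"
    and \<phi>: "\<phi> \<in> test_functions"
  shows "f \<phi> = g \<phi>"
proof -
  let ?J = "{j :: nat ^ 'd. mnorm j \<le> m}"
  have ext: "((\<lambda>s. \<Sum>j\<in>?J. (if s \<in> A then c s j else 0) * distr_deriv j (delta s) \<phi>) has_sum F \<phi>) UNIV"
    if "is_delta_series m A c F" for A c and F :: "(real ^ 'd \<Rightarrow> complex) \<Rightarrow> complex"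
    using that \<phi> unfolding is_delta_series_def
    by (subst has_sum_cong_neutral[where T = A and g = "\<lambda>s. \<Sum>j\<in>?J. c s j * distr_deriv j (delta s) \<phi>"]) auto
  have "(\<Sum>j\<in>?J. (if s \<in> L then p s j else 0) * distr_deriv j (delta s) \<phi>)
      = (\<Sum>j\<in>?J. (if s \<in> G then q s j else 0) * distr_deriv j (delta s) \<phi>)" for s
    by (intro sum.cong) (simp_all only: eq mem_Collect_eq)
  then show ?thesis using infsumI[OF ext[OF f]] infsumI[OF ext[OF g]] by simp
qed

theorem theorem4:
  fixes m :: nat
    and f g :: "(real ^ 'd::finite \<Rightarrow> complex) \<Rightarrow> complex"
    and \<Lambda> \<Gamma> E :: "(real ^ 'd) set"
    and p q :: "real ^ 'd \<Rightarrow> nat ^ 'd \<Rightarrow> complex"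
    and \<mu> \<nu> :: "(real ^ 'd) set \<Rightarrow> complex"
    and \<Lambda>s \<Gamma>s :: "nat \<Rightarrow> (real ^ 'd) set"
    and x :: "nat \<Rightarrow> real ^ 'd" and r :: "nat \<Rightarrow> real"
    and N :: nat
  assumes f: "tempered_distribution f" "is_delta_series m \<Lambda> p f"
    and g: "tempered_distribution g" "is_delta_series m \<Gamma> q g"
    and \<Lambda>: "\<Lambda> = distr_support f" "discrete \<Lambda>"
    and \<Gamma>: "\<Gamma> = distr_support g" "discrete \<Gamma>"
    and \<mu>: "distr_is_measure (fourier_distr f) \<mu>" "atomic_measure \<mu>"
      "tempered_measure (total_variation \<mu>)"
    and \<nu>: "distr_is_measure (fourier_distr g) \<nu>" "atomic_measure \<nu>"
      "tempered_measure (total_variation \<nu>)"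
    and disj: "disjoint_family \<Lambda>s" "disjoint_family \<Gamma>s"
    and i: "filterlim r at_top sequentially"
      "\<forall>\<^sub>F k in sequentially. x k \<noteq> 0" "(\<lambda>k. r k / norm (x k)) \<longlonglongrightarrow> 0"
      "(\<Union>k. ball (x k) (r k)) \<subseteq> E"
    and ii: "\<Lambda> \<inter> E = (\<Union>n. \<Lambda>s n)" "\<Gamma> \<inter> E = (\<Union>n. \<Gamma>s n)"
    and iii: "\<forall>y\<in>E. finite {n. (\<Lambda>s n \<union> \<Gamma>s n) \<inter> ball y 1 \<noteq> {}} \<and>
      card {n. (\<Lambda>s n \<union> \<Gamma>s n) \<inter> ball y 1 \<noteq> {}} \<le> N"
    and iv: "\<forall>\<^sub>F n in sequentially. bounded (\<Lambda>s n \<union> \<Gamma>s n)"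
      "(\<lambda>n. diameter (\<Lambda>s n \<union> \<Gamma>s n)) \<longlonglongrightarrow> 0"
      "\<forall>j. mnorm j \<le> m \<longrightarrow>
        (\<lambda>n. (\<Sum>\<^sub>\<infinity>s\<in>\<Lambda>s n. p s j) - (\<Sum>\<^sub>\<infinity>t\<in>\<Gamma>s n. q t j)) \<longlonglongrightarrow> 0"
    and v: "(MAX j\<in>{j. mnorm j \<le> m}. SUP n. \<Sum>\<^sub>\<infinity>s\<in>\<Lambda>s n. ennreal (cmod (p s j))) < \<infinity>"
      "(MAX j\<in>{j. mnorm j \<le> m}. SUP n. \<Sum>\<^sub>\<infinity>t\<in>\<Gamma>s n. ennreal (cmod (q t j))) < \<infinity>"
  shows "\<forall>\<phi>\<in>schwartz_space. f \<phi> = g \<phi>"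
proof -
  let ?J = "{j :: nat ^ 'd. mnorm j \<le> m}"
  have J: "finite ?J" by (rule finite_mnorm_le)
  obtain Kp where Kp: "\<And>n j. j \<in> ?J \<Longrightarrow> (\<lambda>s. cmod (p s j)) summable_on \<Lambda>s n"
    "\<And>n j. j \<in> ?J \<Longrightarrow> (\<Sum>\<^sub>\<infinity>s\<in>\<Lambda>s n. cmod (p s j)) \<le> Kp"
    using Max_SUP_ennreal_finite[OF J v(1) norm_ge_zero] by metis
  obtain Kq where Kq: "\<And>n j. j \<in> ?J \<Longrightarrow> (\<lambda>s. cmod (q s j)) summable_on \<Gamma>s n"
    "\<And>n j. j \<in> ?J \<Longrightarrow> (\<Sum>\<^sub>\<infinity>s\<in>\<Gamma>s n. cmod (q s j)) \<le> Kq"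
    using Max_SUP_ennreal_finite[OF J v(2) norm_ge_zero] by metis
  define K where "K = max Kp Kq"
  \<comment> \<open>As r k tends to infinity and is eventually at most |x k|, the centres tend to
    infinity too.\<close>
  have x_inf: "filterlim (\<lambda>k. norm (x k)) at_top sequentially"
  proof (rule filterlim_at_top_mono[OF i(1)])
    have "\<forall>\<^sub>F k in sequentially. r k / norm (x k) < 1" using i(3) by (rule order_tendstoD(2)) simp
    with i(2) show "\<forall>\<^sub>F k in sequentially. r k \<le> norm (x k)"
      by eventually_elim (simp add: divide_less_eq)
  qed
  have translates: "f (tensor (\<lambda>i y. u i (y - t $ i))) = g (tensor (\<lambda>i y. u i (y - t $ i)))"
    if u: "\<And>i. test1 (u i)" for u :: "'d \<Rightarrow> real \<Rightarrow> complex" and t :: "real ^ 'd"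
  proof -
    have us: "\<And>i. schwartz1 (u i)" "\<And>i. smooth1 (u i)" using u test1_schwartz1 by (auto simp: test1_def)
    obtain \<beta> where \<beta>: "(\<lambda>s. cmod (\<beta> s)) summable_on UNIV"
      "\<And>t. ((\<lambda>s. \<beta> s * exp (2 * pi * \<i> * (s \<bullet> t))) has_sum f (tensor (\<lambda>i y. u i (y - t $ i)))) UNIV"
      using translate_exponential_sum[where u = u, OF f(1) \<mu>(1,2,3) us(1)] by blast
    obtain \<gamma> where \<gamma>: "(\<lambda>s. cmod (\<gamma> s)) summable_on UNIV"
      "\<And>t. ((\<lambda>s. \<gamma> s * exp (2 * pi * \<i> * (s \<bullet> t))) has_sum g (tensor (\<lambda>i y. u i (y - t $ i)))) UNIV"
      using translate_exponential_sum[where u = u, OF g(1) \<nu>(1,2,3) us(1)] by blast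
    define F where "F t = f (tensor (\<lambda>i y. u i (y - t $ i))) - g (tensor (\<lambda>i y. u i (y - t $ i)))" for t
    have "\<exists>\<rho>. \<forall>i x. \<rho> i < \<bar>x\<bar> \<longrightarrow> u i x = 0" using u unfolding test1_def by metis
    then obtain \<rho>0 where \<rho>0: "\<And>i x. \<rho>0 i < \<bar>x\<bar> \<Longrightarrow> u i x = 0" by blast
    define \<rho>1 where "\<rho>1 = Max (range \<rho>0)"
    have \<rho>1: "u i x = 0" if "\<rho>1 < \<bar>x\<bar>" for i x
    proof (rule \<rho>0)
      have "\<rho>0 i \<le> \<rho>1" unfolding \<rho>1_def by (rule Max_ge) auto
      then show "\<rho>0 i < \<bar>x\<bar>" using that by simp
    qed
    \<comment> \<open>If every coordinate were at most \<open>\<rho>1\<close> in size, the norm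
      would be at most CARD('d) times \<open>\<rho>1\<close>; the additional 1 makes the excess
      strict.\<close>
    define \<rho> where "\<rho> = real CARD('d) * \<rho>1 + 1"
    have jz: "jet_test u j z = 0" if z: "\<rho> \<le> norm z" for j z
    proof -
      have "real CARD('d) * \<rho>1 < norm z" using z by (simp add: \<rho>_def)
      then obtain i where "\<rho>1 < \<bar>z $ i\<bar>" using norm_ge_imp_component by blast
      then show ?thesis by (intro jet_test_eq_0[where u = u and \<rho> = \<rho>1 and i = i] u \<rho>1)
    qed
    have lim: "(\<lambda>k. F (t + x k)) \<longlonglongrightarrow> 0" for t
      unfolding F_def
    proof (rule matched_series_difference_tendsto_0[where J = ?J and \<psi> = "jet_test u" and p = "\<lambda>j s. p s j"
          and q = "\<lambda>j s. q s j" and K = K and y = "\<lambda>k. t + x k", OF J _ jz disj ii _ _ iv(1,2)])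
      show "continuous_on UNIV (jet_test u j)" for j by (rule continuous_on_jet_test[OF us(2)])
      show "finite {n. (\<Lambda>s n \<union> \<Gamma>s n) \<inter> ball y 1 \<noteq> {}}" "card {n. (\<Lambda>s n \<union> \<Gamma>s n) \<inter> ball y 1 \<noteq> {}} \<le> N"
        if "y \<in> E" for y using iii that by blast+
      show "(\<lambda>n. (\<Sum>\<^sub>\<infinity>s\<in>\<Lambda>s n. p s j) - (\<Sum>\<^sub>\<infinity>t\<in>\<Gamma>s n. q t j)) \<longlonglongrightarrow> 0" if "j \<in> ?J" for j
        using iv(3) that by blast
      show "(\<lambda>s. cmod (p s j)) summable_on \<Lambda>s n" "(\<lambda>s. cmod (q s j)) summable_on \<Gamma>s n"
        "(\<Sum>\<^sub>\<infinity>s\<in>\<Lambda>s n. cmod (p s j)) \<le> K" "(\<Sum>\<^sub>\<infinity>s\<in>\<Gamma>s n. cmod (q s j)) \<le> K" if "j \<in> ?J" for j n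
        using Kp[OF that, of n] Kq[OF that, of n] by (auto simp: K_def)
      show "filterlim (\<lambda>k. t + x k) at_infinity sequentially"
        by (rule tendsto_add_filterlim_at_infinity[OF tendsto_const
              filterlim_norm_at_top_imp_at_infinity[OF x_inf]])
      \<comment> \<open>The growing radii swallow the fixed shift t and the fixed support radius, so
        the ball that the translate sees lies in E for every t.\<close>
      have "\<forall>\<^sub>F k in sequentially. norm t + \<rho> < r k"
        using i(1) by (simp add: filterlim_at_top_dense)
      then show "\<forall>\<^sub>F k in sequentially. cball (t + x k) \<rho> \<subseteq> E"
      proof eventually_elim
        case (elim k)
        have "cball (t + x k) \<rho> \<subseteq> ball (x k) (r k)"
        proof
          fix z assume "z \<in> cball (t + x k) \<rho>"
          moreover have "dist (x k) z \<le> dist (x k) (t + x k) + dist (t + x k) z" by (rule dist_triangle)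
          ultimately show "z \<in> ball (x k) (r k)" using elim by (simp add: dist_norm)
        qed
        then show ?case using i(4) by blast
      qed
      show "((\<lambda>s. \<Sum>j\<in>?J. p s j * jet_test u j (s - (t + x k))) has_sum f (tensor (\<lambda>i y. u i (y - (t + x k) $ i)))) \<Lambda>" for k
        by (rule delta_series_translate[OF f(2) u])
      show "((\<lambda>s. \<Sum>j\<in>?J. q s j * jet_test u j (s - (t + x k))) has_sum g (tensor (\<lambda>i y. u i (y - (t + x k) $ i)))) \<Gamma>" for k
        by (rule delta_series_translate[OF g(2) u])
    qed
    \<comment> \<open>The difference of two absolutely convergent exponential sums is one with
      coefficients \<open>\<beta> s - \<gamma> s\<close>, indexed by all points, so the atoms of the
      two transforms need not coincide beforehand.\<close>
    have "F t = 0"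
    proof (rule exponential_sum_vanishing[OF _ _ lim])
      show "((\<lambda>s. (\<beta> s - \<gamma> s) * exp (2 * pi * \<i> * (s \<bullet> t))) has_sum F t) UNIV" for t
        using has_sum_diff[OF \<beta>(2)[of t] \<gamma>(2)[of t]] by (simp add: F_def left_diff_distrib)
      show "(\<lambda>s. cmod (\<beta> s - \<gamma> s)) summable_on UNIV"
        by (rule Infinite_Sum.abs_summable_on_comparison_test'[OF summable_on_add[OF \<beta>(1) \<gamma>(1)]])
           (rule norm_triangle_ineq4)
    qed
    then show ?thesis by (simp add: F_def)
  qed
  have coeff: "(if t \<in> \<Lambda> then p t j0 else 0) = (if t \<in> \<Gamma> then q t j0 else 0)" if j0: "mnorm j0 \<le> m" for t j0
  proof -
    obtain \<epsilon>1 where \<epsilon>1: "\<epsilon>1 > 0" "\<Lambda> \<inter> ball t \<epsilon>1 \<subseteq> {t}"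
      using closed_discrete_isolating_ball[of \<Lambda> t] \<Lambda> closed_distr_support by metis
    obtain \<epsilon>2 where \<epsilon>2: "\<epsilon>2 > 0" "\<Gamma> \<inter> ball t \<epsilon>2 \<subseteq> {t}"
      using closed_discrete_isolating_ball[of \<Gamma> t] \<Gamma> closed_distr_support by metis
    \<comment> \<open>The localized monomials vanish for arguments of size at least 2 \<delta>, and
      CARD('d) times 2 \<delta> is half of the smaller isolation radius, so one test function
      isolates \<open>t\<close> in both supports.\<close>
    define \<delta> where "\<delta> = min \<epsilon>1 \<epsilon>2 / (4 * real CARD('d))"
    have \<delta>: "\<delta> > 0" "real CARD('d) * (2 * \<delta>) < \<epsilon>1" "real CARD('d) * (2 * \<delta>) < \<epsilon>2"
      using \<epsilon>1(1) \<epsilon>2(1) by (auto simp: \<delta>_def field_simps min_def)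
    have "\<exists>u. \<forall>i. test1 (u i) \<and> (\<forall>x. 2 * \<delta> \<le> \<bar>x\<bar> \<longrightarrow> u i x = 0)
        \<and> (\<forall>k. (vderiv ^^ k) (u i) 0 = (if k = j0 $ i then 1 else 0))"
      by (rule choice, rule allI) (use localized_monomial_exists[OF \<delta>(1)] in metis)
    then obtain u where u: "\<And>i. test1 (u i)" "\<And>i x. 2 * \<delta> < \<bar>x\<bar> \<Longrightarrow> u i x = 0"
      "\<And>i k. (vderiv ^^ k) (u i) 0 = (if k = j0 $ i then 1 else 0)" by (metis less_imp_le)
    have "f (tensor (\<lambda>i y. u i (y - t $ i))) = (if t \<in> \<Lambda> then (- 1) ^ (\<Sum>i\<in>UNIV. j0 $ i) * p t j0 else 0)"
      by (rule delta_series_coefficient[where u = u, OF f(2) j0 u(1) \<epsilon>1(2) _ \<delta>(2) u(3)]) (rule u(2))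
    moreover have "g (tensor (\<lambda>i y. u i (y - t $ i))) = (if t \<in> \<Gamma> then (- 1) ^ (\<Sum>i\<in>UNIV. j0 $ i) * q t j0 else 0)"
      by (rule delta_series_coefficient[where u = u, OF g(2) j0 u(1) \<epsilon>2(2) _ \<delta>(3) u(3)]) (rule u(2))
    ultimately show ?thesis
      using translates[where u = u and t = t, OF u(1)] by (auto split: if_splits)
  qed
  show ?thesis
  proof
    fix \<phi> :: "real ^ 'd \<Rightarrow> complex" assume "\<phi> \<in> schwartz_space"
    then obtain \<phi>s where \<phi>s: "\<And>n. \<phi>s n \<in> test_functions"
      "\<And>f. tempered_distribution f \<Longrightarrow> (\<lambda>n. f (\<phi>s n)) \<longlonglongrightarrow> f \<phi>"
      using test_functions_dense by blast
    \<comment> \<open>The delta series speaks about test functions only; equality on Schwartz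
      functions comes from passing to the limit along the common approximating sequence.\<close>
    have "(\<lambda>n. f (\<phi>s n)) = (\<lambda>n. g (\<phi>s n))"
      using coefficients_determine_delta_series[OF f(2) g(2) coeff \<phi>s(1)] by simp
    then show "f \<phi> = g \<phi>" using \<phi>s(2)[OF f(1)] \<phi>s(2)[OF g(1)] LIMSEQ_unique by metis
  qed
qed

end
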